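(* Let $\Psi=(\Psi_1\ \Psi_2)\in\mathcal{RH}_\infty^{n_s\times(n_q+n_p)}$ with $\Psi_1\in\mathcal{RH}_\infty^{n_s\times n_q}$, $\Psi_2\in\mathcal{RH}_\infty^{n_s\times n_p}$, minimal realization $\Psi=[A_\Psi,B_\Psi,C_\Psi,D_\Psi]$, and $M\in\mathbb{S}^{n_s}$, and suppose that for all $\zeta\in\partial\mathbb D$: $$\Psi_1^*M\Psi_1\succ0,\qquad \Psi_2^*M\Psi_2-\Psi_2^*M\Psi_1(\Psi_1^*M\Psi_1)^{-1}\Psi_1^*M\Psi_2\prec0.$$ Let $\hat M=\operatorname{diag}(I_{n_q},-I_{n_p})$. Then there exists $\hat\Psi\in\mathcal{RH}_\infty^{(n_q+n_p)\times(n_q+n_p)}$ with $\hat\Psi^*\hat M\hat\Psi=\Psi^*M\Psi$ and a realization of the form $$\hat\Psi=\begin{pmatrix}\hat\Psi_{11}&\hat\Psi_{12}\\0&\hat\Psi_{22}\end{pmatrix}=[\hat A,\hat B,\hat C,\hat D],\quad \hat A=\begin{pmatrix}\hat A_1&0\\0&\hat A_2\end{pmatrix},\ \hat B=\begin{pmatrix}\hat B_1&0\\0&\hat B_2\end{pmatrix},\ \hat C=\begin{pmatrix}\hat C_{11}&\hat C_{12}\\0&\hat C_{22}\end{pmatrix},\ \hat D=\begin{pmatrix}\hat D_{11}&\hat D_{12}\\0&\hat D_{22}\end{pmatrix},$$ where $\hat\Psi_{22}=[\hat A_2,\hat B_2,\hat C_{22},\hat D_{22}]\in\mathcal{RH}_\infty^{n_p\times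 n_p}$ has a stable inverse, $\hat\Psi_{22}^{-1}\in\mathcal{RH}_\infty^{n_p\times n_p}$. Moreover, there exist matrices $\hat C_\Psi\in\mathbb{R}^{n_s\times n_{\hat\psi}}$ and $Z\in\mathbb{S}^{n_{\hat\psi}}$ ($n_{\hat\psi}$ the dimension of $\hat A$) such that $\Psi=[\hat A,\hat B,\hat C_\Psi,D_\Psi]$ and $$\begin{pmatrix}I&0\\\hat A&\hat B\\\hat C&\hat D\end{pmatrix}^{\!\top}\operatorname{diag}(-Z,\;Z,\;\hat M)\begin{pmatrix}I&0\\\hat A&\hat B\\\hat C&\hat D\end{pmatrix}=\begin{pmatrix}\hat C_\Psi&D_\Psi\end{pmatrix}^{\!\top}M\begin{pmatrix}\hat C_\Psi&D_\Psi\end{pmatrix}.$$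
   Context: $\mathbb D=\{\lambda\in\mathbb C:|\lambda|<1\}$, $\partial\mathbb D$ the unit circle. For matrices $(A,B,C,D)$, $[A,B,C,D](\zeta)=C(\zeta I-A)^{-1}B+D$. $\mathcal{RH}_\infty$ is the set of transfer matrices $[A,B,C,D]$ with all eigenvalues of $A$ in $\mathbb D$ (proper, stable, rational, discrete time). For a transfer matrix $G$, $G^*(\zeta)=G(\zeta^{-1})^\top$. $\mathbb{S}^n$ denotes symmetric $n\times n$ matrices; inequalities $\succ,\prec$ are in the sense of positive/negative definiteness (for Hermitian matrices on $\partial\mathbb D$). *)

theory Defs
  imports "HOL-Analysis.Analysis" "Jordan_Normal_Form.Matrix" "Jordan_Normal_Form.Determinant"
    "Jordan_Normal_Form.Char_Poly"
begin

type_synonym rlz = "real mat \<times> real mat \<times> real mat \<times> real mat"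

definition cm :: "real mat \<Rightarrow> complex mat" where
  "cm X = map_mat complex_of_real X"

definition minv :: "complex mat \<Rightarrow> complex mat" where
  "minv X = (1 / det X) \<cdot>\<^sub>m adj_mat X"

definition hcat :: "'a::zero mat \<Rightarrow> 'a mat \<Rightarrow> 'a mat" where
  "hcat X Y = four_block_mat X Y (0\<^sub>m 0 (dim_col X)) (0\<^sub>m 0 (dim_col Y))"

definition cadj :: "complex mat \<Rightarrow> complex mat" where
  "cadj H = transpose_mat (map_mat cnj H)"

definition wf_rlz :: "rlz \<Rightarrow> bool" where
  "wf_rlz R = (case R of (A,B,C,D) \<Rightarrow>
     A \<in> carrier_mat (dim_row A) (dim_row A) \<and> B \<in> carrier_mat (dim_row A) (dim_col D) \<and>
     C \<in> carrier_mat (dim_row D) (dim_row A) \<and> D \<in> carrier_mat (dim_row D) (dim_col D))"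

definition defined_at :: "rlz \<Rightarrow> complex \<Rightarrow> bool" where
  "defined_at R z = (case R of (A,B,C,D) \<Rightarrow> det (z \<cdot>\<^sub>m 1\<^sub>m (dim_row A) - cm A) \<noteq> 0)"

definition tf :: "rlz \<Rightarrow> complex \<Rightarrow> complex mat" where
  "tf R z = (case R of (A,B,C,D) \<Rightarrow>
     cm C * minv (z \<cdot>\<^sub>m 1\<^sub>m (dim_row A) - cm A) * cm B + cm D)"

text \<open>two realizations define the same transfer matrix (equality as rational functions,
  i.e. equality wherever both are defined)\<close>
definition same_tf :: "rlz \<Rightarrow> rlz \<Rightarrow> bool" where
  "same_tf R R' = (\<forall>z. defined_at R z \<and> defined_at R' z \<longrightarrow> tf R z = tf R' z)"

definition schur_stable :: "real mat \<Rightarrow> bool" where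
  "schur_stable A = (\<forall>ev. eigenvalue (cm A) ev \<longrightarrow> cmod ev < 1)"

definition in_RH :: "rlz \<Rightarrow> bool" where
  "in_RH R = (\<exists>R'. wf_rlz R' \<and> schur_stable (fst R') \<and> same_tf R R')"

definition minimal_rlz :: "rlz \<Rightarrow> bool" where
  "minimal_rlz R = (wf_rlz R \<and>
     (\<forall>R'. wf_rlz R' \<and> same_tf R R' \<longrightarrow> dim_row (fst R) \<le> dim_row (fst R')))"

definition stable_inverse :: "nat \<Rightarrow> rlz \<Rightarrow> bool" where
  "stable_inverse p R = (\<exists>R'. wf_rlz R' \<and> schur_stable (fst R') \<and>
     (\<forall>z. defined_at R z \<and> defined_at R' z \<longrightarrow>
        tf R z * tf R' z = 1\<^sub>m p \<and> tf R' z * tf R z = 1\<^sub>m p))"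

definition cols_first :: "nat \<Rightarrow> 'a mat \<Rightarrow> 'a mat" where
  "cols_first k G = mat (dim_row G) k (\<lambda>(i,j). G $$ (i,j))"
definition cols_last :: "nat \<Rightarrow> nat \<Rightarrow> 'a mat \<Rightarrow> 'a mat" where
  "cols_last k l G = mat (dim_row G) l (\<lambda>(i,j). G $$ (i,k+j))"

definition pos_def :: "complex mat \<Rightarrow> bool" where
  "pos_def H = (H \<in> carrier_mat (dim_row H) (dim_row H) \<and> cadj H = H \<and>
     (\<forall>v \<in> carrier_vec (dim_row H). v \<noteq> 0\<^sub>v (dim_row H) \<longrightarrow>
        0 < Re (map_vec cnj v \<bullet> (H *\<^sub>v v))))"
definition neg_def :: "complex mat \<Rightarrow> bool" where
  "neg_def H = pos_def (- H)"

text \<open>Paraconjugate product G1^*(z) M G2(z), with G^*(z) = G(z^{-1})^T\<close>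
definition para :: "(complex \<Rightarrow> complex mat) \<Rightarrow> complex mat \<Rightarrow> (complex \<Rightarrow> complex mat) \<Rightarrow> complex \<Rightarrow> complex mat" where
  "para G1 M G2 z = transpose_mat (G1 (inverse z)) * M * G2 z"

end

theory Submission
  imports Defs "Jordan_Normal_Form.Spectral_Radius"
begin

text \<open>Let \<open>\<Pi> = \<Psi>\<^sup>* M \<Psi>\<close>, with blocks \<open>\<Pi>\<^sub>i\<^sub>j\<close>. A minimal realization of a stable transfer matrix is stable.
  Positivity of \<open>\<Pi>\<^sub>1\<^sub>1\<close> on the circle makes the associated quadratic cost coercive (Parseval for the
  finite Fourier transform and a limit of long periods), so value iteration converges to a
  stabilizing solution of the Riccati equation; this gives \<open>\<Pi>\<^sub>1\<^sub>1 = S\<^sup>* S\<close> with \<open>S\<close> and \<open>S\<^sup>-\<^sup>1\<close> stable. In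
  general \<open>S\<^sup>-\<^sup>* \<Pi>\<^sub>1\<^sub>2\<close> is not stable. Its unstable part comes from \<open>(\<Psi>\<^sub>1 S\<^sup>-\<^sup>1)\<^sup>*\<close>, which becomes stable
  after multiplication with the inner matrix \<open>U\<close> completing the balanced state equation of
  \<open>S\<^sup>-\<^sup>1\<close> to an orthogonal matrix. Hence \<open>U S\<close> and \<open>U S\<^sup>-\<^sup>* \<Pi>\<^sub>1\<^sub>2\<close> serve as the first block row. A second
  spectral factorization, of the negative of the Schur complement, yields the last block. All
  factorizations come with storage functions, which assemble to \<open>Z\<close>.\<close>

section \<open>A ring containing all matrices\<close>

text \<open>Every factorization is carried as a constant matrix identity with a storage matrix. The
  identity of transfer functions on the circle follows because storage terms cancel there, and the
  matrix equation of the theorem is the same identity assembled from blocks. The block-diagonal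
  \<open>Ah\<close> and \<open>Bh\<close> force the shape of the realization: the two input channels
  need separate states, so the state of \<Psi> is duplicated and recovered as \<open>V\<close> times
  the first state plus \<open>T\<close> times the second, which yields the output matrix
  \<open>rF C\<^sub>\<Psi> * (V + T * adj (sh n1))\<close>. The first state is the reachable part of
  the inverse spectral factor in balanced coordinates; the second stacks an auxiliary state \<xi>,
  belonging to the stable version of the cross term, on a full copy of the state of \<Psi>.
  Definiteness is assumed on the circle only, so coercivity in the time domain has to be earned;
  periodic inputs do this with finite sums in place of Fourier integrals.\<close>

text \<open>Matrices of all sizes are embedded in one unital ring, the infinite complex matrices with
  finitely supported rows and columns; an \<open>n \<times> m\<close> matrix is supported on its upper left corner
  (\<open>rw n A\<close>, \<open>cl m A\<close> below). Block matrices are sums involving the shift \<open>sh n\<close>, which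
  satisfies \<open>adj (sh n) * sh n = 1\<close>. Vectors are matrices of which only column \<open>0\<close> matters.\<close>
typedef lfm = "{f :: nat \<Rightarrow> nat \<Rightarrow> complex. (\<forall>i. finite {j. f i j \<noteq> 0}) \<and> (\<forall>j. finite {i. f i j \<noteq> 0})}"
  morphisms ent Lfm
  by (rule exI[of _ "\<lambda>i j. 0"]) auto

setup_lifting type_definition_lfm

lemma lfm_eqI: "(\<And>i j. ent A i j = ent B i j) \<Longrightarrow> A = B"
  by (metis ent_inject ext)

lemma finite_row: "finite {j. ent A i j \<noteq> 0}" and finite_col: "finite {i. ent A i j \<noteq> 0}"
  using ent[of A] by auto

lemma mult_row_support:
  "{j. (\<Sum>k\<in>{k. f i k \<noteq> (0::complex)}. f i k * g k j) \<noteq> 0} \<subseteq> (\<Union>k\<in>{k. f i k \<noteq> 0}. {j. g k j \<noteq> 0})"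
proof
  fix j assume "j \<in> {j. (\<Sum>k\<in>{k. f i k \<noteq> 0}. f i k * g k j) \<noteq> 0}"
  then obtain k where "k \<in> {k. f i k \<noteq> 0}" "f i k * g k j \<noteq> 0"
    by (metis (mono_tags, lifting) mem_Collect_eq sum.neutral)
  then show "j \<in> (\<Union>k\<in>{k. f i k \<noteq> 0}. {j. g k j \<noteq> 0})" by auto
qed

text \<open>A surviving summand has \<open>g k j \<noteq> 0\<close>, so the column support of the
  product is covered by finitely many columns of \<open>f\<close>, although the sum itself runs over
  a row support.\<close>

lemma mult_col_support:
  "{i. (\<Sum>k\<in>{k. f i k \<noteq> (0::complex)}. f i k * g k j) \<noteq> 0} \<subseteq> (\<Union>k\<in>{k. g k j \<noteq> 0}. {i. f i k \<noteq> 0})"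
proof
  fix i assume "i \<in> {i. (\<Sum>k\<in>{k. f i k \<noteq> 0}. f i k * g k j) \<noteq> 0}"
  then obtain k where "k \<in> {k. f i k \<noteq> 0}" "f i k * g k j \<noteq> 0"
    by (metis (mono_tags, lifting) mem_Collect_eq sum.neutral)
  then show "i \<in> (\<Union>k\<in>{k. g k j \<noteq> 0}. {i. f i k \<noteq> 0})" by auto
qed

instantiation lfm :: "{zero, one, plus, minus, uminus, times}"
begin
lift_definition zero_lfm :: lfm is "\<lambda>i j. 0" by auto
lift_definition one_lfm :: lfm is "\<lambda>i j. if i = j then 1 else 0" by auto
lift_definition plus_lfm :: "lfm \<Rightarrow> lfm \<Rightarrow> lfm" is "\<lambda>f g i j. f i j + g i j"
proof -
  fix f g :: "nat \<Rightarrow> nat \<Rightarrow> complex"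
  assume *: "(\<forall>i. finite {j. f i j \<noteq> 0}) \<and> (\<forall>j. finite {i. f i j \<noteq> 0})"
    "(\<forall>i. finite {j. g i j \<noteq> 0}) \<and> (\<forall>j. finite {i. g i j \<noteq> 0})"
  have "{j. f i j + g i j \<noteq> 0} \<subseteq> {j. f i j \<noteq> 0} \<union> {j. g i j \<noteq> 0}"
    "{j. f j i + g j i \<noteq> 0} \<subseteq> {j. f j i \<noteq> 0} \<union> {j. g j i \<noteq> 0}" for i by auto
  then show "(\<forall>i. finite {j. f i j + g i j \<noteq> 0}) \<and> (\<forall>j. finite {i. f i j + g i j \<noteq> 0})"
    using * by (meson finite_UnI finite_subset)
qed
lift_definition minus_lfm :: "lfm \<Rightarrow> lfm \<Rightarrow> lfm" is "\<lambda>f g i j. f i j - g i j"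
proof -
  fix f g :: "nat \<Rightarrow> nat \<Rightarrow> complex"
  assume *: "(\<forall>i. finite {j. f i j \<noteq> 0}) \<and> (\<forall>j. finite {i. f i j \<noteq> 0})"
    "(\<forall>i. finite {j. g i j \<noteq> 0}) \<and> (\<forall>j. finite {i. g i j \<noteq> 0})"
  have "{j. f i j - g i j \<noteq> 0} \<subseteq> {j. f i j \<noteq> 0} \<union> {j. g i j \<noteq> 0}"
    "{j. f j i - g j i \<noteq> 0} \<subseteq> {j. f j i \<noteq> 0} \<union> {j. g j i \<noteq> 0}" for i by auto
  then show "(\<forall>i. finite {j. f i j - g i j \<noteq> 0}) \<and> (\<forall>j. finite {i. f i j - g i j \<noteq> 0})"
    using * by (meson finite_UnI finite_subset)
qed
lift_definition uminus_lfm :: "lfm \<Rightarrow> lfm" is "\<lambda>f i j. - f i j" by auto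
lift_definition times_lfm :: "lfm \<Rightarrow> lfm \<Rightarrow> lfm" is "\<lambda>f g i j. \<Sum>k\<in>{k. f i k \<noteq> 0}. f i k * g k j"
proof (intro conjI allI)
  fix f g :: "nat \<Rightarrow> nat \<Rightarrow> complex" and i
  assume "(\<forall>i. finite {j. f i j \<noteq> 0}) \<and> (\<forall>j. finite {i. f i j \<noteq> 0})"
    "(\<forall>i. finite {j. g i j \<noteq> 0}) \<and> (\<forall>j. finite {i. g i j \<noteq> 0})"
  then show "finite {j. (\<Sum>k\<in>{k. f i k \<noteq> 0}. f i k * g k j) \<noteq> 0}"
    "finite {j. (\<Sum>k\<in>{k. f j k \<noteq> 0}. f j k * g k i) \<noteq> 0}"
    by (auto intro: finite_subset[OF mult_row_support] finite_subset[OF mult_col_support])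
qed
instance ..
end

lemma ent_simps [simp]:
  "ent 0 i j = 0" "ent 1 i j = (if i = j then 1 else 0)" "ent (A + B) i j = ent A i j + ent B i j"
  "ent (A - B) i j = ent A i j - ent B i j" "ent (- A) i j = - ent A i j"
  by (transfer, simp)+

text \<open>Frees the defining sum from the exact support of the row, which is awkward to carry
  through products.\<close>

lemma ent_mult_row:
  assumes "finite S" "\<And>k. k \<notin> S \<Longrightarrow> ent A i k = 0"
  shows "ent (A * B) i j = (\<Sum>k\<in>S. ent A i k * ent B k j)"
proof -
  have "ent (A * B) i j = (\<Sum>k\<in>{k. ent A i k \<noteq> 0}. ent A i k * ent B k j)"
    by (transfer, simp)
  also have "\<dots> = (\<Sum>k\<in>S. ent A i k * ent B k j)"
    by (rule sum.mono_neutral_left) (use assms in auto)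
  finally show ?thesis .
qed

lemma ent_mult_col:
  assumes "finite S" "\<And>k. k \<notin> S \<Longrightarrow> ent B k j = 0"
  shows "ent (A * B) i j = (\<Sum>k\<in>S. ent A i k * ent B k j)"
proof -
  have "ent (A * B) i j = (\<Sum>k\<in>S \<union> {k. ent A i k \<noteq> 0}. ent A i k * ent B k j)"
    by (rule ent_mult_row) (use assms finite_row in auto)
  also have "\<dots> = (\<Sum>k\<in>S. ent A i k * ent B k j)"
    by (rule sum.mono_neutral_right) (use assms finite_row in auto)
  finally show ?thesis .
qed

instance lfm :: ring_1
proof
  fix a b c :: lfm
  show "a * b * c = a * (b * c)"
  proof (rule lfm_eqI)
    fix i j
    define S where "S = {k. ent a i k \<noteq> 0}"
    \<comment> \<open>\<open>T\<close> holds the indices reached from row \<open>i\<close> through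
      \<open>a\<close> and then \<open>b\<close>; with \<open>S\<close> and \<open>T\<close> fixed,
      associativity is an exchange of two finite sums.\<close>
    define T where "T = (\<Union>k\<in>S. {l. ent b k l \<noteq> 0})"
    have fS: "finite S" and fT: "finite T" by (auto simp: S_def T_def finite_row)
    have ab: "ent (a * b) i l = (\<Sum>k\<in>S. ent a i k * ent b k l)" for l
      by (rule ent_mult_row) (use fS S_def in auto)
    have bT: "ent b k l = 0" if "k \<in> S" "l \<notin> T" for k l using that by (auto simp: T_def)
    have "ent (a * b * c) i j = (\<Sum>l\<in>T. ent (a * b) i l * ent c l j)"
      by (rule ent_mult_row) (use fT in \<open>auto simp: ab bT intro!: sum.neutral\<close>)
    also have "\<dots> = (\<Sum>k\<in>S. \<Sum>l\<in>T. ent a i k * (ent b k l * ent c l j))"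
      unfolding ab sum_distrib_right mult.assoc by (rule sum.swap)
    also have "\<dots> = (\<Sum>k\<in>S. ent a i k * ent (b * c) k j)"
    proof (rule sum.cong[OF refl])
      fix k assume "k \<in> S"
      then have "ent (b * c) k j = (\<Sum>l\<in>T. ent b k l * ent c l j)"
        by (intro ent_mult_row fT bT)
      then show "(\<Sum>l\<in>T. ent a i k * (ent b k l * ent c l j)) = ent a i k * ent (b * c) k j"
        by (simp add: sum_distrib_left)
    qed
    also have "\<dots> = ent (a * (b * c)) i j"
      by (rule ent_mult_row[symmetric]) (use fS S_def in auto)
    finally show "ent (a * b * c) i j = ent (a * (b * c)) i j" .
  qed
  show "(a + b) * c = a * c + b * c"
  proof (rule lfm_eqI)
    fix i j
    have "ent (d * c) i j = (\<Sum>k\<in>{k. ent c k j \<noteq> 0}. ent d i k * ent c k j)" for d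
      by (rule ent_mult_col) (auto simp: finite_col)
    then show "ent ((a + b) * c) i j = ent (a * c + b * c) i j"
      by (simp add: sum.distrib distrib_right)
  qed
  show "a * (b + c) = a * b + a * c"
  proof (rule lfm_eqI)
    fix i j
    have "ent (a * d) i j = (\<Sum>k\<in>{k. ent a i k \<noteq> 0}. ent a i k * ent d k j)" for d
      by (rule ent_mult_row) (auto simp: finite_row)
    then show "ent (a * (b + c)) i j = ent (a * b + a * c) i j"
      by (simp add: sum.distrib distrib_left)
  qed
  show "1 * a = a"
    by (rule lfm_eqI, subst ent_mult_row[where S = "{i}" for i]) auto
  show "a * 1 = a"
    by (rule lfm_eqI, subst ent_mult_col[where S = "{j}" for j]) auto
  show "(0::lfm) \<noteq> 1"
    by (metis ent_simps(1,2) zero_neq_one)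
qed (auto intro!: lfm_eqI)

section \<open>Adjoint, conjugation, scalars, corner projections, shifts and matrix units\<close>

lift_definition adj :: "lfm \<Rightarrow> lfm" is "\<lambda>f i j. cnj (f j i)" by auto
lift_definition cj :: "lfm \<Rightarrow> lfm" is "\<lambda>f i j. cnj (f i j)" by auto
text \<open>Scalars are the central diagonal elements, so scalar multiplication stays inside the
  ring and is normalized by \<open>sc_ac\<close>.\<close>

lift_definition sc :: "complex \<Rightarrow> lfm" is "\<lambda>c i j. if i = j then c else 0" by auto
lift_definition proj :: "nat \<Rightarrow> lfm" is "\<lambda>n i j. if i = j \<and> i < n then 1 else 0" by auto
lift_definition sh :: "nat \<Rightarrow> lfm" is "\<lambda>n i j. if i = n + j then 1 else 0"
proof (intro conjI allI)
  fix n i :: nat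
  show "finite {j. (if i = n + j then 1 else (0::complex)) \<noteq> 0}"
    by (rule finite_subset[of _ "{..i}"]) (auto split: if_splits)
  show "finite {j. (if j = n + i then 1 else (0::complex)) \<noteq> 0}" by simp
qed
lift_definition un :: "nat \<Rightarrow> nat \<Rightarrow> lfm" is "\<lambda>k l i j. if i = k \<and> j = l then 1 else 0" by auto

lemma ent_simps2 [simp]:
  "ent (adj A) i j = cnj (ent A j i)" "ent (cj A) i j = cnj (ent A i j)"
  "ent (sc c) i j = (if i = j then c else 0)"
  "ent (proj n) i j = (if i = j \<and> i < n then 1 else 0)"
  "ent (sh n) i j = (if i = n + j then 1 else 0)"
  "ent (un k l) i j = (if i = k \<and> j = l then 1 else 0)"
  by (transfer, simp)+

lemma ent_sc_mult [simp]: "ent (sc c * A) i j = c * ent A i j"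
  by (subst ent_mult_row[where S = "{i}"]) auto
lemma ent_mult_sc [simp]: "ent (A * sc c) i j = c * ent A i j"
  by (subst ent_mult_col[where S = "{j}"]) auto
lemma ent_proj_mult [simp]: "ent (proj n * A) i j = (if i < n then ent A i j else 0)"
  by (subst ent_mult_row[where S = "{i}"]) auto
lemma ent_mult_proj [simp]: "ent (A * proj n) i j = (if j < n then ent A i j else 0)"
  by (subst ent_mult_col[where S = "{j}"]) auto
lemma ent_un_mult [simp]: "ent (un k l * A) i j = (if i = k then ent A l j else 0)"
  by (subst ent_mult_row[where S = "{l}"]) auto
lemma ent_mult_un [simp]: "ent (A * un k l) i j = (if j = l then ent A i k else 0)"
  by (subst ent_mult_col[where S = "{k}"]) auto
lemma ent_sh_mult [simp]: "ent (sh n * A) i j = (if n \<le> i then ent A (i - n) j else 0)"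
  by (subst ent_mult_row[where S = "{i - n}"]) auto
lemma ent_adj_sh_mult [simp]: "ent (adj (sh n) * A) i j = ent A (n + i) j"
  by (subst ent_mult_row[where S = "{n + i}"]) auto
lemma ent_mult_adj_sh [simp]: "ent (A * adj (sh n)) i j = (if n \<le> j then ent A i (j - n) else 0)"
  by (subst ent_mult_col[where S = "{j - n}"]) auto
lemma ent_mult_sh [simp]: "ent (A * sh n) i j = ent A i (n + j)"
  by (subst ent_mult_col[where S = "{n + j}"]) auto

lemma adj_mult [simp]: "adj (A * B) = adj B * adj A"
proof (rule lfm_eqI)
  fix i j
  have f: "finite {k. ent A j k \<noteq> 0}" by (rule finite_row)
  have "ent (A * B) j i = (\<Sum>k\<in>{k. ent A j k \<noteq> 0}. ent A j k * ent B k i)"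
    by (rule ent_mult_row[OF f]) simp
  then have "ent (adj (A * B)) i j = cnj (\<Sum>k\<in>{k. ent A j k \<noteq> 0}. ent A j k * ent B k i)"
    by simp
  also have "\<dots> = (\<Sum>k\<in>{k. ent A j k \<noteq> 0}. ent (adj B) i k * ent (adj A) k j)"
    by (simp add: mult.commute)
  also have "\<dots> = ent (adj B * adj A) i j"
    by (rule ent_mult_col[symmetric]) (use f in auto)
  finally show "ent (adj (A * B)) i j = ent (adj B * adj A) i j" .
qed

lemma cj_mult [simp]: "cj (A * B) = cj A * cj B"
proof (rule lfm_eqI)
  fix i j
  have f: "finite {k. ent A i k \<noteq> 0}" by (rule finite_row)
  have "ent (A * B) i j = (\<Sum>k\<in>{k. ent A i k \<noteq> 0}. ent A i k * ent B k j)"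
    by (rule ent_mult_row[OF f]) simp
  moreover have "ent (cj A * cj B) i j = (\<Sum>k\<in>{k. ent A i k \<noteq> 0}. ent (cj A) i k * ent (cj B) k j)"
    by (rule ent_mult_row[OF f]) simp
  ultimately show "ent (cj (A * B)) i j = ent (cj A * cj B) i j" by simp
qed

lemma adj_simps [simp]:
  "adj (A + B) = adj A + adj B" "adj (A - B) = adj A - adj B" "adj (- A) = - adj A"
  "adj 0 = 0" "adj 1 = 1" "adj (adj A) = A" "adj (sc c) = sc (cnj c)" "adj (proj n) = proj n"
  "adj (un k l) = un l k"
  by (auto intro!: lfm_eqI)

lemma adj_cj: "adj (cj A) = cj (adj A)"
  by (auto intro!: lfm_eqI)

lemma cj_simps [simp]:
  "cj (A + B) = cj A + cj B" "cj (A - B) = cj A - cj B" "cj (- A) = - cj A"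
  "cj 0 = 0" "cj 1 = 1" "cj (cj A) = A" "cj (sc c) = sc (cnj c)" "cj (proj n) = proj n"
  "cj (un k l) = un k l" "cj (sh n) = sh n"
  by (auto intro!: lfm_eqI)

lemma adj_sum [simp]: "adj (sum f S) = (\<Sum>i\<in>S. adj (f i))"
  by (induction S rule: infinite_finite_induct) auto

lemma ent_sum [simp]: "ent (sum f S) i j = (\<Sum>k\<in>S. ent (f k) i j)"
  by (induction S rule: infinite_finite_induct) auto

lemma adj_power [simp]: "adj (A ^ k) = adj A ^ k"
  by (induction k) (auto simp: power_commutes)

lemma cj_power [simp]: "cj (A ^ k) = cj A ^ k"
  by (induction k) auto

lemma sc_simps [simp]: "sc 0 = 0" "sc 1 = 1"
  by (auto intro!: lfm_eqI)

lemma sc_mult: "sc a * sc b = sc (a * b)"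
  by (auto intro!: lfm_eqI)

lemma sc_mult_left: "sc a * (sc b * A) = sc (a * b) * A"
  by (auto intro!: lfm_eqI)

lemma mult_sc: "A * sc c = sc c * A"
  by (auto intro!: lfm_eqI)

lemma mult_sc_left: "A * (sc c * B) = sc c * (A * B)"
  by (metis mult.assoc mult_sc)

text \<open>The \<open>NO_MATCH\<close> guard keeps two scalars from being swapped forever; they are
  merged by \<open>sc_mult\<close> instead.\<close>

lemma mult_sc_nm: "NO_MATCH (sc d) A \<Longrightarrow> A * sc c = sc c * A"
  by (rule mult_sc)

lemma mult_sc_left_nm: "NO_MATCH (sc d) A \<Longrightarrow> A * (sc c * B) = sc c * (A * B)"
  by (rule mult_sc_left)

lemmas sc_ac = mult_sc_nm mult_sc_left_nm sc_mult sc_mult_left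

lemma proj_0 [simp]: "proj 0 = 0"
  by (auto intro!: lfm_eqI)

lemma un_mult_un [simp]: "un i j * un k l = (if j = k then un i l else 0)"
  by (auto intro!: lfm_eqI)

lemma sh_simps [simp]:
  "adj (sh n) * sh n = 1" "adj (sh n) * proj n = 0" "proj n * sh n = 0"
  by (auto intro!: lfm_eqI)

lemma sh_left [simp]:
  "adj (sh n) * (sh n * A) = A" "adj (sh n) * (proj n * A) = 0" "proj n * (sh n * A) = 0"
  by (simp_all flip: mult.assoc)

text \<open>The direct sum decomposition behind all block matrices; \<open>sh n\<close> is the
  isometric inclusion of the second summand.\<close>

lemma proj_add: "proj (n + m) = proj n + sh n * (proj m * adj (sh n))"
  by (rule lfm_eqI) auto

section \<open>Supports, real and Hermitian elements\<close>

definition rw :: "nat \<Rightarrow> lfm \<Rightarrow> bool" where "rw n A \<longleftrightarrow> proj n * A = A"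
definition cl :: "nat \<Rightarrow> lfm \<Rightarrow> bool" where "cl n A \<longleftrightarrow> A * proj n = A"
definition rl :: "lfm \<Rightarrow> bool" where "rl A \<longleftrightarrow> cj A = A"

lemma rw_ent: "rw n A \<longleftrightarrow> (\<forall>i j. n \<le> i \<longrightarrow> ent A i j = 0)"
proof
  assume "rw n A"
  then show "\<forall>i j. n \<le> i \<longrightarrow> ent A i j = 0" unfolding rw_def
    by (metis ent_proj_mult linorder_not_less)
next
  assume "\<forall>i j. n \<le> i \<longrightarrow> ent A i j = 0"
  then show "rw n A" unfolding rw_def by (intro lfm_eqI) auto
qed

lemma cl_adj [simp]: "cl n (adj A) \<longleftrightarrow> rw n A"
  by (metis adj_mult adj_simps(6) adj_simps(8) cl_def rw_def)

lemma rw_adj [simp]: "rw n (adj A) \<longleftrightarrow> cl n A"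
  by (metis adj_simps(6) cl_adj)

lemma cl_ent: "cl n A \<longleftrightarrow> (\<forall>i j. n \<le> j \<longrightarrow> ent A i j = 0)"
proof -
  have "cl n A \<longleftrightarrow> rw n (adj A)" by simp
  then show ?thesis unfolding rw_ent by auto
qed

lemma rw_mult [simp]: "rw n A \<Longrightarrow> rw n (A * B)"
  by (simp add: rw_def flip: mult.assoc)
lemma cl_mult [simp]: "cl n B \<Longrightarrow> cl n (A * B)"
  by (simp add: cl_def mult.assoc)
lemma rw_closure [simp]:
  "rw n A \<Longrightarrow> rw n B \<Longrightarrow> rw n (A + B)" "rw n A \<Longrightarrow> rw n B \<Longrightarrow> rw n (A - B)" "rw n A \<Longrightarrow> rw n (- A)"
  "rw n 0" "rw n (proj n)" "rw n A \<Longrightarrow> rw n (sc c * A)" "rw n A \<Longrightarrow> rw n (cj A)"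
  by (auto simp: rw_ent)
lemma cl_closure [simp]:
  "cl n A \<Longrightarrow> cl n B \<Longrightarrow> cl n (A + B)" "cl n A \<Longrightarrow> cl n B \<Longrightarrow> cl n (A - B)" "cl n A \<Longrightarrow> cl n (- A)"
  "cl n 0" "cl n (proj n)" "cl n A \<Longrightarrow> cl n (A * sc c)" "cl n A \<Longrightarrow> cl n (cj A)"
  by (auto simp: cl_ent)

lemma rw_sum [simp]: "(\<And>i. i \<in> S \<Longrightarrow> rw n (f i)) \<Longrightarrow> rw n (sum f S)"
  by (auto simp: rw_ent intro!: sum.neutral)
lemma rw_proj [simp]: "rw n A \<Longrightarrow> proj n * A = A" by (simp add: rw_def)
lemma rw_proj_left [simp]: "rw n A \<Longrightarrow> proj n * (A * B) = A * B" by (simp add: rw_def flip: mult.assoc)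
lemma cl_proj [simp]: "cl n A \<Longrightarrow> A * proj n = A" by (simp add: cl_def)
lemma cl_proj_left [simp]: "cl n A \<Longrightarrow> A * (proj n * B) = A * B" by (simp add: cl_def flip: mult.assoc)

lemma rw_mono: "rw n A \<Longrightarrow> n \<le> m \<Longrightarrow> rw m A"
  by (auto simp: rw_ent)
lemma cl_mono: "cl n A \<Longrightarrow> n \<le> m \<Longrightarrow> cl m A"
  by (auto simp: cl_ent)

lemma rw_sh [simp]: "rw m A \<Longrightarrow> rw (n + m) (sh n * A)"
  by (auto simp: rw_ent)
lemma cl_sh [simp]: "cl m A \<Longrightarrow> cl (n + m) (A * adj (sh n))"
  by (metis adj_mult adj_simps(6) cl_adj rw_adj rw_sh)
lemma rw_sh0 [simp]: "rw n A \<Longrightarrow> adj (sh n) * A = 0"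
  by (metis mult_zero_left rw_proj sh_left(2))
lemma rw_sh0_left [simp]: "rw n A \<Longrightarrow> adj (sh n) * (A * B) = 0"
  by (metis mult.assoc mult_zero_left rw_sh0)
lemma cl_sh0 [simp]: "cl n A \<Longrightarrow> A * sh n = 0"
  by (metis cl_proj mult.assoc mult_zero_right sh_simps(3))
lemma cl_sh0_left [simp]: "cl n A \<Longrightarrow> A * (sh n * B) = 0"
  by (metis mult.assoc mult_zero_left cl_sh0)

lemma rl_closure [simp]:
  "rl A \<Longrightarrow> rl B \<Longrightarrow> rl (A + B)" "rl A \<Longrightarrow> rl B \<Longrightarrow> rl (A - B)" "rl A \<Longrightarrow> rl (- A)"
  "rl A \<Longrightarrow> rl B \<Longrightarrow> rl (A * B)" "rl 0" "rl 1" "rl (proj n)" "rl (sh n)" "rl (un i j)"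
  "cnj c = c \<Longrightarrow> rl (sc c)" "rl A \<Longrightarrow> rl (adj A)" "rl A \<Longrightarrow> rl (A ^ k)"
  by (simp_all add: rl_def flip: adj_cj)

definition hm :: "lfm \<Rightarrow> bool" where "hm A \<longleftrightarrow> adj A = A"

lemma hm_closure [simp]:
  "hm A \<Longrightarrow> hm B \<Longrightarrow> hm (A + B)" "hm A \<Longrightarrow> hm B \<Longrightarrow> hm (A - B)" "hm A \<Longrightarrow> hm (- A)"
  "hm 0" "hm 1" "hm (proj n)" "hm A \<Longrightarrow> hm (adj X * (A * X))" "hm (adj X * X)" "hm (X * adj X)"
  "hm A \<Longrightarrow> hm (X * (A * adj X))"  "hm A \<Longrightarrow> hm (sc (complex_of_real r) * A)"
  by (auto simp: hm_def mult.assoc sc_ac)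

lemma hm_adj: "hm A \<Longrightarrow> adj A = A" by (simp add: hm_def)

lemma hm_cl: "hm A \<Longrightarrow> cl n A \<longleftrightarrow> rw n A"
  by (metis cl_adj hm_def)

text \<open>Real part of the top left entry; on \<open>adj x * A * x\<close> it is the quadratic form of \<open>A\<close> at the first column of \<open>x\<close>.\<close>
definition re :: "lfm \<Rightarrow> real" where "re A = Re (ent A 0 0)"

lemma re_simps [simp]:
  "re (A + B) = re A + re B" "re (A - B) = re A - re B" "re (- A) = - re A" "re 0 = 0"
  "re (sum f S) = (\<Sum>i\<in>S. re (f i))" "re (sc (complex_of_real r) * A) = r * re A" "re (adj A) = re A"
  by (auto simp: re_def)

section \<open>Euclidean norms and polarization\<close>

definition nsq :: "lfm \<Rightarrow> real" where "nsq x = re (adj x * x)"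

lemma nsq_ent: assumes "rw n x" shows "nsq x = (\<Sum>i<n. (cmod (ent x i 0))\<^sup>2)"
proof -
  have "ent (adj x * x) 0 0 = (\<Sum>i\<in>{..<n}. ent (adj x) 0 i * ent x i 0)"
    by (rule ent_mult_col) (use assms in \<open>auto simp: rw_ent\<close>)
  also have "\<dots> = (\<Sum>i<n. of_real ((cmod (ent x i 0))\<^sup>2))"
    by (simp add: complex_norm_square mult.commute del: of_real_power)
  finally show ?thesis by (simp add: nsq_def re_def)
qed

lemma column_rows: "\<exists>n. \<forall>i\<ge>n. ent x i j = 0"
proof -
  obtain n where "\<forall>i\<in>{i. ent x i j \<noteq> 0}. i < n" using finite_col finite_nat_set_iff_bounded by blast
  then show ?thesis by (intro exI[of _ n]) force
qed

text \<open>Ring elements may have infinitely many nonzero columns, and \<open>nsq\<close> sees only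
  column \<open>0\<close>; right multiplication by \<open>un 0 0\<close> cuts to that column, which
  has finite support, so that \<open>nsq_ent\<close> applies.\<close>

lemma nsq_col0: "nsq x = nsq (x * un 0 0)"
proof -
  have "ent (adj (x * un 0 0) * (x * un 0 0)) 0 0 = ent (un 0 0 * (adj x * x) * un 0 0) 0 0"
    by (simp add: mult.assoc)
  then show ?thesis by (simp only: nsq_def re_def) simp
qed

lemma column_rw: "\<exists>n. rw n (x * un j k)"
proof -
  obtain n where "\<forall>i\<ge>n. ent x i j = 0" using column_rows by blast
  then show ?thesis by (intro exI[of _ n]) (auto simp: rw_ent)
qed

lemma re_col0: "re (adj (v * un 0 0) * (M * (w * un 0 0))) = re (adj v * (M * w))"
proof -
  have "adj (v * un 0 0) * (M * (w * un 0 0)) = un 0 0 * ((adj v * (M * w)) * un 0 0)"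
    by (simp add: mult.assoc)
  then show ?thesis unfolding re_def by (simp only: ent_un_mult ent_mult_un) simp
qed

lemma nsq_nonneg [simp]: "0 \<le> nsq x"
proof -
  obtain n where "rw n (x * un 0 0)" using column_rw by blast
  then show ?thesis by (subst nsq_col0) (simp add: nsq_ent sum_nonneg)
qed

lemma nsq_0D: assumes "nsq x = 0" shows "ent x i 0 = 0"
proof -
  obtain n where n: "rw n (x * un 0 0)" using column_rw by blast
  with assms have "\<forall>i<n. ent x i 0 = 0"
    by (subst (asm) nsq_col0) (simp add: nsq_ent sum_nonneg_eq_0_iff)
  moreover have "ent x i 0 = 0" if "n \<le> i" for i
  proof -
    from n that have "ent (x * un 0 0) i 0 = 0" unfolding rw_ent by blast
    then show ?thesis by simp
  qed
  ultimately show ?thesis by (meson linorder_not_less)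
qed

lemma cmod_ent_le_nsq: "(cmod (ent x i 0))\<^sup>2 \<le> nsq x"
proof -
  obtain n where n: "rw n (x * un 0 0)" using column_rw by blast
  show ?thesis
  proof (cases "i < n")
    case True
    have "(cmod (ent (x * un 0 0) i 0))\<^sup>2 \<le> nsq (x * un 0 0)"
      unfolding nsq_ent[OF n] by (rule member_le_sum) (use True in auto)
    then show ?thesis by (simp flip: nsq_col0)
  next
    case False
    with n have "ent (x * un 0 0) i 0 = 0" unfolding rw_ent by (meson linorder_not_less)
    then show ?thesis by simp
  qed
qed

lemma hm_zeroI:
  assumes "hm A" "\<And>x. re (adj x * (A * x)) = 0"
  shows "A = 0"
proof (rule lfm_eqI)
  fix i j
  have d: "re (un 0 k * (A * un k 0)) = 0" for k
    using assms(2)[of "un k 0"] by simp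
  \<comment> \<open>Polarization: the diagonal terms are already zero, so \<open>c = 1\<close> and
    \<open>c = \<i>\<close> isolate the real and the imaginary part of the entry.\<close>
  have s: "Re (c * ent A i j) + Re (cnj c * ent A j i) = 0" for c
    using assms(2)[of "un i 0 + sc c * un j 0"] d[of i] d[of j]
    by (simp add: algebra_simps sc_ac) (simp add: re_def algebra_simps)
  have a: "ent A j i = cnj (ent A i j)" 
    using assms(1) by (metis hm_def ent_simps2(1))
  from s[of 1] s[of \<i>] have "Re (ent A i j) = 0" "Im (ent A i j) = 0" by (simp_all add: a)
  then show "ent A i j = ent 0 i j" by (simp add: complex_eq_iff)
qed

text \<open>The Stein and Riccati equations are obtained as limits of quadratic forms; this turns
  them into matrix equations.\<close>

lemma hm_eqI:
  assumes "hm A" "hm B" "\<And>x. re (adj x * (A * x)) = re (adj x * (B * x))"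
  shows "A = B"
  using hm_zeroI[of "A - B"] assms by (simp add: algebra_simps)

section \<open>Embedding of finite matrices, stability\<close>

definition toF :: "complex mat \<Rightarrow> lfm" where
  "toF A = Lfm (\<lambda>i j. if i < dim_row A \<and> j < dim_col A then A $$ (i, j) else 0)"

lemma ent_toF [simp]: "ent (toF A) i j = (if i < dim_row A \<and> j < dim_col A then A $$ (i, j) else 0)"
proof -
  have "finite {j. (if i < dim_row A \<and> j < dim_col A then A $$ (i, j) else 0) \<noteq> 0}" for i
    by (rule finite_subset[of _ "{..<dim_col A}"]) (auto split: if_splits)
  moreover have "finite {i. (if i < dim_row A \<and> j < dim_col A then A $$ (i, j) else 0) \<noteq> 0}" for j
    by (rule finite_subset[of _ "{..<dim_row A}"]) (auto split: if_splits)
  ultimately show ?thesis unfolding toF_def by (subst Lfm_inverse) auto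
qed

definition ofF :: "nat \<Rightarrow> nat \<Rightarrow> lfm \<Rightarrow> complex mat" where
  "ofF n m A = mat n m (\<lambda>(i, j). ent A i j)"

lemma ofF_carrier [simp]: "ofF n m A \<in> carrier_mat n m" "dim_row (ofF n m A) = n" "dim_col (ofF n m A) = m"
  by (auto simp: ofF_def)

lemma toF_rw [simp]: "A \<in> carrier_mat n m \<Longrightarrow> rw n (toF A)"
  and toF_cl [simp]: "A \<in> carrier_mat n m \<Longrightarrow> cl m (toF A)"
  by (auto simp: rw_ent cl_ent)

lemma toF_ofF [simp]: "rw n A \<Longrightarrow> cl m A \<Longrightarrow> toF (ofF n m A) = A"
  by (rule lfm_eqI) (auto simp: ofF_def rw_ent cl_ent)

lemma ofF_toF: "A \<in> carrier_mat n m \<Longrightarrow> ofF n m (toF A) = A"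
  by (auto simp: ofF_def)

lemma toF_inject: "A \<in> carrier_mat n m \<Longrightarrow> B \<in> carrier_mat n m \<Longrightarrow> toF A = toF B \<Longrightarrow> A = B"
  by (metis ofF_toF)

lemma toF_mult: "dim_col A = dim_row B \<Longrightarrow> toF (A * B) = toF A * toF B"
proof (rule lfm_eqI)
  fix i j assume d: "dim_col A = dim_row B"
  have "ent (toF A * toF B) i j = (\<Sum>k<dim_row B. ent (toF A) i k * ent (toF B) k j)"
    by (rule ent_mult_row) (auto simp: d)
  also have "\<dots> = ent (toF (A * B)) i j"
    by (auto simp: scalar_prod_def d intro!: sum.cong simp flip: lessThan_atLeast0)
  finally show "ent (toF (A * B)) i j = ent (toF A * toF B) i j" by simp
qed

lemma toF_add: "dim_row A = dim_row B \<Longrightarrow> dim_col A = dim_col B \<Longrightarrow> toF (A + B) = toF A + toF B"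
  and toF_minus: "dim_row A = dim_row B \<Longrightarrow> dim_col A = dim_col B \<Longrightarrow> toF (A - B) = toF A - toF B"
  and toF_uminus: "toF (- A) = - toF A"
  and toF_smult: "toF (c \<cdot>\<^sub>m A) = sc c * toF A"
  and toF_one: "toF (1\<^sub>m n) = proj n"
  and toF_zero: "toF (0\<^sub>m n m) = 0"
  by (auto intro!: lfm_eqI)

lemmas toF_simps = toF_mult toF_add toF_minus toF_uminus toF_smult toF_one toF_zero

definition vF :: "complex vec \<Rightarrow> lfm" where
  "vF v = toF (mat (dim_vec v) 1 (\<lambda>(i, j). v $ i))"

lemma ent_vF [simp]: "ent (vF v) i j = (if i < dim_vec v \<and> j = 0 then v $ i else 0)"
  by (auto simp: vF_def)

lemma vF_rw [simp]: "v \<in> carrier_vec n \<Longrightarrow> rw n (vF v)"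
  by (auto simp: rw_ent)

lemma vF_inject:
  assumes "v \<in> carrier_vec n" "w \<in> carrier_vec n" "vF v = vF w"
  shows "v = w"
proof (rule eq_vecI)
  fix i assume "i < dim_vec w"
  then show "v $ i = w $ i" using assms ent_vF[of v i 0] ent_vF[of w i 0] by simp
qed (use assms in auto)

lemma vF_mult: "dim_col A = dim_vec v \<Longrightarrow> vF (A *\<^sub>v v) = toF A * vF v"
  unfolding vF_def by (subst toF_mult[symmetric]) (auto intro!: lfm_eqI simp: scalar_prod_def)

lemma vF_smult: "vF (c \<cdot>\<^sub>v v) = sc c * vF v"
  by (rule lfm_eqI) auto

lemma vF_0_iff: "v \<in> carrier_vec n \<Longrightarrow> vF v = 0 \<longleftrightarrow> v = 0\<^sub>v n"
proof -
  assume v: "v \<in> carrier_vec n"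
  have "vF (0\<^sub>v n) = 0" by (auto intro!: lfm_eqI)
  then show ?thesis using vF_inject[OF v, of "0\<^sub>v n"] by auto
qed

lemma minv_toF:
  assumes X: "X \<in> carrier_mat n n" "det X \<noteq> 0"
  shows "minv X \<in> carrier_mat n n" "toF X * toF (minv X) = proj n" "toF (minv X) * toF X = proj n"
proof -
  show b: "minv X \<in> carrier_mat n n" using adj_mat(1)[OF X(1)] by (simp add: minv_def)
  have "X * minv X = 1\<^sub>m n" "minv X * X = 1\<^sub>m n" unfolding minv_def
    using adj_mat[OF X(1)] X by (auto simp: mult_smult_distrib[of _ n n _ n] mult_smult_assoc_mat[of _ n n _ n])
  then show "toF X * toF (minv X) = proj n" "toF (minv X) * toF X = proj n"
    using X b by (metis carrier_matD toF_mult toF_one)+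
qed

lemma det_nonzeroI:
  assumes "X \<in> carrier_mat n n" "\<And>x. rw n x \<Longrightarrow> toF X * x = 0 \<Longrightarrow> x = 0"
  shows "det X \<noteq> 0"
proof
  assume "det X = 0"
  then obtain v where v: "v \<in> carrier_vec n" "v \<noteq> 0\<^sub>v n" "X *\<^sub>v v = 0\<^sub>v n"
    using det_0_iff_vec_prod_zero[OF assms(1)] by auto
  have "toF X * vF v = 0" using vF_mult[of X v] v assms(1) vF_0_iff[of "0\<^sub>v n" n] by simp
  then have "vF v = 0" using assms(2) v by simp
  then show False using v vF_0_iff by blast
qed

text \<open>Inverses relative to \<open>proj n\<close> come from the adjugate of the corner matrix,
  whose determinant is nonzero by injectivity.\<close>

lemma inj_inverse:
  assumes "rw n A" "cl n A" "\<And>x. rw n x \<Longrightarrow> A * x = 0 \<Longrightarrow> x = 0"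
  obtains B where "rw n B" "cl n B" "A * B = proj n" "B * A = proj n"
proof -
  define a where "a = ofF n n A"
  have a: "a \<in> carrier_mat n n" and A: "toF a = A" using assms by (auto simp: a_def)
  have "det a \<noteq> 0" by (rule det_nonzeroI[OF a]) (use assms(3) A in auto)
  from minv_toF[OF a this] show ?thesis using that[of "toF (minv a)"] A by simp
qed

section \<open>Eigenvalue stability and geometric decay\<close>

definition stab :: "lfm \<Rightarrow> bool" where
  "stab A \<longleftrightarrow> (\<forall>x l. A * x = sc l * x \<and> x \<noteq> 0 \<longrightarrow> cmod l < 1)"

text \<open>The quantitative form of \<open>stab\<close>; the two agree on finite corners by
  \<open>stab_decay\<close> and \<open>decay_stab\<close>. The constant also has to cover the power
  \<open>k = 0\<close>, which is the infinite identity.\<close>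

definition decay :: "lfm \<Rightarrow> bool" where
  "decay A \<longleftrightarrow> (\<exists>c r. 0 \<le> r \<and> r < 1 \<and> (\<forall>k i j. cmod (ent (A ^ k) i j) \<le> c * r ^ k))"

lemma decay_adj [simp]: "decay (adj A) \<longleftrightarrow> decay A"
proof -
  have "decay (adj A)" if d: "decay A" for A
  proof -
    obtain c r where "0 \<le> r" "r < 1" "\<And>k i j. cmod (ent (A ^ k) i j) \<le> c * r ^ k"
      using d unfolding decay_def by blast
    moreover have "ent (adj A ^ k) i j = cnj (ent (A ^ k) j i)" for k i j
      by (metis adj_power ent_simps2(1))
    ultimately show ?thesis unfolding decay_def by (intro exI[of _ c] exI[of _ r]) auto
  qed
  from this[of A] this[of "adj A"] show ?thesis by auto
qed

text \<open>Eigenvectors are arbitrary ring elements; a nonzero eigenvalue confines them to the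
  corner of \<open>A\<close>, and the eigenvalue \<open>0\<close> satisfies the bound of
  \<open>stab\<close> anyway.\<close>

lemma eigenvector_rw:
  assumes "rw n A" "A * x = sc l * x" "l \<noteq> 0"
  shows "rw n x"
proof -
  have "rw n (sc l * x)" unfolding assms(2)[symmetric] using assms(1) by simp
  then show ?thesis using assms(3) by (auto simp: rw_ent)
qed

lemma toF_eigen:
  assumes a: "a \<in> carrier_mat n n" and x: "toF a * x = sc l * x" "x \<noteq> 0" and l: "l \<noteq> 0"
  shows "eigenvalue a l"
proof -
  obtain i0 j where j: "ent x i0 j \<noteq> 0" using x(2) by (metis ent_simps(1) lfm_eqI)
  have rx: "rw n x" by (rule eigenvector_rw[OF toF_rw[OF a] x(1) l])
  define v where "v = vec n (\<lambda>i. ent x i j)"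
  have v: "v \<in> carrier_vec n" by (simp add: v_def)
  have vx: "vF v = x * un j 0"
    using rx by (intro lfm_eqI) (auto simp: v_def rw_ent)
  have "vF (a *\<^sub>v v) = vF (l \<cdot>\<^sub>v v)"
    using a v x(1) by (simp add: vF_mult vF_smult vx flip: mult.assoc)
  then have "a *\<^sub>v v = l \<cdot>\<^sub>v v"
    using a v by (intro vF_inject[of _ n]) auto
  moreover have "v \<noteq> 0\<^sub>v n"
  proof
    assume "v = 0\<^sub>v n"
    then have "x * un j 0 = 0" using vx vF_0_iff[OF v] by simp
    then have "ent (x * un j 0) i0 0 = 0" by simp
    then show False using j by simp
  qed
  ultimately show ?thesis using a v unfolding eigenvalue_def eigenvector_def by auto
qed

lemma eigen_toF:
  assumes a: "a \<in> carrier_mat n n" and "eigenvalue a l"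
  obtains x where "rw n x" "x \<noteq> 0" "toF a * x = sc l * x"
proof -
  obtain v where v: "v \<in> carrier_vec n" "v \<noteq> 0\<^sub>v n" "a *\<^sub>v v = l \<cdot>\<^sub>v v"
    using assms unfolding eigenvalue_def eigenvector_def by auto
  have "toF a * vF v = sc l * vF v"
    using a v by (metis carrier_matD(2) carrier_vecD vF_mult vF_smult)
  then show ?thesis using that[of "vF v"] v vF_0_iff by auto
qed

lemma toF_power: "a \<in> carrier_mat n n \<Longrightarrow> toF (a ^\<^sub>m k) = proj n * toF a ^ k"
proof (induction k)
  case 0 then show ?case by (simp add: toF_one)
next
  case (Suc k)
  then have "toF (a ^\<^sub>m Suc k) = (proj n * toF a ^ k) * toF a"
    by (simp add: toF_mult pow_carrier_mat[of a n k, THEN carrier_matD(2)])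
  then show ?case by (simp add: mult.assoc power_commutes)
qed

lemma sc_mult_power: "(sc c * A) ^ k = sc (c ^ k) * A ^ k"
proof (induction k)
  case (Suc k)
  then show ?case by (simp add: mult.assoc sc_ac)
qed simp

text \<open>Division by a number \<open>r\<close> strictly between the spectral radius and
  \<open>1\<close> leaves a matrix of spectral radius below \<open>1\<close>, whose powers are
  bounded by the Jordan normal form; multiplying back by \<open>r ^ k\<close> gives the
  decay.\<close>

lemma stab_decay:
  assumes "stab A" and n: "rw n A" "cl n A"
  shows "decay A"
proof (cases "n = 0")
  case True
  then have "A = 0" using n unfolding rw_def by simp
  then show ?thesis unfolding decay_def
    by (intro exI[of _ 1] exI[of _ 0]) (auto simp: power_0_left)
next
  case False
  define a where "a = ofF n n A"
  have a: "a \<in> carrier_mat n n" and A: "toF a = A" using n by (auto simp: a_def)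
  define \<rho> where "\<rho> = spectral_radius a"
  have "\<rho> \<in> cmod ` spectrum a" using spectral_radius_mem_max(1)[OF a] False \<rho>_def by auto
  then obtain l where l: "eigenvalue a l" "\<rho> = cmod l" unfolding spectrum_def by auto
  then have \<rho>: "0 \<le> \<rho>" "\<rho> < 1"
    using eigen_toF[OF a l(1)] assms(1) A unfolding stab_def by auto
  define r where "r = (1 + \<rho>) / 2"
  have r: "0 < r" "\<rho> < r" "r < 1" using \<rho> by (auto simp: r_def)
  define b where "b = complex_of_real (1 / r) \<cdot>\<^sub>m a"
  have b: "b \<in> carrier_mat n n" using a by (simp add: b_def)
  have "spectral_radius b \<in> cmod ` spectrum b" using spectral_radius_mem_max(1)[OF b] False by auto
  then obtain m where m: "eigenvalue b m" "spectral_radius b = cmod m" unfolding spectrum_def by auto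
  have "spectral_radius b < 1"
  proof (cases "m = 0")
    case False
    obtain x where x: "x \<noteq> 0" "toF b * x = sc m * x" using eigen_toF[OF b m(1)] by blast
    have "toF a = sc (complex_of_real r) * toF b"
      using r by (simp add: b_def toF_smult sc_mult_left)
    then have "toF a * x = sc (complex_of_real r * m) * x"
      using x(2) by (simp add: mult.assoc sc_ac)
    then have "eigenvalue a (complex_of_real r * m)"
      using toF_eigen[OF a] x(1) False r by simp
    then have "cmod (complex_of_real r * m) \<le> \<rho>"
      using spectral_radius_mem_max(2)[OF a] \<open>n \<noteq> 0\<close> unfolding \<rho>_def spectrum_def by auto
    then have "r * cmod m \<le> \<rho>" using r by (simp add: norm_mult)
    then have "r * cmod m < r" using r by linarith
    moreover have "r \<le> r * cmod m" if "1 \<le> cmod m" using mult_left_mono[OF that, of r] r by simp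
    ultimately show ?thesis using m(2) by linarith
  qed (use m in auto)
  from spectral_radius_jnf_norm_bound_less_1_upper_triangular[OF b this] obtain c
    where c: "\<And>k. norm_bound (b ^\<^sub>m k) c" by blast
  have ab: "A ^ k = sc (complex_of_real r ^ k) * toF b ^ k" for k
  proof -
    have "A = sc (complex_of_real r) * toF b"
      using r by (simp add: b_def toF_smult A sc_mult_left)
    then show ?thesis by (simp only: sc_mult_power)
  qed
  have c0: "0 \<le> c" using c[of 0] False a b unfolding norm_bound_def by (force intro: order_trans[OF norm_ge_zero])
  \<comment> \<open>\<open>max c 1\<close> takes care of \<open>k = 0\<close>, where the entries are
    those of the infinite identity and the bound on the corner says nothing about the rest.\<close>
  have main: "cmod (ent (A ^ k) i j) \<le> max c 1 * r ^ k" for k i j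
  proof (cases "k = 0")
    case False
    then obtain k' where k': "k = Suc k'" by (cases k) auto
    have rk: "rw n (A ^ k)" "cl n (A ^ k)"
      using n by (simp add: k', simp add: k' power_Suc2 del: power_Suc)
    show ?thesis
    proof (cases "i < n \<and> j < n")
      case True
      have "ent (A ^ k) i j = complex_of_real r ^ k * ent (proj n * toF b ^ k) i j"
        using True by (simp add: ab)
      also have "\<dots> = complex_of_real r ^ k * (b ^\<^sub>m k) $$ (i, j)"
        using True pow_carrier_mat[OF b, of k] by (subst toF_power[OF b, symmetric]) auto
      finally have "cmod (ent (A ^ k) i j) = r ^ k * cmod ((b ^\<^sub>m k) $$ (i, j))"
        using r by (simp add: norm_mult norm_power)
      also have "\<dots> \<le> r ^ k * c"
        using c[of k] True carrier_matD[OF pow_carrier_mat[OF b, of k]] r unfolding norm_bound_def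
        by (intro mult_left_mono) (auto simp del: pow_mat_dim)
      also have "\<dots> \<le> max c 1 * r ^ k" using r by (subst mult.commute) (intro mult_right_mono, auto)
      finally show ?thesis .
    next
      case False
      then have "ent (A ^ k) i j = 0" using rk unfolding rw_ent cl_ent by (meson linorder_not_less)
      then show ?thesis using r by simp
    qed
  qed auto
  show ?thesis unfolding decay_def using r main by (intro exI[of _ "max c 1"] exI[of _ r]) auto
qed

text \<open>The traces of \<open>V * W\<close> and \<open>W * V\<close> agree, and they count
  \<open>m\<close> and \<open>k\<close>.\<close>

lemma square_of_inverses:
  assumes "rw m V" "cl k V" "rw k W" "cl m W" "V * W = proj m" "W * V = proj k"
  shows "m = k"
proof -
  have "of_nat m = (\<Sum>i<m. ent (V * W) i i)" by (simp add: assms(5))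
  also have "\<dots> = (\<Sum>i<m. \<Sum>l<k. ent V i l * ent W l i)"
    by (intro sum.cong refl ent_mult_row) (use assms(2) in \<open>auto simp: cl_ent\<close>)
  also have "\<dots> = (\<Sum>l<k. \<Sum>i<m. ent W l i * ent V i l)"
    by (subst sum.swap) (simp add: mult.commute)
  also have "\<dots> = (\<Sum>l<k. ent (W * V) l l)"
    by (intro sum.cong refl ent_mult_row[symmetric]) (use assms(4) in \<open>auto simp: cl_ent\<close>)
  also have "\<dots> = of_nat k" by (simp add: assms(6))
  finally show ?thesis by (metis of_nat_eq_iff)
qed

section \<open>Norm estimates and limits of forms\<close>

lemma form_expand:
  assumes "rw n x" "rw m y"
  shows "ent (adj x * (M * y)) 0 0 = (\<Sum>i<n. \<Sum>j<m. cnj (ent x i 0) * ent M i j * ent y j 0)"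
proof -
  have "ent (adj x * (M * y)) 0 0 = (\<Sum>i<n. ent (adj x) 0 i * ent (M * y) i 0)"
    by (rule ent_mult_row) (use assms(1) in \<open>auto simp: rw_ent\<close>)
  also have "\<dots> = (\<Sum>i<n. cnj (ent x i 0) * (\<Sum>j<m. ent M i j * ent y j 0))"
    by (intro sum.cong refl arg_cong2[where f = "(*)"] ent_mult_col) (use assms(2) in \<open>auto simp: rw_ent\<close>)
  finally show ?thesis by (simp add: sum_distrib_left mult.assoc)
qed

lemma form_tendsto:
  assumes "\<And>k. rw n (X k)" "rw n x" "\<And>k. rw m (Y k)" "rw m y"
    and "\<And>i. (\<lambda>k. ent (X k) i 0) \<longlonglongrightarrow> ent x i 0" "\<And>i. (\<lambda>k. ent (Y k) i 0) \<longlonglongrightarrow> ent y i 0"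
  shows "(\<lambda>k. re (adj (X k) * (M * Y k))) \<longlonglongrightarrow> re (adj x * (M * y))"
  unfolding re_def form_expand[OF assms(1,3)] form_expand[OF assms(2,4)]
  by (intro tendsto_intros assms(5,6))

lemma operator_bound:
  assumes "\<And>i j. cmod (ent M i j) \<le> b" "rw n M" "rw m x"
  shows "nsq (M * x) \<le> (real n * real m * b\<^sup>2) * nsq x"
proof -
  have "(cmod (ent (M * x) i 0))\<^sup>2 \<le> real m * b\<^sup>2 * nsq x" for i
  proof -
    have "ent (M * x) i 0 = (\<Sum>j<m. ent M i j * ent x j 0)"
      by (rule ent_mult_col) (use assms in \<open>auto simp: rw_ent\<close>)
    then have "cmod (ent (M * x) i 0) \<le> (\<Sum>j<m. cmod (ent M i j * ent x j 0))"
      by (simp add: norm_sum)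
    also have "\<dots> \<le> (\<Sum>j<m. b * cmod (ent x j 0))"
      by (intro sum_mono) (simp add: norm_mult assms(1) mult_right_mono)
    finally have "(cmod (ent (M * x) i 0))\<^sup>2 \<le> (\<Sum>j<m. b * cmod (ent x j 0))\<^sup>2"
      by (intro power_mono) auto
    also have "\<dots> \<le> (\<Sum>j<m. (b * cmod (ent x j 0))\<^sup>2) * real (card {..<m})"
      by (rule sum_squared_le_sum_of_squares) 
    also have "\<dots> = real m * b\<^sup>2 * nsq x"
      by (simp add: nsq_ent[OF assms(3)] power_mult_distrib sum_distrib_left sum_distrib_right mult_ac)
    finally show ?thesis .
  qed
  then have "(\<Sum>i<n. (cmod (ent (M * x) i 0))\<^sup>2) \<le> real (card {..<n}) * (real m * b\<^sup>2 * nsq x)"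
    by (intro sum_bounded_above) auto
  then show ?thesis using assms by (simp add: nsq_ent[of n] mult_ac)
qed

lemma operator_bounded:
  assumes "rw n M" "cl m M"
  obtains c where "0 \<le> c" "\<And>x. rw m x \<Longrightarrow> nsq (M * x) \<le> c * nsq x"
proof -
  define b where "b = (\<Sum>i<n. \<Sum>j<m. cmod (ent M i j))"
  have "cmod (ent M i j) \<le> b" for i j
  proof (cases "i < n \<and> j < m")
    case True
    have "cmod (ent M i j) \<le> (\<Sum>j<m. cmod (ent M i j))" by (rule member_le_sum) (use True in auto)
    also have "\<dots> \<le> b" unfolding b_def by (rule member_le_sum) (use True in \<open>auto intro: sum_nonneg\<close>)
    finally show ?thesis .
  next
    case False
    then have "ent M i j = 0" using assms unfolding rw_ent cl_ent by (meson linorder_not_less)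
    then show ?thesis by (simp add: b_def sum_nonneg)
  qed
  from operator_bound[OF this assms(1)] show ?thesis
    by (intro that[of "real n * real m * b\<^sup>2"]) auto
qed

lemma form_sc: "re (adj (sc c * x) * (M * (sc c * y))) = (cmod c)\<^sup>2 * re (adj x * (M * y))"
proof -
  have "adj (sc c * x) * (M * (sc c * y)) = sc (complex_of_real ((cmod c)\<^sup>2)) * (adj x * (M * y))"
    by (simp add: mult.assoc sc_ac complex_norm_square mult.commute del: of_real_power)
  then show ?thesis by (simp only: re_simps)
qed

lemma nsq_sc [simp]: "nsq (sc c * x) = (cmod c)\<^sup>2 * nsq x"
  using form_sc[of c x 1 x] unfolding nsq_def by (simp only: mult_1_left)

lemma re_swap: "re (adj y * x) = re (adj x * y)"
  by (metis adj_mult adj_simps(6) re_simps(7))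

lemma nsq_diff: "nsq (x - y) = nsq x + nsq y - 2 * re (adj x * y)"
  by (simp add: nsq_def algebra_simps re_swap[of y x])

lemma nsq_add: "nsq (x + y) = nsq x + nsq y + 2 * re (adj x * y)"
  by (simp add: nsq_def algebra_simps re_swap[of y x])

text \<open>Expands the squared norm of \<open>sqrt e * x - y / sqrt e\<close>.\<close>

lemma young:
  assumes "0 < e"
  shows "2 * re (adj x * y) \<le> e * nsq x + nsq y / e"
proof -
  define s where "s = sqrt e"
  have s: "s > 0" "s\<^sup>2 = e" using assms by (auto simp: s_def)
  have "adj (sc (of_real s) * x) * (sc (of_real (1 / s)) * y) = adj x * y"
    using s by (simp add: mult.assoc sc_ac)
  then show ?thesis using s nsq_nonneg[of "sc (of_real s) * x - sc (of_real (1 / s)) * y"]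
    unfolding nsq_diff by (simp add: norm_divide power_divide)
qed

lemma decay_nsq:
  assumes "decay A" "rw n A"
  obtains c r where "0 \<le> c" "0 \<le> r" "r < 1" "\<And>k x. rw n x \<Longrightarrow> nsq (A ^ k * x) \<le> c * r ^ k * nsq x"
proof -
  obtain c r where cr: "0 \<le> r" "r < 1" "\<And>k i j. cmod (ent (A ^ k) i j) \<le> c * r ^ k"
    using assms unfolding decay_def by blast
  \<comment> \<open>The factor \<open>max 1\<close> covers the power \<open>0\<close>; passing to
    squared norms squares the rate.\<close>
  have b: "nsq (A ^ k * x) \<le> (max 1 (real n * real n * c\<^sup>2)) * (r ^ 2) ^ k * nsq x" if "rw n x" for k x
  proof (cases k)
    case 0
    then show ?thesis using mult_right_mono[of 1 "max 1 (real n * real n * c\<^sup>2)" "nsq x"] by simp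
  next
    case (Suc l)
    have "nsq (A ^ k * x) \<le> (real n * real n * (c * r ^ k)\<^sup>2) * nsq x"
      using Suc assms by (intro operator_bound cr that) auto
    also have "\<dots> = (real n * real n * c\<^sup>2) * ((r ^ 2) ^ k * nsq x)"
      by (simp add: power_mult_distrib flip: power_mult) (simp add: mult.commute)
    also have "\<dots> \<le> max 1 (real n * real n * c\<^sup>2) * ((r ^ 2) ^ k * nsq x)"
      by (intro mult_right_mono) auto
    finally show ?thesis by (simp add: mult.assoc)
  qed
  show ?thesis
    by (rule that[of "max 1 (real n * real n * c\<^sup>2)" "r\<^sup>2"]) (use cr b in \<open>auto simp: power_less_one_iff abs_square_less_1\<close>)
qed

lemma decay_tendsto:
  assumes "decay A" "rw n A" "rw n x"
  shows "(\<lambda>k. nsq (A ^ k * x)) \<longlonglongrightarrow> 0" "(\<lambda>k. ent (A ^ k * x) i 0) \<longlonglongrightarrow> 0"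
proof -
  obtain c r where cr: "0 \<le> c" "0 \<le> r" "r < 1" "\<And>k x. rw n x \<Longrightarrow> nsq (A ^ k * x) \<le> c * r ^ k * nsq x"
    using decay_nsq[OF assms(1,2)] by metis
  have "(\<lambda>k. c * r ^ k * nsq x) \<longlonglongrightarrow> c * 0 * nsq x"
    by (intro tendsto_intros LIMSEQ_realpow_zero cr)
  then have "(\<lambda>k. c * r ^ k * nsq x) \<longlonglongrightarrow> 0" by simp
  then show l: "(\<lambda>k. nsq (A ^ k * x)) \<longlonglongrightarrow> 0"
    by (rule tendsto_sandwich[rotated 3]) (use cr assms in \<open>auto intro: tendsto_const\<close>)
  have "(\<lambda>k. sqrt (nsq (A ^ k * x))) \<longlonglongrightarrow> sqrt 0" by (intro tendsto_intros l)
  moreover have "norm (ent (A ^ k * x) i 0) \<le> sqrt (nsq (A ^ k * x))" for k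
    using cmod_ent_le_nsq real_le_rsqrt by blast
  ultimately show "(\<lambda>k. ent (A ^ k * x) i 0) \<longlonglongrightarrow> 0"
    by (metis (no_types, lifting) Lim_null_comparison always_eventually real_sqrt_zero)
qed

text \<open>For an eigenvalue outside the open disc, the powers of \<open>A\<close> would never
  shrink a nonzero column of the eigenvector.\<close>

lemma decay_stab:
  assumes "decay A" "rw n A"
  shows "stab A"
  unfolding stab_def
proof (intro allI impI)
  fix x l assume x: "A * x = sc l * x \<and> x \<noteq> 0"
  show "cmod l < 1"
  proof (rule ccontr)
    assume l: "\<not> cmod l < 1"
    obtain i0 j where j: "ent x i0 j \<noteq> 0" using x by (metis ent_simps(1) lfm_eqI)
    define y where "y = x * un j 0"
    have y: "A * y = sc l * y" using x by (simp add: y_def flip: mult.assoc)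
    have ry: "rw n y" by (rule eigenvector_rw[OF assms(2) y]) (use l in auto)
    have yk: "A ^ k * y = sc (l ^ k) * y" for k
      by (induction k) (auto simp: power_Suc2 mult.assoc y sc_ac mult.commute[of l] simp del: power_Suc)
    have "(\<lambda>k. ent (A ^ k * y) i0 0) \<longlonglongrightarrow> 0" by (rule decay_tendsto[OF assms ry])
    then have "(\<lambda>k. cmod (ent (A ^ k * y) i0 0)) \<longlonglongrightarrow> 0" by (rule tendsto_norm_zero)
    moreover have "cmod (ent (A ^ k * y) i0 0) \<ge> cmod (ent y i0 0)" for k
      using l one_le_power[of "cmod l" k] mult_right_mono[of 1 "cmod l ^ k" "cmod (ent y i0 0)"]
      by (simp add: yk norm_mult norm_power)
    ultimately have "cmod (ent y i0 0) \<le> 0" by (intro LIMSEQ_le_const) auto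
    then show False using j by (simp add: y_def)
  qed
qed

text \<open>Polarization recovers every entry from the forms at
  \<open>un i 0 + sc c * un j 0\<close>, so convergence of the forms forces entrywise convergence of
  the matrices. Symmetry and realness pass to the limit.\<close>

lemma form_limit:
  assumes hm: "\<And>k. hm (P k)" and rw: "\<And>k. rw n (P k)"
    and conv: "\<And>x. rw n x \<Longrightarrow> convergent (\<lambda>k. re (adj x * (P k * x)))"
  obtains Q where "hm Q" "rw n Q" "(\<And>k. rl (P k)) \<Longrightarrow> rl Q"
    "\<And>x. rw n x \<Longrightarrow> (\<lambda>k. re (adj x * (P k * x))) \<longlonglongrightarrow> re (adj x * (Q * x))"
proof -
  have cl: "cl n (P k)" for k using hm rw hm_cl by blast
  have entc: "convergent (\<lambda>k. ent (P k) i j)" if ij: "i < n" "j < n" for i j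
  proof -
    define f where "f c k = re (adj (un i 0 + sc c * un j 0) * (P k * (un i 0 + sc c * un j 0)))
        - re (un 0 i * (P k * un i 0)) - (cmod c)\<^sup>2 * re (un 0 j * (P k * un j 0))" for c k
    have r1: "rw n (un i 0 + sc c * un j 0)" for c using ij by (auto simp: rw_ent)
    have r2: "rw n (un i 0)" if "i < n" for i using that by (auto simp: rw_ent)
    have fc: "convergent (f c)" for c
      unfolding f_def
      using conv[OF r1[of c]] conv[OF r2[OF ij(1)]] conv[OF r2[OF ij(2)]]
      by (intro convergent_diff convergent_mult convergent_const) simp_all
    have fe: "f c k = 2 * Re (c * ent (P k) i j)" for c k
    proof -
      have "ent (P k) j i = cnj (ent (P k) i j)" using hm by (metis hm_def ent_simps2(1))
      then show ?thesis unfolding f_def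
        by (simp add: re_def algebra_simps sc_ac cmod_power2) (simp add: power2_eq_square algebra_simps)
    qed
    have eq: "(\<lambda>k. ent (P k) i j) = (\<lambda>k. complex_of_real (f 1 k / 2) + \<i> * complex_of_real (- f \<i> k / 2))"
      by (auto simp: fe complex_eq_iff)
    show ?thesis unfolding eq
    proof -
      obtain a b where "f 1 \<longlonglongrightarrow> a" "f \<i> \<longlonglongrightarrow> b" using fc unfolding convergent_def by blast
      then have "(\<lambda>k. complex_of_real (f 1 k / 2) + \<i> * complex_of_real (- f \<i> k / 2)) \<longlonglongrightarrow>
          complex_of_real (a / 2) + \<i> * complex_of_real (- b / 2)" by (intro tendsto_intros) auto
      then show "convergent (\<lambda>k. complex_of_real (f 1 k / 2) + \<i> * complex_of_real (- f \<i> k / 2))"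
        unfolding convergent_def by blast
    qed
  qed
  define Q where "Q = toF (mat n n (\<lambda>(i, j). lim (\<lambda>k. ent (P k) i j)))"
  have Ql: "(\<lambda>k. ent (P k) i j) \<longlonglongrightarrow> ent Q i j" for i j
  proof (cases "i < n \<and> j < n")
    case True
    then show ?thesis using entc[of i j] by (simp add: Q_def convergent_LIMSEQ_iff)
  next
    case False
    then have "ent (P k) i j = 0" for k using rw cl unfolding rw_ent cl_ent by (meson linorder_not_less)
    moreover have "ent Q i j = 0" using False by (auto simp: Q_def)
    ultimately show ?thesis by simp
  qed
  show ?thesis
  proof (rule that)
    show "hm Q" unfolding hm_def
    proof (rule lfm_eqI)
      fix i j
      have "(\<lambda>k. cnj (ent (P k) j i)) \<longlonglongrightarrow> cnj (ent Q j i)" by (intro tendsto_intros Ql)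
      moreover have "cnj (ent (P k) j i) = ent (P k) i j" for k using hm by (metis hm_def ent_simps2(1))
      ultimately show "ent (adj Q) i j = ent Q i j" using Ql[of i j] LIMSEQ_unique by simp blast
    qed
    show "rw n Q" by (auto simp: Q_def rw_ent)
    show "rl Q" if "\<And>k. rl (P k)" unfolding rl_def
    proof (rule lfm_eqI)
      fix i j
      have "(\<lambda>k. cnj (ent (P k) i j)) \<longlonglongrightarrow> cnj (ent Q i j)" by (intro tendsto_intros Ql)
      moreover have "cnj (ent (P k) i j) = ent (P k) i j" for k using that by (metis rl_def ent_simps2(2))
      ultimately show "ent (cj Q) i j = ent Q i j" using Ql[of i j] LIMSEQ_unique by simp blast
    qed
    show "(\<lambda>k. re (adj x * (P k * x))) \<longlonglongrightarrow> re (adj x * (Q * x))" if "rw n x" for x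
      unfolding re_def form_expand[OF that that] by (intro tendsto_intros Ql)
  qed
qed

section \<open>Stein equations and positive semidefinite matrices\<close>

definition psd :: "lfm \<Rightarrow> bool" where
  "psd Q \<longleftrightarrow> hm Q \<and> (\<forall>x. 0 \<le> re (adj x * (Q * x)))"

lemma psd_hm [simp]: "psd Q \<Longrightarrow> hm Q" and psd_form: "psd Q \<Longrightarrow> 0 \<le> re (adj x * (Q * x))"
  by (auto simp: psd_def)

lemma psd_conj [simp]: assumes "psd P" shows "psd (adj T * (P * T))"
  using assms psd_form[OF assms, of "T * x" for x] by (auto simp: psd_def mult.assoc)

lemma psd_gram [simp]: "psd (adj X * X)" "psd (X * adj X)"
proof -
  have "psd (adj X * X)" for X
    using nsq_nonneg[of "X * x" for x] by (auto simp: psd_def nsq_def mult.assoc)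
  from this[of X] this[of "adj X"] show "psd (adj X * X)" "psd (X * adj X)" by auto
qed

lemma form_proj:
  assumes "hm G" "rw n G"
  shows "re (adj (proj n * x) * (G * (proj n * x))) = re (adj x * (G * x))"
  using assms hm_cl[of G n] by (simp add: mult.assoc)

lemma form_bounded:
  assumes "rw n Q" "cl n Q"
  obtains c where "0 \<le> c" "\<And>x. rw n x \<Longrightarrow> \<bar>re (adj x * (Q * x))\<bar> \<le> c * nsq x"
proof -
  obtain c where c: "0 \<le> c" "\<And>x. rw n x \<Longrightarrow> nsq (Q * x) \<le> c * nsq x"
    using operator_bounded[OF assms] by blast
  have "\<bar>re (adj x * (Q * x))\<bar> \<le> (1 + c) * nsq x" if "rw n x" for x
  proof -
    have "2 * re (adj x * (Q * x)) \<le> nsq x + nsq (Q * x)" using young[of 1 x "Q * x"] by simp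
    moreover have "- (2 * re (adj x * (Q * x))) \<le> nsq x + nsq (Q * x)" using young[of 1 x "- (Q * x)"] by (simp add: nsq_def)
    moreover have "0 \<le> (1 + c) * nsq x" using c by simp
    ultimately show ?thesis using c(2)[OF that] by (simp add: algebra_simps)
  qed
  then show ?thesis using that[of "1 + c"] c by simp
qed

text \<open>Partial sums of the series of \<open>adj A ^ j * (Q * A ^ j)\<close>, written
  recursively so that the Stein equation is the limit of the second clause.\<close>

fun stein_sum :: "lfm \<Rightarrow> lfm \<Rightarrow> nat \<Rightarrow> lfm" where
  "stein_sum A Q 0 = 0"
| "stein_sum A Q (Suc k) = adj A * (stein_sum A Q k * A) + Q"

lemma power_commutes_left: "A ^ k * (A * x) = A * (A ^ k * (x :: lfm))"
  by (metis mult.assoc power_commutes)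

lemma stein_sum_form:
  "re (adj x * (stein_sum A Q k * x)) = (\<Sum>j<k. re (adj (A ^ j * x) * (Q * (A ^ j * x))))"
proof (induction k arbitrary: x)
  case (Suc k)
  show ?case unfolding sum.lessThan_Suc_shift
    using Suc[of "A * x"] by (simp add: algebra_simps power_commutes_left)
qed simp

text \<open>Decay makes the forms of the partial sums converge absolutely; the limit solves the
  fixed-point equation and inherits realness and positivity. It serves as observability Gramian, as
  reachability Gramian (with \<open>adj A\<close> for \<open>A\<close>) and as the storage that
  removes a state cost.\<close>

lemma stein:
  assumes A: "decay A" "rw n A" "cl n A" and Q: "hm Q" "rw n Q"
  obtains G where "hm G" "rw n G" "adj A * (G * A) + Q = G" "rl A \<Longrightarrow> rl Q \<Longrightarrow> rl G" "psd Q \<Longrightarrow> psd G"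
proof -
  have clQ: "cl n Q" using Q hm_cl by blast
  have h: "hm (stein_sum A Q k)" "rw n (stein_sum A Q k)" for k
    by (induction k) (use A Q in auto)
  have conv: "convergent (\<lambda>k. re (adj x * (stein_sum A Q k * x)))" if x: "rw n x" for x
  proof -
    obtain c where c: "0 \<le> c" "\<And>x. rw n x \<Longrightarrow> \<bar>re (adj x * (Q * x))\<bar> \<le> c * nsq x"
      using form_bounded[OF Q(2) clQ] by blast
    obtain d r where d: "0 \<le> d" "0 \<le> r" "r < 1" "\<And>k x. rw n x \<Longrightarrow> nsq (A ^ k * x) \<le> d * r ^ k * nsq x"
      using decay_nsq[OF A(1,2)] by metis
    have rx: "rw n (A ^ k * x)" for k
      using A x by (cases k) (auto simp: mult.assoc)
    have "norm (re (adj (A ^ j * x) * (Q * (A ^ j * x)))) \<le> (c * d * nsq x) * r ^ j" for j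
    proof -
      have "norm (re (adj (A ^ j * x) * (Q * (A ^ j * x)))) \<le> c * nsq (A ^ j * x)"
        using c(2)[OF rx] by simp
      also have "\<dots> \<le> c * (d * r ^ j * nsq x)" using c d x by (intro mult_left_mono) auto
      finally show ?thesis by (simp add: mult_ac)
    qed
    moreover have "summable (\<lambda>j. (c * d * nsq x) * r ^ j)"
      using d by (intro summable_mult summable_geometric) auto
    ultimately have "summable (\<lambda>j. re (adj (A ^ j * x) * (Q * (A ^ j * x))))"
      by (meson summable_comparison_test')
    then show ?thesis unfolding stein_sum_form summable_iff_convergent .
  qed
  obtain G where G: "hm G" "rw n G" "(\<And>k. rl (stein_sum A Q k)) \<Longrightarrow> rl G"
    and lim: "\<And>x. rw n x \<Longrightarrow> (\<lambda>k. re (adj x * (stein_sum A Q k * x))) \<longlonglongrightarrow> re (adj x * (G * x))"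
    using form_limit[of "stein_sum A Q" n] h conv by metis
  have clG: "cl n G" using G hm_cl by blast
  show ?thesis
  proof (rule that)
    show "adj A * (G * A) + Q = G"
    proof (rule hm_eqI)
      fix x
      define y where "y = proj n * x"
      have y: "rw n y" "rw n (A * y)" using A by (simp_all add: y_def)
      have "(\<lambda>k. re (adj y * (stein_sum A Q (Suc k) * y))) \<longlonglongrightarrow> re (adj y * (G * y))"
        by (rule LIMSEQ_Suc[OF lim[OF y(1)]])
      moreover have "(\<lambda>k. re (adj (A * y) * (stein_sum A Q k * (A * y))) + re (adj y * (Q * y)))
          \<longlonglongrightarrow> re (adj (A * y) * (G * (A * y))) + re (adj y * (Q * y))"
        by (intro tendsto_intros lim[OF y(2)])
      ultimately have "re (adj (A * y) * (G * (A * y))) + re (adj y * (Q * y)) = re (adj y * (G * y))"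
        by (intro LIMSEQ_unique) (simp_all add: algebra_simps)
      then have "re (adj y * ((adj A * (G * A) + Q) * y)) = re (adj y * (G * y))"
        by (simp add: algebra_simps)
      moreover have "hm (adj A * (G * A) + Q)" "rw n (adj A * (G * A) + Q)" using A G Q by simp_all
      ultimately show "re (adj x * ((adj A * (G * A) + Q) * x)) = re (adj x * (G * x))"
        using form_proj G(1,2) unfolding y_def by metis
    qed (use G Q in simp_all)
    show "rl G" if "rl A" "rl Q"
    proof (rule G(3))
      show "rl (stein_sum A Q k)" for k by (induction k) (use that in auto)
    qed
    show "psd G" if "psd Q" unfolding psd_def
    proof (intro conjI allI)
      fix x
      have "0 \<le> re (adj y * (stein_sum A Q k * y))" for k y
        unfolding stein_sum_form by (intro sum_nonneg psd_form that)
      then have "0 \<le> re (adj (proj n * x) * (G * (proj n * x)))"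
        by (intro LIMSEQ_le_const[OF lim]) (simp del: adj_mult, blast)
      then show "0 \<le> re (adj x * (G * x))" using form_proj G by metis
    qed (use G in auto)
  qed (use G in auto)
qed

section \<open>Semidefinite factorization and orthogonal completion\<close>

lemma psd_cross:
  assumes "psd P" "re (adj x * (P * x)) = 0"
  shows "re (adj y * (P * x)) = 0"
proof (rule ccontr)
  define b where "b = re (adj y * (P * x))"
  define a where "a = re (adj y * (P * y))"
  assume "re (adj y * (P * x)) \<noteq> 0"
  then have b: "b \<noteq> 0" by (simp add: b_def)
  have hP: "adj P = P" using assms(1) hm_adj by simp
  \<comment> \<open>Since the form vanishes at \<open>x\<close>, the quadratic term in
    \<open>t\<close> disappears, and an affine function that stays nonnegative has slope
    zero.\<close>
  have "0 \<le> a + 2 * t * b" for t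
  proof -
    have sw: "re (adj x * (P * y)) = b" unfolding b_def
      using re_swap[of x "P * y"] by (simp add: hP mult.assoc)
    have "re (sc (complex_of_real t) * (sc (complex_of_real t) * (adj x * (P * x)))) = 0"
      using assms(2) by simp
    then show ?thesis using psd_form[OF assms(1), of "y + sc (complex_of_real t) * x"]
      by (simp add: algebra_simps sc_ac sw flip: a_def b_def)
  qed
  from this[of "- (a + 1) / (2 * b)"] this[of 0] show False using b by (simp add: field_simps)
qed

text \<open>The tests \<open>un i 0\<close> and \<open>sc \<i> * un i 0\<close> give the real and
  the imaginary part.\<close>

lemma psd_kernel:
  assumes "psd P" "re (adj x * (P * x)) = 0"
  shows "ent (P * x) i 0 = 0"
  using psd_cross[OF assms, of "un i 0"] psd_cross[OF assms, of "sc \<i> * un i 0"]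
  by (simp add: re_def complex_eq_iff mult.assoc)

lemma rw_un0 [simp]: "rw n A \<Longrightarrow> un i n * A = 0"
  and cl_un0 [simp]: "cl n A \<Longrightarrow> A * un n i = 0"
  by (auto intro!: lfm_eqI simp: rw_ent cl_ent)

lemma rw_un0_left [simp]: "rw n A \<Longrightarrow> un i n * (A * B) = 0"
  and cl_un0_left [simp]: "cl n A \<Longrightarrow> A * (un n i * B) = 0"
  by (metis mult.assoc mult_zero_left rw_un0) (metis mult.assoc mult_zero_left cl_un0)

lemma un_left: "un i j * (un k l * A) = (if j = k then un i l * A else 0)"
  by (simp flip: mult.assoc)

lemma rw_un: "i < n \<Longrightarrow> rw n (un i j)" and cl_un: "j < n \<Longrightarrow> cl n (un i j)"
  by (auto simp: rw_ent cl_ent)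

text \<open>The induction peels off the last row and column (one step of a Cholesky factorization).\<close>
lemma psd_factorization:
  assumes "psd P" "rw n P" "rl P"
  shows "\<exists>k V W. rw n V \<and> cl k V \<and> rw k W \<and> cl n W \<and> rl V \<and> rl W \<and> V * adj V = P \<and> W * V = proj k \<and> k \<le> n"
  using assms
proof (induction n arbitrary: P)
  case 0
  then have "P = 0" by (simp add: rw_def)
  then show ?case by (intro exI[of _ 0]) simp
next
  case (Suc n)
  have hP: "adj P = P" using Suc hm_adj by simp
  define p where "p = Re (ent P n n)"
  have ep: "ent P n n = complex_of_real p"
  proof -
    have "cnj (ent P n n) = ent P n n" using Suc.prems(3) by (metis rl_def ent_simps2(2))
    then show ?thesis by (simp add: complex_eq_iff p_def)
  qed
  have p0: "0 \<le> p" using psd_form[OF Suc.prems(1), of "un n 0"] by (simp add: re_def p_def)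
  show ?case
  proof (cases "p = 0")
    case True
    have "re (adj (un n 0) * (P * un n 0)) = 0" by (simp add: re_def ep True)
    from psd_kernel[OF Suc.prems(1) this] have z: "ent P i n = 0" for i by simp
    have "ent P i j = 0" if "n \<le> i" for i j
    proof (cases "i = n")
      case True
      have "ent P n j = cnj (ent P j n)" by (metis hP ent_simps2(1))
      then show ?thesis using True z by simp
    next
      case False
      then show ?thesis using Suc.prems(2) that by (simp add: rw_ent)
    qed
    then have "rw n P" by (simp add: rw_ent)
    with Suc.IH[OF Suc.prems(1) this Suc.prems(3)] obtain k V W where
      "rw n V" "cl k V" "rw k W" "cl n W" "rl V" "rl W" "V * adj V = P" "W * V = proj k" "k \<le> n" by metis
    then show ?thesis
      by (intro exI[of _ k] exI[of _ V] exI[of _ W]) (simp add: rw_mono[of n _ "Suc n"] cl_mono[of n _ "Suc n"])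
  next
    case False
    define s where "s = sqrt p"
    have s: "0 < s" "s * s = p" using False p0 by (auto simp: s_def)
    define v where "v = sc (complex_of_real (1 / s)) * (P * un n 0)"
    define P' where "P' = P - v * adj v"
    have PnP: "un i n * (P * un n j) = sc (complex_of_real p) * un i j" for i j
      by (rule lfm_eqI) (auto simp: ep)
    have PnPl: "un i n * (P * (un n j * X)) = sc (complex_of_real p) * (un i j * X)" for i j X
      using PnP[of i j] by (metis mult.assoc)
    have vv: "v * adj v = sc (complex_of_real (1 / p)) * (P * (un n n * P))"
      using s by (simp add: v_def hP mult.assoc sc_ac un_left flip: of_real_mult)
    \<comment> \<open>Congruence by \<open>T\<close> clears the last row and column:
      \<open>P'\<close> is the Schur complement of the pivot \<open>p\<close>, and congruence keeps
      it semidefinite.\<close>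
    define T where "T = 1 - sc (complex_of_real (1 / p)) * (un n n * P)"
    have "adj T * (P * T) = P'"
      using False by (simp add: T_def P'_def vv hP algebra_simps sc_ac PnPl un_left)
    then have psd': "psd P'" using Suc.prems(1) psd_conj by metis
    have rl': "rl v" "rl P'" using Suc.prems(3) by (simp_all add: v_def P'_def)
    have "ent P' i j = 0" if "n \<le> i" for i j
    proof (cases "i = n")
      case True
      have "ent (un n n * P') n j = 0"
        using False by (simp add: P'_def vv algebra_simps sc_ac PnPl un_left)
      then show ?thesis using True by simp
    next
      case F: False
      have "rw (Suc n) P'" using Suc.prems(2) by (simp add: P'_def vv)
      then show ?thesis using F that by (simp add: rw_ent)
    qed
    then have rw': "rw n P'" by (simp add: rw_ent)
    obtain k V W where VW: "rw n V" "cl k V" "rw k W" "cl n W" "rl V" "rl W" "V * adj V = P'" "W * V = proj k" "k \<le> n"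
      using Suc.IH[OF psd' rw' rl'(2)] by metis
    define V' where "V' = V + v * un 0 k"
    \<comment> \<open>The new coordinate is read off row \<open>n\<close>, where \<open>V\<close>
      vanishes and \<open>v\<close> has the entry \<open>s\<close>; its contribution is removed
      before \<open>W\<close> is applied.\<close>
    define W' where "W' = W * (1 - sc (complex_of_real (1 / s)) * (v * un 0 n)) + sc (complex_of_real (1 / s)) * un k n"
    have "complex_of_real p / complex_of_real s = complex_of_real s"
      using s by (simp add: field_simps flip: of_real_mult)
    then have unv: "un i n * v = sc (complex_of_real s) * un i 0" for i
      by (simp add: v_def sc_ac PnP)
    have unvl: "un i n * (v * X) = sc (complex_of_real s) * (un i 0 * X)" for i X
      using unv[of i] by (metis mult.assoc)
    have v00: "v * un 0 0 = v" "v * (un 0 0 * X) = v * X" for X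
      by (auto simp: v_def mult.assoc un_left)
    have rv: "rw (Suc n) v" using Suc.prems(2) by (simp add: v_def)
    have pk: "proj (Suc k) = proj k + un k k" by (rule lfm_eqI) auto
    show ?thesis
    proof (rule exI[of _ "Suc k"], rule exI[of _ V'], rule exI[of _ W'], intro conjI)
      show "rw (Suc n) V'" using VW rw_mono[of n V "Suc n"] rv by (simp add: V'_def)
      show "cl (Suc k) V'" using VW cl_mono[of k V "Suc k"] by (simp add: V'_def cl_un)
      show "rw (Suc k) W'" using VW rw_mono[of k W "Suc k"] by (simp add: W'_def rw_un)
      show "cl (Suc n) W'" using VW cl_mono[of n W "Suc n"] by (simp add: W'_def algebra_simps sc_ac cl_un)
      show "rl V'" "rl W'" using VW rl' by (simp_all add: V'_def W'_def)
      show "V' * adj V' = P"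
        using VW(2,7) by (simp add: V'_def algebra_simps un_left v00 P'_def)
      show "W' * V' = proj (Suc k)"
        using VW(1,8) s by (simp add: W'_def V'_def algebra_simps un_left sc_ac unvl v00 pk)
      show "Suc k \<le> Suc n" using VW by simp
    qed
  qed
qed

text \<open>\<open>N = proj (r + q) - adj R * R\<close> is the orthogonal projection onto the
  complement of the row space. In its factorization \<open>V * adj V\<close> the columns of
  \<open>V\<close> are orthonormal, and \<open>adj V\<close> supplies the missing rows.\<close>

lemma orthogonal_completion:
  assumes R: "rw r R" "cl (r + q) R" "rl R" "R * adj R = proj r"
  obtains U where "rw q U" "cl (r + q) U" "rl U" "adj R * R + adj U * U = proj (r + q)"
    "R * adj U = 0" "U * adj U = proj q"
proof -
  define N where "N = proj (r + q) - adj R * R"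
  have RR: "R * (adj R * X) = proj r * X" for X using R(4) by (metis mult.assoc)
  have RRR: "adj R * (R * (adj R * R)) = adj R * R" using R by (simp add: RR)
  have "adj N * N = N" using R by (simp add: N_def algebra_simps RRR)
  then have "psd N" by (metis psd_gram(1))
  moreover have "rw (r + q) N" "rl N" using R by (simp_all add: N_def)
  ultimately obtain k V W where V: "rw (r + q) V" "cl k V" "rw k W" "cl (r + q) W" "rl V"
    "V * adj V = N" "W * V = proj k"
    using psd_factorization by metis
  have Wl: "W * (V * X) = proj k * X" for X using V(7) by (metis mult.assoc)
  have adjVW: "adj V * adj W = proj k" using arg_cong[OF V(7), of adj] by simp
  have NN: "N * N = N" using \<open>adj N * N = N\<close> by (simp add: N_def)
  \<comment> \<open>Left invertibility of \<open>V\<close> turns the idempotence of \<open>N\<close>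
    into orthonormality of the columns.\<close>
  have "adj V * V = W * (V * (adj V * (V * (adj V * adj W))))"
    using V(2) by (simp add: Wl adjVW)
  also have "\<dots> = W * ((N * N) * adj W)" by (simp add: V(6)[symmetric] mult.assoc)
  also have "\<dots> = proj k" using V(2) unfolding NN by (simp add: V(6)[symmetric] V(7) mult.assoc Wl adjVW)
  finally have VV: "adj V * V = proj k" .
  have "R * N = 0" using R by (simp add: N_def algebra_simps RR)
  have "R * V = R * (V * (adj V * adj W))" using V(2) by (simp add: adjVW)
  also have "\<dots> = (R * N) * adj W" by (simp add: V(6)[symmetric] mult.assoc)
  finally have RV: "R * V = 0" using \<open>R * N = 0\<close> by simp
  have VR: "adj V * adj R = 0" using arg_cong[OF RV, of adj] by simp
  have RVl: "R * (V * X) = 0" and VVl: "adj V * (V * X) = proj k * X" for X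
    using RV VV by (metis mult.assoc mult_zero_left)+
  \<comment> \<open>\<open>R\<close> stacked on \<open>adj V\<close> is inverted on both sides by
    its adjoint, so the rank \<open>k\<close> of the projection can only be
    \<open>q\<close>.\<close>
  have "r + k = r + q"
  proof (rule square_of_inverses)
    let ?Q = "R + sh r * adj V"
    show "rw (r + k) ?Q" "cl (r + q) ?Q" using R V rw_mono[of r R "r + k"] by simp_all
    show "rw (r + q) (adj ?Q)" "cl (r + k) (adj ?Q)" using R V rw_mono[of r R "r + k"] by (simp_all del: adj_simps)
    show "?Q * adj ?Q = proj (r + k)"
      unfolding proj_add by (simp add: algebra_simps R(4) RVl VR VVl)
    show "adj ?Q * ?Q = proj (r + q)"
      using R V by (simp add: algebra_simps V(6) N_def)
  qed
  then have "k = q" by simp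
  show ?thesis
    by (rule that[of "adj V"]) (use V VV RV \<open>k = q\<close> in \<open>auto simp: N_def\<close>)
qed

text \<open>The rows of \<open>A\<close> and \<open>B\<close> side by side are orthonormal, and the
  completing rows \<open>C\<close> and \<open>D\<close> make the whole matrix orthogonal. In system
  terms, the output equation turns the balanced state equation into a lossless system whose storage
  is the identity.\<close>

lemma inner_completion:
  assumes A: "rw r A" "cl r A" "rl A" and B: "rw r B" "cl q B" "rl B"
    and AB: "A * adj A + B * adj B = proj r"
  obtains C D where "rw q C" "cl r C" "rl C" "rw q D" "cl q D" "rl D"
    "adj A * A + adj C * C = proj r" "adj A * B + adj C * D = 0" "adj B * B + adj D * D = proj q"
    "A * adj C + B * adj D = 0" "C * adj C + D * adj D = proj q"
proof -
  define R where "R = A + B * adj (sh r)"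
  have "rw r R" "cl (r + q) R" "rl R" using A B cl_mono[of r A "r + q"] by (simp_all add: R_def)
  moreover have "R * adj R = proj r"
  proof -
    have "adj (sh r) * adj A = 0" using A by simp
    then show ?thesis using A by (simp add: R_def algebra_simps AB)
  qed
  ultimately obtain U where U: "rw q U" "cl (r + q) U" "rl U" "adj R * R + adj U * U = proj (r + q)"
    "R * adj U = 0" "U * adj U = proj q"
    using orthogonal_completion by blast
  define C where "C = U * proj r"
  define D where "D = U * sh r"
  have D': "cl q D"
  proof -
    have "U * proj (r + q) = U" using U by simp
    then have "U * (proj r + sh r * (proj q * adj (sh r))) * sh r = U * sh r" unfolding proj_add by simp
    then have "U * (sh r * proj q) = U * sh r" by (simp add: algebra_simps)
    then show ?thesis by (simp add: cl_def D_def mult.assoc)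
  qed
  have Rp: "R * proj r = A" "R * sh r = B" using A B by (simp_all add: R_def algebra_simps)
  have Rp': "proj r * adj R = adj A" "adj (sh r) * adj R = adj B"
    using arg_cong[OF Rp(1), of adj] arg_cong[OF Rp(2), of adj] by simp_all
  have Rl: "R * (proj r * X) = A * X" "R * (sh r * X) = B * X"
    "proj r * (adj R * X) = adj A * X" "adj (sh r) * (adj R * X) = adj B * X" for X
    using Rp Rp' by (metis mult.assoc)+
  have UD: "U = C + D * adj (sh r)"
  proof -
    have "U = U * proj (r + q)" using U by simp
    also have "\<dots> = C + D * proj q * adj (sh r)"
      unfolding proj_add by (simp add: C_def D_def algebra_simps)
    finally show ?thesis using D' by simp
  qed
  have id: "adj R * (R * X) + adj U * (U * X) = proj (r + q) * X" for X
    unfolding U(4)[symmetric] by (simp add: algebra_simps)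
  have pp: "proj (q + r) * proj r = proj r" "proj (q + r) * sh r = sh r * proj q"
    by (auto intro!: lfm_eqI)
  show ?thesis
  proof (rule that)
    show "rw q C" "cl r C" "rl C" "rw q D" "cl q D" "rl D" using U D' by (simp_all add: C_def D_def)
    show "adj A * A + adj C * C = proj r"
      using arg_cong[OF id[of "proj r"], of "\<lambda>X. proj r * X"] A
      by (simp add: algebra_simps Rl Rp pp C_def)
    show "adj A * B + adj C * D = 0"
      using arg_cong[OF id[of "sh r"], of "\<lambda>X. proj r * X"] A
      by (simp add: algebra_simps Rl Rp pp C_def D_def)
    show "adj B * B + adj D * D = proj q"
      using arg_cong[OF id[of "sh r"], of "\<lambda>X. adj (sh r) * X"] A
      by (simp add: algebra_simps Rl Rp pp C_def D_def)
    have "cl r C" by (simp add: C_def)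
    then show "A * adj C + B * adj D = 0" "C * adj C + D * adj D = proj q"
      using U(5,6) A \<open>cl r C\<close> unfolding UD R_def by (simp_all add: algebra_simps)
  qed
qed

section \<open>Coercivity from positivity on the unit circle\<close>

lemma ent_mult_tendsto:
  assumes "\<And>k. rw n (X k)" "rw n x" "\<And>i. (\<lambda>k. ent (X k) i 0) \<longlonglongrightarrow> ent x i 0"
  shows "(\<lambda>k. ent (M * X k) i 0) \<longlonglongrightarrow> ent (M * x) i 0"
proof -
  have "ent (M * y) i 0 = (\<Sum>j<n. ent M i j * ent y j 0)" if "rw n y" for y
    by (rule ent_mult_col) (use that in \<open>auto simp: rw_ent\<close>)
  then show ?thesis using assms by (auto intro!: tendsto_intros)
qed

lemma nsq_triangle: "nsq (x + y) \<le> 2 * nsq x + 2 * nsq y"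
  using nsq_nonneg[of "x - y"] unfolding nsq_add nsq_diff by simp

text \<open>Energy estimate with the storage \<open>G\<close> of \<open>stein\<close> for
  \<open>Q = proj n\<close>: Young's inequality splits the cross term, and half of the state energy
  is absorbed. The factor \<open>(cmod z)\<^sup>2\<close> is kept because it also yields the decay
  at infinity in \<open>transfer_vanishes\<close>.\<close>

lemma resolvent_bound:
  assumes A: "decay A" "rw n A" "cl n A" and B: "rw n B" "cl m B"
  obtains c where "0 \<le> c" "\<And>z x u. 1 \<le> cmod z \<Longrightarrow> rw n x \<Longrightarrow> rw m u \<Longrightarrow> sc z * x = A * x + B * u
    \<Longrightarrow> (cmod z)\<^sup>2 * nsq x \<le> c * nsq u"
proof -
  have "psd (proj n)" using psd_gram(1)[of "proj n"] by simp
  then obtain G where G: "hm G" "rw n G" "adj A * (G * A) + proj n = G" "psd G"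
    using stein[OF A, of "proj n"] by auto
  obtain c where c: "0 \<le> c" "\<And>x. rw m x \<Longrightarrow> nsq ((G * B) * x) \<le> c * nsq x"
    using operator_bounded[of n "G * B" m] G B by auto
  have "(cmod z)\<^sup>2 * nsq x \<le> (4 * c) * nsq u"
    if z: "1 \<le> cmod z" and x: "rw n x" "rw m u" "sc z * x = A * x + B * u" for z x u
  proof -
    define w where "w = G * (B * u)"
    have Gx: "re (adj x * (G * x)) = re (adj (A * x) * (G * (A * x))) + nsq x"
      using x(1) by (subst G(3)[symmetric]) (simp add: algebra_simps nsq_def)
    then have g: "nsq x \<le> re (adj x * (G * x))" using psd_form[OF G(4)] by (metis le_add_same_cancel2)
    have Ax: "A * x = sc z * x - B * u" using x(3) by simp
    have hG: "adj G = G" using G(1) by (rule hm_adj)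
    note zz = form_sc[of z x G x]
    have sw: "re (adj (B * u) * (G * (sc z * x))) = re (adj (sc z * x) * w)"
      unfolding w_def using re_swap[of "sc z * x" "G * (B * u)"] by (simp add: hG mult.assoc)
    have "re (adj (A * x) * (G * (A * x))) = re (adj (sc z * x) * (G * (sc z * x)))
        - re (adj (sc z * x) * (G * (B * u))) - re (adj (B * u) * (G * (sc z * x))) + re (adj (B * u) * (G * (B * u)))"
      unfolding Ax adj_simps(2) by (simp only: left_diff_distrib right_diff_distrib re_simps)
    then have "nsq x + (cmod z)\<^sup>2 * re (adj x * (G * x)) - re (adj x * (G * x)) \<le> 2 * re (adj (sc z * x) * w)"
      using Gx psd_form[OF G(4), of "B * u"] unfolding zz sw w_def by linarith
    also have "\<dots> \<le> 1 / 2 * nsq (sc z * x) + nsq w / (1 / 2)" by (rule young) simp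
    also have "\<dots> \<le> (cmod z)\<^sup>2 * nsq x / 2 + 2 * (c * nsq u)"
      using c(2)[OF x(2)] by (simp add: w_def mult.assoc)
    finally have "nsq x + ((cmod z)\<^sup>2 - 1) * re (adj x * (G * x)) \<le> (cmod z)\<^sup>2 * nsq x / 2 + 2 * (c * nsq u)"
      by (simp add: algebra_simps)
    moreover have "((cmod z)\<^sup>2 - 1) * nsq x \<le> ((cmod z)\<^sup>2 - 1) * re (adj x * (G * x))"
      using z g by (intro mult_left_mono) auto
    ultimately show ?thesis by (simp add: algebra_simps)
  qed
  then show ?thesis using that[of "4 * c"] c by simp
qed

text \<open>Coordinates are treated one after the other, each time passing to a further
  subsequence.\<close>

lemma bounded_subsequence:
  fixes f :: "nat \<Rightarrow> nat \<Rightarrow> complex"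
  assumes "\<And>k i. cmod (f k i) \<le> c"
  shows "\<exists>r g. strict_mono (r :: nat \<Rightarrow> nat) \<and> (\<forall>i<N. (\<lambda>k. f (r k) i) \<longlonglongrightarrow> g i)"
proof (induction N)
  case 0
  show ?case by (intro exI[of _ id]) (simp add: strict_mono_def)
next
  case (Suc N)
  then obtain r g where r: "strict_mono r" "\<And>i. i < N \<Longrightarrow> (\<lambda>k. f (r k) i) \<longlonglongrightarrow> g i" by blast
  have "bounded (range (\<lambda>k. f (r k) N))" using assms by (auto simp: bounded_iff)
  then obtain l s where s: "strict_mono s" "((\<lambda>k. f (r k) N) \<circ> s) \<longlonglongrightarrow> l"
    using bounded_imp_convergent_subsequence by blast
  have "(\<lambda>k. f ((r \<circ> s) k) i) \<longlonglongrightarrow> (g(N := l)) i" if "i < Suc N" for i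
  proof (cases "i = N")
    case True then show ?thesis using s by (simp add: o_def)
  next
    case False
    then have "((\<lambda>k. f (r k) i) \<circ> s) \<longlonglongrightarrow> g i"
      using r(2)[of i] that s(1) by (intro LIMSEQ_subseq_LIMSEQ) auto
    then show ?thesis using False by (simp add: o_def)
  qed
  moreover have "strict_mono (r \<circ> s)" using r s by (intro strict_mono_o)
  ultimately show ?case by blast
qed

section \<open>Finite Fourier transform\<close>

lemma root_of_unity_orthogonality:
  assumes "0 < N" and w: "w = exp (2 * complex_of_real pi * \<i> / of_nat N)" and kl: "k < N" "l < N"
  shows "(\<Sum>j<N. w ^ (j * k) * cnj w ^ (j * l)) = (if k = l then of_nat N else 0)"
proof -
  have wk: "w ^ k = exp (2 * of_real pi * \<i> * of_nat k / of_nat N)" for k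
    unfolding w by (simp add: mult_ac flip: exp_of_nat_mult)
  have "cmod w = 1" unfolding w by (simp add: norm_exp_eq_Re)
  then have ww: "w * cnj w = 1" by (simp add: complex_norm_square[symmetric])
  have wN: "w ^ N = 1" using assms(1) by (simp add: wk exp_two_pi_i)
  define q where "q = w ^ k * cnj w ^ l"
  have "w ^ (j * k) * cnj w ^ (j * l) = q ^ j" for j
    by (simp add: q_def power_mult_distrib flip: power_mult) (simp add: mult.commute)
  then have s: "(\<Sum>j<N. w ^ (j * k) * cnj w ^ (j * l)) = (\<Sum>j<N. q ^ j)" by simp
  show ?thesis
  proof (cases "k = l")
    case True
    then have "q = 1" by (simp add: q_def ww flip: power_mult_distrib)
    then show ?thesis using True s by simp
  next
    case False
    have "q \<noteq> 1"
    proof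
      assume "q = 1"
      then have "w ^ l = w ^ k * (cnj w ^ l * w ^ l)" by (simp add: q_def)
      also have "cnj w ^ l * w ^ l = 1" using ww by (simp add: mult.commute flip: power_mult_distrib)
      finally have "w ^ l = w ^ k" by simp
      then have "l mod N = k mod N"
        using complex_root_unity_eq[of N l k] assms(1) unfolding wk by simp
      then show False using False kl by simp
    qed
    moreover have "q ^ N = 1"
    proof -
      have "q ^ N = (w ^ N) ^ k * cnj (w ^ N) ^ l" by (simp add: q_def power_mult_distrib flip: power_mult) (simp add: mult.commute)
      then show ?thesis by (simp add: wN)
    qed
    ultimately show ?thesis using s False by (simp add: geometric_sum)
  qed
qed

text \<open>Left unnormalized, which is why a factor \<open>N\<close> shows up in
  \<open>parseval\<close>.\<close>

definition dft :: "nat \<Rightarrow> (nat \<Rightarrow> lfm) \<Rightarrow> nat \<Rightarrow> lfm" where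
  "dft N a j = (\<Sum>k<N. sc (cnj (exp (2 * complex_of_real pi * \<i> / of_nat N)) ^ (j * k)) * a k)"

lemma parseval:
  assumes "0 < N"
  shows "(\<Sum>j<N. re (adj (dft N a j) * (M * dft N b j))) = real N * (\<Sum>k<N. re (adj (a k) * (M * b k)))"
proof -
  define w where w: "w = exp (2 * complex_of_real pi * \<i> / of_nat N)"
  have "(\<Sum>j<N. adj (dft N a j) * (M * dft N b j))
      = (\<Sum>j<N. \<Sum>l<N. \<Sum>k<N. sc (w ^ (j * k) * cnj w ^ (j * l)) * (adj (a k) * (M * b l)))"
    unfolding dft_def w[symmetric]
    by (simp add: sum_distrib_left sum_distrib_right mult.assoc sc_ac)
  also have "\<dots> = (\<Sum>j<N. \<Sum>k<N. \<Sum>l<N. sc (w ^ (j * k) * cnj w ^ (j * l)) * (adj (a k) * (M * b l)))"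
    by (intro sum.cong refl sum.swap)
  also have "\<dots> = (\<Sum>k<N. \<Sum>l<N. \<Sum>j<N. sc (w ^ (j * k) * cnj w ^ (j * l)) * (adj (a k) * (M * b l)))"
    by (subst sum.swap) (intro sum.cong refl sum.swap)
  also have "\<dots> = (\<Sum>k<N. \<Sum>l<N. sc (\<Sum>j<N. w ^ (j * k) * cnj w ^ (j * l)) * (adj (a k) * (M * b l)))"
  proof -
    have "(\<Sum>j<N. sc (f j) * X) = sc (\<Sum>j<N. f j) * X" for f X
      by (rule lfm_eqI) (simp add: sum_distrib_right)
    then show ?thesis by simp
  qed
  also have "\<dots> = (\<Sum>k<N. \<Sum>l<N. if k = l then sc (of_nat N) * (adj (a k) * (M * b l)) else 0)"
    using root_of_unity_orthogonality[OF assms w] by (intro sum.cong refl) simp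
  also have "\<dots> = (\<Sum>k<N. sc (complex_of_real (real N)) * (adj (a k) * (M * b k)))"
    by (simp add: sum.delta')
  finally have "re (\<Sum>j<N. adj (dft N a j) * (M * dft N b j)) = re (\<Sum>k<N. sc (complex_of_real (real N)) * (adj (a k) * (M * b k)))"
    by (rule arg_cong)
  then show ?thesis by (simp only: re_simps sum_distrib_left)
qed

section \<open>Trajectories, periodic responses and the linear-quadratic cost\<close>

primrec traj :: "lfm \<Rightarrow> lfm \<Rightarrow> lfm \<Rightarrow> (nat \<Rightarrow> lfm) \<Rightarrow> nat \<Rightarrow> lfm" where
  "traj A B x u 0 = x"
| "traj A B x u (Suc k) = A * traj A B x u k + B * u k"

lemma traj_rw [simp]: "rw n A \<Longrightarrow> rw n B \<Longrightarrow> rw n x \<Longrightarrow> rw n (traj A B x u k)"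
  by (cases k) auto

lemma traj_linear: "traj A B x u k = A ^ k * x + traj A B 0 u k"
  by (induction k) (auto simp: algebra_simps)

lemma traj_cong: "(\<And>j. j < k \<Longrightarrow> u j = v j) \<Longrightarrow> traj A B x u k = traj A B x v k"
  by (induction k) auto

lemma traj_shift: "traj A B x u (Suc k) = traj A B (A * x + B * u 0) (\<lambda>j. u (Suc j)) k"
  by (induction k) auto

text \<open>For a periodic response the shift has no boundary terms, so it becomes multiplication by a root of unity.\<close>
lemma periodic_response_dft:
  assumes "0 < N" and y: "y N = y 0" "\<And>k. k < N \<Longrightarrow> y (Suc k) = A * y k + B * u k"
  defines "z \<equiv> \<lambda>j. exp (2 * complex_of_real pi * \<i> / of_nat N) ^ j"
  shows "sc (z j) * dft N y j = A * dft N y j + B * dft N u j"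
proof -
  define w where w: "w = exp (2 * complex_of_real pi * \<i> / of_nat N)"
  have "cmod w = 1" unfolding w by (simp add: norm_exp_eq_Re)
  then have ww: "w * cnj w = 1" by (simp add: complex_norm_square[symmetric])
  have wN: "w ^ N = 1" unfolding w using complex_root_unity[of N 1] assms(1) by simp
  define h where "h k = sc (w ^ j * cnj w ^ (j * k)) * y k" for k
  have hS: "sc (cnj w ^ (j * k)) * y (Suc k) = h (Suc k)" for k
  proof -
    have "w ^ j * cnj w ^ j = 1" using ww by (simp flip: power_mult_distrib)
    then show ?thesis by (simp add: h_def power_add flip: mult.assoc)
  qed
  have "A * dft N y j + B * dft N u j = (\<Sum>k<N. sc (cnj w ^ (j * k)) * y (Suc k))"
    by (simp add: dft_def w[symmetric] y(2) sum_distrib_left sc_ac distrib_left sum.distrib)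
  also have "\<dots> = (\<Sum>k<N. h (Suc k))" by (simp add: hS)
  also have "\<dots> = (\<Sum>k<N. h k) + h N - h 0"
    using sum.lessThan_Suc_shift[of h N] by (simp add: algebra_simps)
  also have "h N = h 0"
  proof -
    have "cnj w ^ (j * N) = cnj ((w ^ N) ^ j)" by (simp add: mult.commute flip: power_mult)
    then show ?thesis by (simp add: h_def y(1) wN)
  qed
  also have "(\<Sum>k<N. h k) + h 0 - h 0 = sc (w ^ j) * dft N y j"
    by (simp add: dft_def w[symmetric] h_def sum_distrib_left sc_mult_left)
  finally show ?thesis by (simp add: z_def w)
qed

text \<open>\<open>stage\<close> is the cost of one time step without a term in the state alone; such a term is removed
  beforehand by a storage function solving a Stein equation. Then the cost of a finitely
  supported input involves only finitely many steps.\<close>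
locale lq =
  fixes n m :: nat and A B S R :: lfm
  assumes A: "decay A" "rw n A" "cl n A" and B: "rw n B" "cl m B" and S: "rw n S" "cl m S"
    and R: "hm R" "rw m R"
begin

definition stage :: "lfm \<Rightarrow> lfm \<Rightarrow> real" where
  "stage x u = 2 * re (adj x * (S * u)) + re (adj u * (R * u))"

lemma stage_zero:
  assumes "rw n x" "rw m u" "nsq u = 0" shows "stage x u = 0"
proof -
  have "ent u i 0 = 0" for i using nsq_0D[OF assms(3)] .
  then show ?thesis
    unfolding stage_def re_def form_expand[OF assms(1,2)] form_expand[OF assms(2,2)] by simp
qed

lemma stage_scale: "stage (sc c * x) (sc c * u) = (cmod c)\<^sup>2 * stage x u"
  unfolding stage_def form_sc by (simp only: algebra_simps)

lemma stage_add: "stage (x + y) u = stage x u + 2 * re (adj y * (S * u))"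
  by (simp add: stage_def algebra_simps)

text \<open>Compactness: a failing sequence can be normalized to \<open>nsq u = 1\<close>; its
  states are bounded by \<open>resolvent_bound\<close> and its frequencies lie on the circle, so a
  subsequence converges to a frequency, state and input that violate strict positivity.\<close>

lemma frequency_uniform:
  assumes pos: "\<And>z x u. cmod z = 1 \<Longrightarrow> rw n x \<Longrightarrow> rw m u \<Longrightarrow> sc z * x = A * x + B * u \<Longrightarrow> 0 < nsq u \<Longrightarrow> 0 < stage x u"
  obtains e where "0 < e" "\<And>z x u. cmod z = 1 \<Longrightarrow> rw n x \<Longrightarrow> rw m u \<Longrightarrow> sc z * x = A * x + B * u \<Longrightarrow> e * nsq u \<le> stage x u"
proof (rule ccontr)
  assume no: "\<not> thesis"
  note eI = that
  obtain c where c: "0 \<le> c" "\<And>z x u. 1 \<le> cmod z \<Longrightarrow> rw n x \<Longrightarrow> rw m u \<Longrightarrow> sc z * x = A * x + B * u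
    \<Longrightarrow> (cmod z)\<^sup>2 * nsq x \<le> c * nsq u"
    using resolvent_bound[OF A B] by metis
  have "\<exists>z x u. cmod z = 1 \<and> rw n x \<and> rw m u \<and> sc z * x = A * x + B * u \<and> nsq u = 1 \<and> x * un 0 0 = x \<and> u * un 0 0 = u
      \<and> stage x u < 1 / real (Suc k)" for k
  proof -
    obtain z x u where 1: "cmod z = 1" "rw n x" "rw m u" "sc z * x = A * x + B * u" "stage x u < 1 / real (Suc k) * nsq u"
    proof -
      note n1 = that
      show thesis
      proof (rule ccontr)
      assume n: "\<not> thesis"
      have "1 / real (Suc k) * nsq u \<le> stage x u"
        if "cmod z = 1" "rw n x" "rw m u" "sc z * x = A * x + B * u" for z x u
        using n1[OF that] n by (meson not_le)
      then show False using eI[of "1 / real (Suc k)"] no by simp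
      qed
    qed
    have "nsq u \<noteq> 0" using 1 stage_zero by force
    then have u: "0 < nsq u" using nsq_nonneg[of u] by linarith
    define d where "d = complex_of_real (1 / sqrt (nsq u))"
    have d: "(cmod d)\<^sup>2 * nsq u = 1" using u by (simp add: d_def norm_divide power_divide)
    then have d2: "(cmod d)\<^sup>2 = 1 / nsq u" using u by (simp add: field_simps)
    \<comment> \<open>\<open>stage\<close> depends on column \<open>0\<close> only, so the witnesses
      are cut to single columns; then convergence of that column determines the limit equation
      completely.\<close>
    have st: "stage (x * un 0 0) (u * un 0 0) = stage x u"
      unfolding stage_def re_col0 ..
    show ?thesis
    proof (intro exI conjI)
      show "rw n (sc d * (x * un 0 0))" "rw m (sc d * (u * un 0 0))" using 1 by simp_all
      show "sc z * (sc d * (x * un 0 0)) = A * (sc d * (x * un 0 0)) + B * (sc d * (u * un 0 0))"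
        using arg_cong[OF 1(4), of "\<lambda>t. sc d * (t * un 0 0)"] by (simp add: algebra_simps sc_ac)
      show "nsq (sc d * (u * un 0 0)) = 1" using d by (simp flip: nsq_col0)
      show "sc d * (x * un 0 0) * un 0 0 = sc d * (x * un 0 0)" "sc d * (u * un 0 0) * un 0 0 = sc d * (u * un 0 0)"
        by (simp_all add: mult.assoc)
      show "stage (sc d * (x * un 0 0)) (sc d * (u * un 0 0)) < 1 / real (Suc k)"
        unfolding stage_scale st d2 using 1(5) u by (simp add: field_simps)
    qed (rule 1)
  qed
  then obtain z x u where k: "\<And>k. cmod (z k) = 1" "\<And>k. rw n (x k)" "\<And>k. rw m (u k)"
      "\<And>k. sc (z k) * x k = A * x k + B * u k" "\<And>k. nsq (u k) = 1" "\<And>k. x k * un 0 0 = x k" "\<And>k. u k * un 0 0 = u k"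
      "\<And>k. stage (x k) (u k) < 1 / real (Suc k)" by metis
  \<comment> \<open>State, input and frequency are packed into one vector of length
    \<open>n + m + 1\<close>, so that a single subsequence serves all three.\<close>
  define f where "f k i = (if i < n then ent (x k) i 0 else if i < n + m then ent (u k) (i - n) 0 else z k)" for k i
  have "cmod (f k i) \<le> 1 + sqrt c" for k i
  proof -
    have "nsq (x k) \<le> c" using c(2)[of "z k" "x k" "u k"] k by simp
    then have "(cmod (ent (x k) i 0))\<^sup>2 \<le> c" using cmod_ent_le_nsq order_trans by blast
    then have "cmod (ent (x k) i 0) \<le> sqrt c" by (rule real_le_rsqrt)
    moreover have "cmod (ent (u k) (i - n) 0) \<le> sqrt 1"
      by (rule real_le_rsqrt) (use cmod_ent_le_nsq[of "u k"] k(5) in simp)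
    moreover have "0 \<le> sqrt c" "sqrt 1 = (1::real)" using c by simp_all
    ultimately have "cmod (ent (x k) i 0) \<le> 1 + sqrt c" "cmod (ent (u k) (i - n) 0) \<le> 1 + sqrt c"
      "cmod (z k) \<le> 1 + sqrt c" using k(1)[of k] by linarith+
    then show ?thesis by (simp add: f_def)
  qed
  from bounded_subsequence[of f, OF this, of "n + m + 1"] obtain r g where r: "strict_mono (r :: nat \<Rightarrow> nat)"
    "\<And>i. i < n + m + 1 \<Longrightarrow> (\<lambda>k. f (r k) i) \<longlonglongrightarrow> g i" by blast
  define x' where "x' = vF (vec n g)"
  define u' where "u' = vF (vec m (\<lambda>i. g (n + i)))"
  have rw': "rw n x'" "rw m u'" by (simp_all add: x'_def u'_def)
  have lx: "(\<lambda>k. ent (x (r k)) i 0) \<longlonglongrightarrow> ent x' i 0" for i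
  proof (cases "i < n")
    case True then show ?thesis using r(2)[of i] by (simp add: f_def x'_def)
  next
    case False
    then have "ent (x (r k)) i 0 = 0" for k using k(2) unfolding rw_ent by (meson not_less)
    then show ?thesis using False by (simp add: x'_def)
  qed
  have lu: "(\<lambda>k. ent (u (r k)) i 0) \<longlonglongrightarrow> ent u' i 0" for i
  proof (cases "i < m")
    case True then show ?thesis using r(2)[of "n + i"] by (simp add: f_def u'_def)
  next
    case False
    then have "ent (u (r k)) i 0 = 0" for k using k(3) unfolding rw_ent by (meson not_less)
    then show ?thesis using False by (simp add: u'_def)
  qed
  have lz: "(\<lambda>k. z (r k)) \<longlonglongrightarrow> g (n + m)" using r(2)[of "n + m"] by (simp add: f_def)
  have z1: "cmod (g (n + m)) = 1"
    using tendsto_norm[OF lz] k(1) by (simp add: LIMSEQ_const_iff)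
  have nq1: "nsq u' = 1"
  proof -
    have "(\<lambda>k. re (adj (u (r k)) * (1 * u (r k)))) \<longlonglongrightarrow> re (adj u' * (1 * u'))"
      by (rule form_tendsto[OF k(3) rw'(2) k(3) rw'(2) lu lu])
    then show ?thesis using k(5) unfolding nsq_def by (simp add: LIMSEQ_const_iff)
  qed
  have eq: "sc (g (n + m)) * x' = A * x' + B * u'"
  proof (rule lfm_eqI)
    fix i j
    show "ent (sc (g (n + m)) * x') i j = ent (A * x' + B * u') i j"
    proof (cases "j = 0")
      case True
      have "(\<lambda>k. z (r k) * ent (x (r k)) i 0) \<longlonglongrightarrow> g (n + m) * ent x' i 0" by (intro tendsto_intros lz lx)
      moreover have "(\<lambda>k. ent (A * x (r k)) i 0 + ent (B * u (r k)) i 0) \<longlonglongrightarrow> ent (A * x') i 0 + ent (B * u') i 0"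
        by (intro tendsto_intros ent_mult_tendsto[OF k(2) rw'(1) lx] ent_mult_tendsto[OF k(3) rw'(2) lu])
      moreover have "z (r k) * ent (x (r k)) i 0 = ent (A * x (r k)) i 0 + ent (B * u (r k)) i 0" for k
        using arg_cong[OF k(4)[of "r k"], of "\<lambda>t. ent t i 0"] by simp
      ultimately show ?thesis using LIMSEQ_unique True by simp blast
    next
      case False
      have "x' * un 0 0 = x'" "u' * un 0 0 = u'" by (auto intro!: lfm_eqI simp: x'_def u'_def)
      then have "ent (A * x') i j = ent ((A * x') * un 0 0) i j" "ent (B * u') i j = ent ((B * u') * un 0 0) i j"
        by (simp_all only: mult.assoc)
      then show ?thesis using False by (simp add: x'_def)
    qed
  qed
  have "(\<lambda>k. stage (x (r k)) (u (r k))) \<longlonglongrightarrow> stage x' u'"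
    unfolding stage_def
    by (intro tendsto_intros form_tendsto[OF k(2) rw'(1) k(3) rw'(2) lx lu] form_tendsto[OF k(3) rw'(2) k(3) rw'(2) lu lu])
  moreover have "(\<lambda>k. 1 / real (Suc (r k))) \<longlonglongrightarrow> 0"
    using LIMSEQ_subseq_LIMSEQ[OF lim_1_over_n[THEN LIMSEQ_Suc] r(1)] by (simp add: o_def)
  ultimately have "stage x' u' \<le> 0"
    by (rule LIMSEQ_le) (use k(8) less_imp_le in blast)
  moreover have "0 < stage x' u'" using pos[OF z1 rw' eq] nq1 by simp
  ultimately show False by simp
qed

text \<open>The time-domain form of the frequency inequality, for zero initial state. Stopping at
  \<open>L\<close> loses nothing for an input that ends there, since \<open>stage\<close> vanishes
  at zero input.\<close>

definition coercive :: "real \<Rightarrow> bool" where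
  "coercive e \<longleftrightarrow> (\<forall>u L. (\<forall>k. rw m (u k)) \<longrightarrow> e * (\<Sum>k<L. nsq (u k)) \<le> (\<Sum>k<L. stage (traj A B 0 u k) (u k)))"

text \<open>In the application \<open>b\<close> is the state reached from zero after one period, and
  \<open>y\<close> the initial state that makes the response periodic. A fixed vector of
  \<open>A ^ N\<close> is fixed by all powers of it, hence zero by decay, so
  \<open>proj n - A ^ N\<close> is invertible.\<close>

lemma periodic_start:
  assumes "0 < N" "rw n b"
  obtains y where "rw n y" "y = b + A ^ N * y"
proof -
  have rN: "rw n (A ^ N)" "cl n (A ^ N)" using assms(1) A by (cases N, simp, simp, cases N, simp, simp add: power_Suc2 del: power_Suc)
  have inj: "x = 0" if "rw n x" "(proj n - A ^ N) * x = 0" for x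
  proof (rule lfm_eqI)
    fix i j
    define v where "v = x * un j 0"
    have v: "rw n v" "A ^ N * v = v" using that by (simp_all add: v_def algebra_simps flip: mult.assoc)
    have "A ^ (N * k) * v = v" for k
      by (induction k) (use v in \<open>auto simp: power_add mult.assoc\<close>)
    moreover have "(\<lambda>k. ent (A ^ k * v) i 0) \<longlonglongrightarrow> 0" by (rule decay_tendsto[OF A(1,2) v(1)])
    then have "(\<lambda>k. ent (A ^ (N * k) * v) i 0) \<longlonglongrightarrow> 0"
      using LIMSEQ_subseq_LIMSEQ[of "\<lambda>k. ent (A ^ k * v) i 0" 0 "\<lambda>k. N * k"] assms(1) by (simp add: o_def strict_mono_def)
    ultimately have "ent v i 0 = 0" by (simp add: LIMSEQ_const_iff)
    then show "ent x i j = ent 0 i j" by (simp add: v_def)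
  qed
  obtain T where T: "rw n T" "cl n T" "(proj n - A ^ N) * T = proj n"
    using inj_inverse[of n "proj n - A ^ N"] rN inj by (metis cl_closure(2) cl_closure(5) rw_closure(2) rw_closure(5))
  have "(proj n - A ^ N) * (T * b) = proj n * b" using T(3) by (simp flip: mult.assoc)
  then have "T * b = b + A ^ N * (T * b)" using T assms(2) by (simp add: left_diff_distrib algebra_simps)
  then show ?thesis using that[of "T * b"] T by simp
qed

text \<open>The input, truncated at \<open>L\<close>, is repeated with a period \<open>N\<close>;
  the frequency inequality holds for each Fourier coefficient and is summed by
  \<open>parseval\<close>. The periodic response differs from the zero-state one by
  \<open>A ^ k\<close> applied to its initial state, which tends to \<open>0\<close> as the period
  grows. Only the first \<open>L\<close> stages contribute, so the limit is one of sums of fixed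
  length.\<close>

lemma frequency_coercive:
  assumes e: "\<And>z x u. cmod z = 1 \<Longrightarrow> rw n x \<Longrightarrow> rw m u \<Longrightarrow> sc z * x = A * x + B * u \<Longrightarrow> e * nsq u \<le> stage x u"
  shows "coercive e"
  unfolding coercive_def
proof (intro allI impI)
  fix u :: "nat \<Rightarrow> lfm" and L assume "\<forall>k. rw m (u k)"
  then have u: "rw m (u k)" for k by simp
  define v where "v k = (if k < L then u k else 0)" for k
  have v: "rw m (v k)" for k using u by (simp add: v_def)
  define x where "x = traj A B 0 v"
  have xr: "rw n (x k)" for k using A B by (simp add: x_def)
  have xL: "x (L + k) = A ^ k * x L" for k
    by (induction k) (auto simp: x_def v_def mult.assoc)
  have xlim: "(\<lambda>k. nsq (x k)) \<longlonglongrightarrow> 0"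
  proof -
    have "(\<lambda>k. nsq (x (k + L))) \<longlonglongrightarrow> 0"
      using decay_tendsto(1)[OF A(1,2) xr[of L]] by (simp add: xL add.commute[of _ L])
    then show ?thesis by (rule LIMSEQ_offset)
  qed
  have "\<exists>y. rw n y \<and> y = x (Suc k) + A ^ Suc k * y" for k
    using periodic_start[of "Suc k" "x (Suc k)"] xr by (metis zero_less_Suc)
  then obtain y where y: "\<And>k. rw n (y k)" "\<And>k. y k = x (Suc k) + A ^ Suc k * y k" by metis
  have per: "e * (\<Sum>k<L. nsq (v k)) \<le> (\<Sum>k<L. stage (x k + A ^ k * y N') (v k))" if "L \<le> N'" for N'
  proof -
    define N where "N = Suc N'"
    have N: "0 < N" "L \<le> N" using that by (simp_all add: N_def)
    define p where "p k = x k + A ^ k * y N'" for k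
    have p0: "p N = p 0" using y(2)[of N'] by (simp add: p_def N_def x_def)
    have pS: "p (Suc k) = A * p k + B * v k" for k
      by (simp add: p_def x_def algebra_simps)
    have pr: "rw n (p k)" for k using xr y(1) A by (cases k) (auto simp: p_def)
    have hat: "e * nsq (dft N v j) \<le> stage (dft N p j) (dft N v j)" for j
    proof (rule e)
      show "sc (exp (2 * complex_of_real pi * \<i> / of_nat N) ^ j) * dft N p j = A * dft N p j + B * dft N v j"
        by (rule periodic_response_dft[OF N(1) p0 pS])
      show "cmod (exp (2 * complex_of_real pi * \<i> / of_nat N) ^ j) = 1" by (simp add: norm_power norm_exp_eq_Re)
    qed (simp_all add: dft_def pr v)
    have "real N * (e * (\<Sum>k<N. nsq (v k))) = (\<Sum>j<N. e * nsq (dft N v j))"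
      using parseval[OF N(1), of v 1 v] by (simp add: nsq_def flip: sum_distrib_left)
    also have "\<dots> \<le> (\<Sum>j<N. stage (dft N p j) (dft N v j))" by (intro sum_mono hat)
    also have "\<dots> = real N * (\<Sum>k<N. stage (p k) (v k))"
      using parseval[OF N(1), of p S v] parseval[OF N(1), of v R v]
      by (simp add: stage_def sum.distrib flip: sum_distrib_left) (simp add: algebra_simps)
    finally have "e * (\<Sum>k<N. nsq (v k)) \<le> (\<Sum>k<N. stage (p k) (v k))"
      using N(1) by (simp add: mult_le_cancel_left_pos)
    moreover have "(\<Sum>k<N. nsq (v k)) = (\<Sum>k<L. nsq (v k))"
      by (rule sum.mono_neutral_right) (use N in \<open>auto simp: v_def nsq_def\<close>)
    moreover have "(\<Sum>k<N. stage (p k) (v k)) = (\<Sum>k<L. stage (p k) (v k))"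
      by (rule sum.mono_neutral_right) (use N in \<open>auto simp: v_def stage_def\<close>)
    ultimately show ?thesis by (simp add: p_def)
  qed
  have ylim: "(\<lambda>k. nsq (y k)) \<longlonglongrightarrow> 0"
  proof -
    obtain c r where cr: "0 \<le> c" "0 \<le> r" "r < 1" "\<And>k x. rw n x \<Longrightarrow> nsq (A ^ k * x) \<le> c * r ^ k * nsq x"
      using decay_nsq[OF A(1,2)] by metis
    have "(\<lambda>k. c * r ^ Suc k) \<longlonglongrightarrow> c * 0"
      by (rule tendsto_mult_left[OF LIMSEQ_Suc[OF LIMSEQ_realpow_zero[OF cr(2,3)]]])
    \<comment> \<open>Once the contraction constant is below \<open>1 / 4\<close>,
      \<open>nsq_triangle\<close> leaves half of \<open>nsq (y k)\<close> on the right; absorbing it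
      gives the factor \<open>4\<close>.\<close>
    then have "\<forall>\<^sub>F k in sequentially. c * r ^ Suc k < 1 / 4" by (intro order_tendstoD) auto
    then have ev: "\<forall>\<^sub>F k in sequentially. nsq (y k) \<le> 4 * nsq (x (Suc k))"
    proof eventually_elim
      case (elim k)
      have "nsq (y k) \<le> 2 * nsq (x (Suc k)) + 2 * nsq (A ^ Suc k * y k)"
        by (subst y(2)) (rule nsq_triangle)
      moreover have "nsq (A ^ Suc k * y k) \<le> 1 / 4 * nsq (y k)"
        using cr(4)[OF y(1), of "Suc k" k] mult_right_mono[OF less_imp_le[OF elim] nsq_nonneg[of "y k"]] by linarith
      ultimately show ?case by linarith
    qed
    have "(\<lambda>k. 4 * nsq (x (Suc k))) \<longlonglongrightarrow> 4 * 0" by (rule tendsto_mult_left[OF LIMSEQ_Suc[OF xlim]])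
    then show ?thesis
      using ev by (intro tendsto_sandwich[OF _ ev tendsto_const]) (auto intro: always_eventually)
  qed
  have yent: "(\<lambda>k. ent (y k) i 0) \<longlonglongrightarrow> ent 0 i 0" for i
  proof -
    have "(\<lambda>k. sqrt (nsq (y k))) \<longlonglongrightarrow> sqrt 0" by (intro tendsto_intros ylim)
    moreover have "norm (ent (y k) i 0) \<le> sqrt (nsq (y k))" for k
      using cmod_ent_le_nsq real_le_rsqrt by blast
    ultimately have "(\<lambda>k. ent (y k) i 0) \<longlonglongrightarrow> 0"
      by (metis (no_types, lifting) Lim_null_comparison always_eventually real_sqrt_zero)
    then show ?thesis by simp
  qed
  have Akr: "rw n (A ^ k * y N)" for k N using A y(1) by (cases k) auto
  have "(\<lambda>N. re (adj (A ^ k * y N) * (S * v k))) \<longlonglongrightarrow> re (adj 0 * (S * v k))" for k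
  proof (rule form_tendsto[OF Akr _ v v])
    show "(\<lambda>N. ent (A ^ k * y N) i 0) \<longlonglongrightarrow> ent 0 i 0" for i
      using ent_mult_tendsto[OF y(1) _ yent, of "A ^ k" i] by simp
  qed simp_all
  then have "(\<lambda>N. \<Sum>k<L. stage (x k + A ^ k * y N) (v k)) \<longlonglongrightarrow> (\<Sum>k<L. stage (x k) (v k) + 2 * 0)"
    unfolding stage_add by (intro tendsto_intros) simp
  then have "e * (\<Sum>k<L. nsq (v k)) \<le> (\<Sum>k<L. stage (x k) (v k) + 2 * 0)"
    by (rule LIMSEQ_le_const) (use per in blast)
  also have "(\<Sum>k<L. stage (x k) (v k) + 2 * 0) = (\<Sum>k<L. stage (traj A B 0 u k) (u k))"
    unfolding x_def by (intro sum.cong refl) (auto simp: v_def intro!: arg_cong2[where f = stage] traj_cong)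
  finally show "e * (\<Sum>k<L. nsq (u k)) \<le> (\<Sum>k<L. stage (traj A B 0 u k) (u k))"
    by (simp add: v_def)
qed

end

section \<open>Riccati equation and spectral factorization\<close>

lemma positive_inverse:
  assumes "hm H" "rw m H" "0 < e" "\<And>u. rw m u \<Longrightarrow> e * nsq u \<le> re (adj u * (H * u))"
  obtains T where "rw m T" "cl m T" "H * T = proj m" "T * H = proj m" "rl H \<Longrightarrow> rl T"
proof -
  have inj: "x = 0" if x: "rw m x" "H * x = 0" for x
  proof (rule lfm_eqI)
    fix i j
    have "e * nsq (x * un j 0) \<le> re (adj (x * un j 0) * ((H * x) * un j 0))"
      using assms(4)[of "x * un j 0"] x(1) by (simp only: mult.assoc rw_mult)
    then have "e * nsq (x * un j 0) \<le> 0" using x(2) by simp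
    then have "nsq (x * un j 0) = 0" using assms(3) nsq_nonneg[of "x * un j 0"]
      by (simp add: mult_le_0_iff)
    from nsq_0D[OF this, of i] show "ent x i j = ent 0 i j" by simp
  qed
  have "cl m H" using assms hm_cl by blast
  from inj_inverse[OF assms(2) this inj] obtain T where T: "rw m T" "cl m T" "H * T = proj m" "T * H = proj m" by metis
  have "rl T" if "rl H"
  proof -
    have "cj T * H = proj m" using arg_cong[OF T(4), of cj] that by (simp add: rl_def)
    moreover have "cj T = cj T * (H * T)" using T by simp
    ultimately have "cj T = T" using T(1) by (simp flip: mult.assoc)
    then show ?thesis by (simp add: rl_def)
  qed
  then show ?thesis using that T by blast
qed

lemma hm_sc: "cnj c = c \<Longrightarrow> hm A \<Longrightarrow> hm (sc c * A)"
  by (simp add: hm_def sc_ac)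

lemma form_hm_swap: "hm H \<Longrightarrow> re (adj x * (H * y)) = re (adj y * (H * x))"
  using re_swap[of y "H * x"] by (simp add: hm_adj mult.assoc)

lemma stein_sum_le:
  assumes "adj A * (G * A) + Q = G" "psd G"
  shows "(\<Sum>k<L. re (adj (A ^ k * x) * (Q * (A ^ k * x)))) \<le> re (adj x * (G * x))"
proof -
  have G: "re (adj x * (G * x)) = re (adj (A * x) * (G * (A * x))) + re (adj x * (Q * x))" for x
    by (subst assms(1)[symmetric]) (simp add: algebra_simps)
  have "re (adj x * (G * x)) = (\<Sum>k<L. re (adj (A ^ k * x) * (Q * (A ^ k * x)))) + re (adj (A ^ L * x) * (G * (A ^ L * x)))"
  proof (induction L)
    case (Suc L)
    then show ?case using G[of "A ^ L * x"] by (simp only: sum.lessThan_Suc power_Suc mult.assoc)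
  qed simp
  then show ?thesis using psd_form[OF assms(2), of "A ^ L * x"] by linarith
qed

section \<open>Value iteration and the stabilizing Riccati solution\<close>

context lq
begin

text \<open>Coefficients of the one-step cost: \<open>Rt P\<close> is its quadratic part in the
  input and \<open>Lt P\<close> the coupling of input and state, see
  \<open>cost_expand\<close>.\<close>

definition Rt :: "lfm \<Rightarrow> lfm" where "Rt P = R + adj B * (P * B)"
definition Lt :: "lfm \<Rightarrow> lfm" where "Lt P = adj S + adj B * (P * A)"
definition cost :: "lfm \<Rightarrow> lfm \<Rightarrow> lfm \<Rightarrow> real" where
  "cost P x u = stage x u + re (adj (A * x + B * u) * (P * (A * x + B * u)))"

lemma Rt_hm: "hm P \<Longrightarrow> hm (Rt P)" and Rt_rw: "rw m (Rt P)" and Lt_rw: "rw m (Lt P)"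
  using R B S by (simp_all add: Rt_def Lt_def)

lemma cost_expand:
  assumes "hm P"
  shows "cost P x u = re (adj (A * x) * (P * (A * x))) + re (adj u * (Rt P * u)) + 2 * re (adj u * (Lt P * x))"
proof -
  have "re (adj x * (S * u)) = re (adj u * (adj S * x))" using re_swap[of u "adj S * x"] by (simp add: mult.assoc)
  moreover have "re (adj (A * x) * (P * (B * u))) = re (adj (B * u) * (P * (A * x)))"
    by (rule form_hm_swap[OF assms])
  ultimately show ?thesis
    by (simp add: cost_def stage_def Rt_def Lt_def algebra_simps)
qed

text \<open>Completion of the square in \<open>u\<close>: \<open>K\<close> is the minimizing
  feedback and \<open>P'\<close> the form of minimal values, one step of the Riccati
  recursion.\<close>

lemma riccati_step:
  assumes P: "hm P" "rw n P" "0 < e" "\<And>u. rw m u \<Longrightarrow> e * nsq u \<le> re (adj u * (Rt P * u))"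
  obtains P' K where "hm P'" "rw n P'" "rw m K" "cl n K" "Rt P * K = - Lt P"
    "P' + adj K * (Rt P * K) = adj A * (P * A)"
    "\<And>x u. cost P x u = re (adj x * (P' * x)) + re (adj (u - K * x) * (Rt P * (u - K * x)))"
    "rl A \<Longrightarrow> rl B \<Longrightarrow> rl S \<Longrightarrow> rl R \<Longrightarrow> rl P \<Longrightarrow> rl P' \<and> rl K"
proof -
  obtain T where T: "rw m T" "cl m T" "Rt P * T = proj m" "T * Rt P = proj m" "rl (Rt P) \<Longrightarrow> rl T"
    using positive_inverse[OF Rt_hm[OF P(1)] Rt_rw P(3,4)] by blast
  define K where "K = - (T * Lt P)"
  have clP: "cl n P" using P hm_cl by blast
  have clL: "cl n (Lt P)" using A S by (simp add: Lt_def)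
  have RK: "Rt P * K = - Lt P" using T(3) Lt_rw by (simp add: K_def flip: mult.assoc)
  define P' where "P' = adj A * (P * A) - adj K * (Rt P * K)"
  have hmP': "hm P'" using P Rt_hm by (simp add: P'_def)
  show ?thesis
  proof (rule that)
    show "hm P'" by (rule hmP')
    show "rw n P'" using A clL T by (simp add: P'_def K_def)
    show "rw m K" using T by (simp add: K_def)
    show "cl n K" using clL by (simp add: K_def)
    show "Rt P * K = - Lt P" by (rule RK)
    show "P' + adj K * (Rt P * K) = adj A * (P * A)" by (simp add: P'_def)
    show "cost P x u = re (adj x * (P' * x)) + re (adj (u - K * x) * (Rt P * (u - K * x)))" for x u
    proof -
      define y where "y = K * x"
      have L: "Lt P * x = - (Rt P * y)" using RK by (simp add: y_def flip: mult.assoc)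
      have "re (adj x * (P' * x)) = re (adj (A * x) * (P * (A * x))) - re (adj y * (Rt P * y))"
        by (simp add: P'_def y_def algebra_simps)
      moreover have "re (adj (u - y) * (Rt P * (u - y))) = re (adj u * (Rt P * u)) - re (adj u * (Rt P * y))
          - re (adj y * (Rt P * u)) + re (adj y * (Rt P * y))"
        by (simp add: algebra_simps)
      moreover have "re (adj y * (Rt P * u)) = re (adj u * (Rt P * y))" by (rule form_hm_swap[OF Rt_hm[OF P(1)]])
      ultimately show ?thesis unfolding cost_expand[OF P(1)] L y_def[symmetric] by simp
    qed
    show "rl P' \<and> rl K" if "rl A" "rl B" "rl S" "rl R" "rl P"
    proof -
      have "rl T" using T(5) that by (simp add: Rt_def)
      then have "rl K" using that by (simp add: K_def Lt_def)
      then show ?thesis using that by (simp add: P'_def Rt_def)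
    qed
  qed
qed

text \<open>Records that the values are costs of actual inputs, not that they are optimal. This
  suffices to compare them with coercivity; optimality enters through \<open>step\<close>.\<close>

definition attained :: "nat \<Rightarrow> lfm \<Rightarrow> bool" where
  "attained k P \<longleftrightarrow> hm P \<and> rw n P \<and> (rl A \<longrightarrow> rl B \<longrightarrow> rl S \<longrightarrow> rl R \<longrightarrow> rl P) \<and>
    (\<forall>x. rw n x \<longrightarrow> (\<exists>u. (\<forall>j. rw m (u j)) \<and> (\<Sum>j<k. stage (traj A B x u j) (u j)) = re (adj x * (P * x))))"

definition step :: "lfm \<Rightarrow> lfm \<Rightarrow> bool" where
  "step P P' \<longleftrightarrow> (\<exists>K. rw m K \<and>
    (\<forall>x u. cost P x u = re (adj x * (P' * x)) + re (adj (u - K * x) * (Rt P * (u - K * x)))))"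

text \<open>The input \<open>u\<close>, followed by one that attains \<open>P\<close> from the state
  \<open>B * u\<close>, gives a trajectory from zero whose cost is exactly the form of
  \<open>Rt P\<close> at \<open>u\<close>.\<close>

lemma attained_coercive:
  assumes "coercive e" "0 < e" "attained k P" "rw m u"
  shows "e * nsq u \<le> re (adj u * (Rt P * u))"
proof -
  have "rw n (B * u)" using B by simp
  then obtain v where v: "\<And>j. rw m (v j)" "(\<Sum>j<k. stage (traj A B (B * u) v j) (v j)) = re (adj (B * u) * (P * (B * u)))"
    using assms(3) unfolding attained_def by blast
  define w where "w = case_nat u v"
  have "rw m (w j)" for j using v assms(4) by (cases j) (auto simp: w_def)
  then have "e * (\<Sum>j<Suc k. nsq (w j)) \<le> (\<Sum>j<Suc k. stage (traj A B 0 w j) (w j))"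
    using assms(1) unfolding coercive_def by blast
  also have "\<dots> = re (adj u * (R * u)) + re (adj (B * u) * (P * (B * u)))"
    unfolding sum.lessThan_Suc_shift traj_shift by (simp add: w_def stage_def v(2)[unfolded stage_def])
  also have "\<dots> = re (adj u * (Rt P * u))" by (simp add: Rt_def algebra_simps)
  finally have "e * (\<Sum>j<Suc k. nsq (w j)) \<le> re (adj u * (Rt P * u))" .
  moreover have "nsq u \<le> (\<Sum>j<Suc k. nsq (w j))"
    unfolding sum.lessThan_Suc_shift by (simp add: w_def sum_nonneg)
  ultimately show ?thesis using assms(2) by (meson mult_left_mono less_imp_le order_trans)
qed

lemma value_iteration:
  assumes "coercive e" "0 < e"
  obtains P where "\<And>k. attained k (P k)" "\<And>k. step (P k) (P (Suc k))"
proof -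
  have "\<exists>P. \<forall>k. attained k (P k) \<and> step (P k) (P (Suc k))"
  proof (rule dependent_nat_choice)
    show "\<exists>P. attained 0 P" unfolding attained_def by (intro exI[of _ 0]) (auto intro: exI[of _ "\<lambda>j. 0"])
  next
    fix P k assume a: "attained k P"
    then have P: "hm P" "rw n P" by (auto simp: attained_def)
    obtain P' K where P': "hm P'" "rw n P'" "rw m K"
      "\<And>x u. cost P x u = re (adj x * (P' * x)) + re (adj (u - K * x) * (Rt P * (u - K * x)))"
      "rl A \<Longrightarrow> rl B \<Longrightarrow> rl S \<Longrightarrow> rl R \<Longrightarrow> rl P \<Longrightarrow> rl P' \<and> rl K"
      using riccati_step[OF P assms(2) attained_coercive[OF assms a]] by metis
    have "\<exists>u. (\<forall>j. rw m (u j)) \<and> (\<Sum>j<Suc k. stage (traj A B x u j) (u j)) = re (adj x * (P' * x))" if x: "rw n x" for x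
    proof -
      have "rw n (A * x + B * (K * x))" using A B by simp
      then obtain v where v: "\<And>j. rw m (v j)"
        "(\<Sum>j<k. stage (traj A B (A * x + B * (K * x)) v j) (v j)) = re (adj (A * x + B * (K * x)) * (P * (A * x + B * (K * x))))"
        using a unfolding attained_def by blast
      \<comment> \<open>The feedback value \<open>K * x\<close> is played at time zero, then an
        input attaining \<open>P\<close> from the next state.\<close>
      have "(\<Sum>j<Suc k. stage (traj A B x (case_nat (K * x) v) j) (case_nat (K * x) v j)) = cost P x (K * x)"
        unfolding sum.lessThan_Suc_shift traj_shift by (simp add: v(2) cost_def del: adj_simps adj_mult)
      also have "\<dots> = re (adj x * (P' * x))" unfolding P'(4) by simp
      finally have "(\<Sum>j<Suc k. stage (traj A B x (case_nat (K * x) v) j) (case_nat (K * x) v j)) = re (adj x * (P' * x))" .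
      moreover have "rw m (case_nat (K * x) v j)" for j using v(1) P'(3) by (cases j) simp_all
      ultimately show ?thesis by blast
    qed
    then have "attained (Suc k) P'" using P' a unfolding attained_def by blast
    moreover have "step P P'" using P'(3,4) unfolding step_def by blast
    ultimately show "\<exists>P'. attained (Suc k) P' \<and> step P P'" by blast
  qed
  then show ?thesis using that by blast
qed

text \<open>The trajectory from \<open>x\<close> is the free response plus the trajectory from zero.
  Young's inequality trades the cross term against the surplus \<open>e * nsq (u k)\<close> of
  coercivity; what remains are the energies of \<open>adj S * (A ^ k * x)\<close> weighted by
  \<open>1 / e\<close>, and a Stein equation bounds their sum.\<close>

lemma cost_bounded_below:
  assumes "coercive e" "0 < e"
  obtains G where "\<And>x (u :: nat \<Rightarrow> lfm) L. rw n x \<Longrightarrow> (\<And>k. rw m (u k)) \<Longrightarrow>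
    - re (adj x * (G * x)) \<le> (\<Sum>k<L. stage (traj A B x u k) (u k))"
proof -
  define Q where "Q = sc (complex_of_real (1 / e)) * (S * adj S)"
  have "adj (sc (complex_of_real (1 / sqrt e)) * adj S) * (sc (complex_of_real (1 / sqrt e)) * adj S) = Q"
    using assms(2) by (simp add: Q_def mult.assoc sc_ac flip: of_real_mult)
  then have "psd Q" by (metis psd_gram(1))
  moreover have "rw n Q" using S by (simp add: Q_def)
  ultimately obtain G where G: "adj A * (G * A) + Q = G" "psd G"
    using stein[OF A, of Q] by (metis psd_hm)
  show ?thesis
  proof (rule that)
    fix x L and u :: "nat \<Rightarrow> lfm" assume x: "rw n x" and u: "\<And>k. rw m (u k)"
    have st: "- (re (adj (A ^ k * x) * (Q * (A ^ k * x)))) - e * nsq (u k) + stage (traj A B 0 u k) (u k)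
        \<le> stage (traj A B x u k) (u k)" for k
    proof -
      define y where "y = adj S * (A ^ k * x)"
      have "stage (traj A B x u k) (u k) = stage (traj A B 0 u k) (u k) + 2 * re (adj (A ^ k * x) * (S * u k))"
        by (subst traj_linear, subst add.commute) (rule stage_add)
      also have "re (adj (A ^ k * x) * (S * u k)) = re (adj y * u k)" by (simp add: y_def mult.assoc)
      finally have s: "stage (traj A B x u k) (u k) = stage (traj A B 0 u k) (u k) + 2 * re (adj y * u k)" .
      have "2 * re (adj (- y) * u k) \<le> 1 / e * nsq (- y) + nsq (u k) / (1 / e)" by (rule young) (use assms in simp)
      moreover have "1 / e * nsq (- y) = nsq y / e" "nsq (u k) / (1 / e) = e * nsq (u k)" "re (adj (- y) * u k) = - re (adj y * u k)"
        by (simp_all add: nsq_def)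
      ultimately have "- (nsq y / e) - e * nsq (u k) \<le> 2 * re (adj y * u k)" by linarith
      moreover have "re (adj (A ^ k * x) * (Q * (A ^ k * x))) = nsq y / e"
      proof -
        have "adj (A ^ k * x) * (Q * (A ^ k * x)) = sc (complex_of_real (1 / e)) * (adj y * y)"
          by (simp add: Q_def y_def mult.assoc sc_ac)
        then show ?thesis by (simp only: re_simps nsq_def) simp
      qed
      ultimately show ?thesis using s by linarith
    qed
    have "- re (adj x * (G * x)) \<le> - (\<Sum>k<L. re (adj (A ^ k * x) * (Q * (A ^ k * x))))"
      using stein_sum_le[OF G, of x L] by simp
    also have "\<dots> \<le> \<dots> + ((\<Sum>k<L. stage (traj A B 0 u k) (u k)) - e * (\<Sum>k<L. nsq (u k)))"
      using assms(1) u unfolding coercive_def by simp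
    also have "\<dots> = (\<Sum>k<L. - (re (adj (A ^ k * x) * (Q * (A ^ k * x)))) - e * nsq (u k) + stage (traj A B 0 u k) (u k))"
      by (simp add: sum.distrib sum_subtractf sum_negf sum_distrib_left)
    also have "\<dots> \<le> (\<Sum>k<L. stage (traj A B x u k) (u k))" by (intro sum_mono st)
    finally show "- re (adj x * (G * x)) \<le> (\<Sum>k<L. stage (traj A B x u k) (u k))" .
  qed
qed

lemma cost_mono:
  assumes "\<And>x. rw n x \<Longrightarrow> re (adj x * (P * x)) \<le> re (adj x * (P' * x))"
  shows "cost P x u \<le> cost P' x u"
  unfolding cost_def using A B by (intro add_left_mono assms) simp

text \<open>Value iteration from \<open>0\<close> decreases, since the zero input has no stage cost
  and a step is monotone, and it is bounded below, hence converges. The property quantified over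
  \<open>P'\<close> is a comparison principle: the limit dominates every nonpositive form that does
  not exceed its own one-step cost.\<close>

lemma riccati:
  assumes e: "coercive e" "0 < e"
  obtains P K where "hm P" "rw n P" "rw m K" "cl n K" "Rt P * K = - Lt P"
    "P + adj K * (Rt P * K) = adj A * (P * A)"
    "\<And>u. rw m u \<Longrightarrow> e * nsq u \<le> re (adj u * (Rt P * u))"
    "\<And>x. rw n x \<Longrightarrow> re (adj x * (P * x)) \<le> 0"
    "\<And>x. rw n x \<Longrightarrow> re (adj x * (P * x)) = cost P x (K * x)"
    "\<And>x u. rw n x \<Longrightarrow> rw m u \<Longrightarrow> re (adj x * (P * x)) \<le> cost P x u"
    "\<And>P' x. (\<And>x. rw n x \<Longrightarrow> re (adj x * (P' * x)) \<le> 0) \<Longrightarrow>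
      (\<And>x u. rw n x \<Longrightarrow> rw m u \<Longrightarrow> re (adj x * (P' * x)) \<le> cost P' x u) \<Longrightarrow>
      rw n x \<Longrightarrow> re (adj x * (P' * x)) \<le> re (adj x * (P * x))"
    "rl A \<Longrightarrow> rl B \<Longrightarrow> rl S \<Longrightarrow> rl R \<Longrightarrow> rl P \<and> rl K"
proof -
  obtain P where P: "\<And>k. attained k (P k)" "\<And>k. step (P k) (P (Suc k))"
    using value_iteration[OF e] by blast
  have hP: "hm (P k)" "rw n (P k)" for k using P(1) by (auto simp: attained_def)
  define f where "f x k = re (adj x * (P k * x))" for x k
  obtain K where K: "\<And>k. rw m (K k)"
    "\<And>k x u. cost (P k) x u = f x (Suc k) + re (adj (u - K k * x) * (Rt (P k) * (u - K k * x)))"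
    using P(2) unfolding step_def f_def by metis
  have le_cost: "f x (Suc k) \<le> cost (P k) x u" if "rw n x" "rw m u" for x u k
  proof -
    have "0 \<le> e * nsq (u - K k * x)" using e by simp
    also have "\<dots> \<le> re (adj (u - K k * x) * (Rt (P k) * (u - K k * x)))"
      by (rule attained_coercive[OF e P(1)]) (use that K in simp)
    finally show ?thesis unfolding K(2) by simp
  qed
  have eq_cost: "f x (Suc k) = cost (P k) x (K k * x)" for x k unfolding K(2) by simp
  have f0: "f x 0 = 0" if "rw n x" for x
    using P(1)[of 0] that unfolding attained_def f_def by force
  have dec: "f x (Suc k) \<le> f x k" if "rw n x" for x k
    using that
  proof (induction k arbitrary: x)
    case 0
    have "f x (Suc 0) \<le> cost (P 0) x 0" by (rule le_cost) (use 0 in simp_all)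
    also have "\<dots> = f (A * x) 0" by (simp add: cost_def stage_def f_def)
    finally show ?case using f0 0 A by simp
  next
    case (Suc k)
    have "f x (Suc (Suc k)) \<le> cost (P (Suc k)) x (K k * x)"
      by (rule le_cost) (use Suc K in simp_all)
    also have "\<dots> \<le> cost (P k) x (K k * x)"
      by (rule cost_mono) (use Suc.IH in \<open>simp add: f_def\<close>)
    finally show ?case unfolding eq_cost .
  qed
  obtain G where G: "\<And>x (u :: nat \<Rightarrow> lfm) L. rw n x \<Longrightarrow> (\<And>k. rw m (u k)) \<Longrightarrow>
    - re (adj x * (G * x)) \<le> (\<Sum>k<L. stage (traj A B x u k) (u k))"
    using cost_bounded_below[OF e] by blast
  have bdd: "- re (adj x * (G * x)) \<le> f x k" if x: "rw n x" for x k
  proof -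
    obtain u where "\<And>j. rw m (u j)" "(\<Sum>j<k. stage (traj A B x u j) (u j)) = f x k"
      using P(1)[of k] x unfolding attained_def f_def by blast
    then show ?thesis using G[OF x, of u k] by simp
  qed
  have decs: "decseq (f x)" if "rw n x" for x using dec[OF that] by (rule decseq_SucI)
  have conv: "convergent (\<lambda>k. re (adj x * (P k * x)))" if x: "rw n x" for x
    using decseq_convergent[OF decs[OF x], of "- re (adj x * (G * x))"] bdd[OF x]
    unfolding f_def convergent_def by blast
  obtain Q where Q: "hm Q" "rw n Q" "(\<And>k. rl (P k)) \<Longrightarrow> rl Q"
    and Qlim: "\<And>x. rw n x \<Longrightarrow> (\<lambda>k. re (adj x * (P k * x))) \<longlonglongrightarrow> re (adj x * (Q * x))"
    using form_limit[of P n] hP conv by metis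
  have Qf: "f x \<longlonglongrightarrow> re (adj x * (Q * x))" if "rw n x" for x
    using Qlim[OF that] by (simp add: f_def[abs_def])
  have Qle: "re (adj x * (Q * x)) \<le> f x k" if "rw n x" for x k
    by (rule decseq_ge[OF decs[OF that] Qf[OF that]])
  have RtQ: "e * nsq u \<le> re (adj u * (Rt Q * u))" if u: "rw m u" for u
  proof (rule LIMSEQ_le_const)
    have "rw n (B * u)" using B by simp
    then have "(\<lambda>k. re (adj u * (R * u)) + re (adj (B * u) * (P k * (B * u)))) \<longlonglongrightarrow>
        re (adj u * (R * u)) + re (adj (B * u) * (Q * (B * u)))" by (intro tendsto_intros Qlim)
    then show "(\<lambda>k. re (adj u * (Rt (P k) * u))) \<longlonglongrightarrow> re (adj u * (Rt Q * u))"
      by (simp add: Rt_def algebra_simps)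
  qed (use attained_coercive[OF e P(1) u] in blast)
  obtain Q' K' where Q': "hm Q'" "rw n Q'" "rw m K'" "cl n K'" "Rt Q * K' = - Lt Q"
    "Q' + adj K' * (Rt Q * K') = adj A * (Q * A)"
    and Qcost: "\<And>x u. cost Q x u = re (adj x * (Q' * x)) + re (adj (u - K' * x) * (Rt Q * (u - K' * x)))"
    and real: "rl A \<Longrightarrow> rl B \<Longrightarrow> rl S \<Longrightarrow> rl R \<Longrightarrow> rl Q \<Longrightarrow> rl Q' \<and> rl K'"
    using riccati_step[OF Q(1,2) e(2) RtQ] by metis
  have Q_le_cost: "re (adj x * (Q * x)) \<le> cost Q x u" if x: "rw n x" "rw m u" for x u
  proof (rule LIMSEQ_le)
    show "(\<lambda>k. f x (Suc k)) \<longlonglongrightarrow> re (adj x * (Q * x))" by (rule LIMSEQ_Suc[OF Qf[OF x(1)]])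
    have "rw n (A * x + B * u)" using A B by simp
    then show "(\<lambda>k. cost (P k) x u) \<longlonglongrightarrow> cost Q x u" unfolding cost_def by (intro tendsto_intros Qlim)
  qed (use le_cost[OF x] in blast)
  \<comment> \<open>\<open>Q\<close> lies below \<open>Q'\<close> by the limit inequality at the
    optimal input for \<open>Q\<close>. Conversely \<open>Q\<close> lies below every iterate, so its
    one-step cost at the input \<open>K k * y\<close> lies below the next iterate, and these tend to
    \<open>Q\<close>.\<close>
  have "Q' = Q"
  proof (rule hm_eqI[OF Q'(1) Q(1)])
    fix x
    define y where "y = proj n * x"
    have y: "rw n y" by (simp add: y_def)
    have "re (adj y * (Q * y)) \<le> cost Q y (K' * y)" by (rule Q_le_cost) (use y Q' in simp_all)
    then have "re (adj y * (Q * y)) \<le> re (adj y * (Q' * y))" unfolding Qcost by simp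
    moreover have "re (adj y * (Q' * y)) \<le> re (adj y * (Q * y))"
    proof (rule LIMSEQ_le_const[OF LIMSEQ_Suc[OF Qf[OF y]]], intro exI allI impI)
      fix k
      have "0 \<le> e * nsq (K k * y - K' * y)" using e by simp
      also have "\<dots> \<le> re (adj (K k * y - K' * y) * (Rt Q * (K k * y - K' * y)))"
        by (rule RtQ) (use K Q' in simp)
      finally have "re (adj y * (Q' * y)) \<le> cost Q y (K k * y)" unfolding Qcost by simp
      also have "\<dots> \<le> cost (P k) y (K k * y)"
        by (rule cost_mono) (use Qle in \<open>simp add: f_def\<close>)
      finally show "re (adj y * (Q' * y)) \<le> f y (Suc k)" unfolding eq_cost .
    qed
    ultimately have "re (adj y * (Q' * y)) = re (adj y * (Q * y))" by simp
    then show "re (adj x * (Q' * x)) = re (adj x * (Q * x))"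
      unfolding y_def form_proj[OF Q'(1,2)] form_proj[OF Q(1,2)] .
  qed
  show ?thesis
  proof (rule that[OF Q(1,2) Q'(3,4,5)])
    show "Q + adj K' * (Rt Q * K') = adj A * (Q * A)" using Q'(6) \<open>Q' = Q\<close> by simp
    show "re (adj x * (Q * x)) \<le> 0" if "rw n x" for x using Qle[OF that, of 0] f0[OF that] by simp
    show "re (adj x * (Q * x)) = cost Q x (K' * x)" for x unfolding Qcost \<open>Q' = Q\<close> by simp
    show "re (adj x * (Z * x)) \<le> re (adj x * (Q * x))"
      if Z: "\<And>x. rw n x \<Longrightarrow> re (adj x * (Z * x)) \<le> 0"
        "\<And>x u. rw n x \<Longrightarrow> rw m u \<Longrightarrow> re (adj x * (Z * x)) \<le> cost Z x u" and x: "rw n x" for Z x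
    proof (rule LIMSEQ_le_const[OF Qf[OF x]], intro exI allI impI)
      fix k
      show "re (adj x * (Z * x)) \<le> f x k" using x
      proof (induction k arbitrary: x)
        case 0 then show ?case using Z(1) f0 by simp
      next
        case (Suc k)
        have "re (adj x * (Z * x)) \<le> cost Z x (K k * x)" by (rule Z(2)) (use Suc K in simp_all)
        also have "\<dots> \<le> cost (P k) x (K k * x)" by (rule cost_mono) (use Suc.IH in \<open>simp add: f_def\<close>)
        finally show ?case unfolding eq_cost .
      qed
    qed
    show "rl Q \<and> rl K'" if "rl A" "rl B" "rl S" "rl R"
    proof -
      have "rl Q" by (rule Q(3)) (use P(1) that in \<open>simp add: attained_def\<close>)
      then show ?thesis using real that by simp
    qed
  qed (use RtQ Q_le_cost in auto)
qed

text \<open>Lowering \<open>R\<close> by \<open>e / 2\<close> gives a smaller solution; the difference of the two solutions is a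
  Lyapunov function for the closed loop that decreases by at least \<open>e / 2\<close> times the input energy.\<close>
lemma stabilizing_riccati:
  assumes e: "coercive e" "0 < e" and "rl A" "rl B" "rl S" "rl R"
  obtains P K where "hm P" "rw n P" "rw m K" "cl n K" "rl P" "rl K" "Rt P * K = - Lt P"
    "P + adj K * (Rt P * K) = adj A * (P * A)"
    "\<And>u. rw m u \<Longrightarrow> e * nsq u \<le> re (adj u * (Rt P * u))"
    "decay (A + B * K)"
proof -
  obtain P K where P: "hm P" "rw n P" "rw m K" "cl n K" "Rt P * K = - Lt P"
    "P + adj K * (Rt P * K) = adj A * (P * A)"
    "\<And>u. rw m u \<Longrightarrow> e * nsq u \<le> re (adj u * (Rt P * u))"
    "\<And>x. rw n x \<Longrightarrow> re (adj x * (P * x)) = cost P x (K * x)"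
    and maxP: "\<And>P' x. (\<And>x. rw n x \<Longrightarrow> re (adj x * (P' * x)) \<le> 0) \<Longrightarrow>
      (\<And>x u. rw n x \<Longrightarrow> rw m u \<Longrightarrow> re (adj x * (P' * x)) \<le> cost P' x u) \<Longrightarrow>
      rw n x \<Longrightarrow> re (adj x * (P' * x)) \<le> re (adj x * (P * x))"
    and realP: "rl P" "rl K"
    using riccati[OF e] assms(3-) by metis
  interpret L: lq n m A B S "R - sc (complex_of_real (e / 2)) * proj m"
    by unfold_locales (use A B S R in \<open>simp_all add: hm_sc\<close>)
  have Lst: "L.stage x u = stage x u - e / 2 * nsq u" if "rw m u" for x u
  proof -
    have "adj u * ((R - sc (complex_of_real (e / 2)) * proj m) * u)
        = adj u * (R * u) - sc (complex_of_real (e / 2)) * (adj u * u)"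
      using that by (simp add: algebra_simps sc_ac)
    then show ?thesis unfolding L.stage_def stage_def nsq_def by (simp only: re_simps)
  qed
  have "L.coercive (e / 2)" unfolding L.coercive_def
  proof (intro allI impI)
    fix u :: "nat \<Rightarrow> lfm" and N assume u: "\<forall>k. rw m (u k)"
    then have "e * (\<Sum>k<N. nsq (u k)) \<le> (\<Sum>k<N. stage (traj A B 0 u k) (u k))"
      using e(1) unfolding coercive_def by blast
    moreover have "(\<Sum>k<N. L.stage (traj A B 0 u k) (u k)) = (\<Sum>k<N. stage (traj A B 0 u k) (u k) - e / 2 * nsq (u k))"
      by (rule sum.cong[OF refl Lst]) (use u in blast)
    then have "(\<Sum>k<N. L.stage (traj A B 0 u k) (u k)) = (\<Sum>k<N. stage (traj A B 0 u k) (u k)) - e / 2 * (\<Sum>k<N. nsq (u k))"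
      by (simp only: sum_subtractf sum_distrib_left)
    ultimately show "e / 2 * (\<Sum>k<N. nsq (u k)) \<le> (\<Sum>k<N. L.stage (traj A B 0 u k) (u k))"
      by linarith
  qed
  then obtain P2 where P2: "\<And>x. rw n x \<Longrightarrow> re (adj x * (P2 * x)) \<le> 0"
    "\<And>x u. rw n x \<Longrightarrow> rw m u \<Longrightarrow> re (adj x * (P2 * x)) \<le> L.cost P2 x u"
    using L.riccati[of "e / 2"] e(2) by (metis half_gt_zero)
  have Lc: "L.cost P2 x u = cost P2 x u - e / 2 * nsq u" if "rw m u" for x u
    unfolding L.cost_def cost_def Lst[OF that] by simp
  \<comment> \<open>\<open>P2\<close> satisfies the hypotheses of the comparison principle, because
    dropping \<open>e / 2 * nsq u\<close> only raises the one-step cost.\<close>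
  have le: "re (adj x * (P2 * x)) \<le> re (adj x * (P * x))" if "rw n x" for x
  proof (rule maxP[OF P2(1) _ that])
    fix x u assume "rw n x" "rw m u"
    then have "re (adj x * (P2 * x)) \<le> cost P2 x u - e / 2 * nsq u" using P2(2) Lc by metis
    moreover have "0 \<le> e / 2 * nsq u" using e by simp
    ultimately show "re (adj x * (P2 * x)) \<le> cost P2 x u" by linarith
  qed
  have "stab (A + B * K)" unfolding stab_def
  proof (intro allI impI)
    fix x l assume x: "(A + B * K) * x = sc l * x \<and> x \<noteq> 0"
    show "cmod l < 1"
    proof (rule ccontr)
      assume l: "\<not> cmod l < 1"
      obtain i0 j where j: "ent x i0 j \<noteq> 0" using x by (metis ent_simps(1) lfm_eqI)
      define y where "y = x * un j 0"
      have "A * y + B * (K * y) = ((A + B * K) * x) * un j 0" by (simp add: y_def algebra_simps)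
      also have "\<dots> = sc l * y" using x by (simp add: y_def mult.assoc)
      finally have y: "A * y + B * (K * y) = sc l * y" .
      have ry: "rw n y"
      proof -
        have "rw n (sc l * y)" unfolding y[symmetric] using A B by simp
        moreover have "l \<noteq> 0" using l by auto
        ultimately show ?thesis by (auto simp: rw_ent)
      qed
      define u where "u = K * y"
      have ru: "rw m u" using P(3) by (simp add: u_def)
      note sq = form_sc[of l y]
      define a where "a = re (adj y * (P * y))"
      define b where "b = re (adj y * (P2 * y))"
      have "a = stage y u + (cmod l)\<^sup>2 * a"
        using P(8)[OF ry] unfolding cost_def u_def[symmetric] y[folded u_def] sq a_def[symmetric] .
      moreover have "b \<le> stage y u - e / 2 * nsq u + (cmod l)\<^sup>2 * b"
        using P2(2)[OF ry ru] unfolding Lc[OF ru] cost_def y[folded u_def] sq b_def[symmetric] by simp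
      \<comment> \<open>For \<open>1 \<le> cmod l\<close> both terms are also nonnegative. Hence the
        input vanishes, and \<open>y\<close> is an eigenvector of the stable \<open>A\<close>
        itself.\<close>
      ultimately have "((cmod l)\<^sup>2 - 1) * (a - b) + e / 2 * nsq u \<le> 0" by (simp add: algebra_simps)
      moreover have "0 \<le> ((cmod l)\<^sup>2 - 1) * (a - b)"
        using le[OF ry] l by (simp add: a_def b_def)
      ultimately have "nsq u = 0" using e(2) nsq_nonneg[of u] by (smt (verit) mult_pos_pos half_gt_zero)
      have "u = 0"
      proof (rule lfm_eqI)
        fix i k
        have "u * un 0 0 = u" by (simp add: u_def y_def mult.assoc)
        then have "ent u i k = ent (u * un 0 0) i k" by simp
        then show "ent u i k = ent 0 i k" using nsq_0D[OF \<open>nsq u = 0\<close>] by simp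
      qed
      then have "A * y = sc l * y" using y by (simp add: u_def)
      moreover have "y \<noteq> 0"
      proof
        assume "y = 0"
        then have "ent y i0 0 = 0" by simp
        then show False using j by (simp add: y_def)
      qed
      ultimately show False using decay_stab[OF A(1,2)] l unfolding stab_def by blast
    qed
  qed
  then have "decay (A + B * K)" by (rule stab_decay[of _ n]) (use A B P in simp_all)
  then show ?thesis using that P realP by blast
qed

end

text \<open>The storage \<open>Y\<close> removes the state cost \<open>Q\<close>, which leads into
  the setting of \<open>lq\<close>; \<open>X = - (P + Y)\<close> collects both storages. With
  \<open>adj D * D = Rt P\<close> and \<open>C = - (D * K)\<close> the output vanishes under the
  feedback \<open>K\<close>, so the closed loop \<open>A + B * K\<close> is the state matrix of the
  inverse factor.\<close>

lemma spectral_factor: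
  assumes A: "decay A" "rw n A" "cl n A" and B: "rw n B" "cl m B"
    and Q: "hm Q" "rw n Q" and S: "rw n S" "cl m S" and R: "hm R" "rw m R"
    and real: "rl A" "rl B" "rl Q" "rl S" "rl R"
    and pos: "\<And>z x u. cmod z = 1 \<Longrightarrow> rw n x \<Longrightarrow> rw m u \<Longrightarrow> sc z * x = A * x + B * u \<Longrightarrow> 0 < nsq u \<Longrightarrow>
      0 < re (adj x * (Q * x)) + 2 * re (adj x * (S * u)) + re (adj u * (R * u))"
  obtains X C D D' where "hm X" "rw n X" "rl X" "rw m C" "cl n C" "rl C" "rw m D" "cl m D" "rl D"
    "rw m D'" "cl m D'" "rl D'" "D * D' = proj m" "D' * D = proj m"
    "adj A * (X * A) - X + adj C * C = Q" "adj A * (X * B) + adj C * D = S" "adj B * (X * B) + adj D * D = R"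
    "decay (A - B * (D' * C))"
proof -
  obtain Y where Y: "hm Y" "rw n Y" "adj A * (Y * A) + Q = Y" "rl Y"
    using stein[OF A Q] real by metis
  have clY: "cl n Y" using Y hm_cl by blast
  define S' where "S' = S + adj A * (Y * B)"
  define R' where "R' = R + adj B * (Y * B)"
  interpret lq n m A B S' R'
    by unfold_locales (use A B S R Y in \<open>simp_all add: S'_def R'_def\<close>)
  have "0 < stage x u" if h: "cmod z = 1" "rw n x" "rw m u" "sc z * x = A * x + B * u" "0 < nsq u" for z x u
  proof -
    \<comment> \<open>As \<open>z\<close> has modulus one, the \<open>Y\<close> terms of the current
      and of the next state agree, and the shifted cost has the value of the original one.\<close>
    have "re (adj (sc z * x) * (Y * (sc z * x))) = re (adj x * (Y * x))"
      using form_sc[of z x Y x] h(1) by simp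
    then have "re (adj (A * x + B * u) * (Y * (A * x + B * u))) = re (adj x * (Y * x))" unfolding h(4) .
    moreover have "re (adj (A * x + B * u) * (Y * (A * x + B * u))) = re (adj (A * x) * (Y * (A * x)))
        + 2 * re (adj (A * x) * (Y * (B * u))) + re (adj (B * u) * (Y * (B * u)))"
      using form_hm_swap[OF Y(1), of "B * u" "A * x"] by (simp add: algebra_simps)
    moreover have "re (adj x * (Y * x)) = re (adj (A * x) * (Y * (A * x))) + re (adj x * (Q * x))"
      by (subst Y(3)[symmetric]) (simp add: algebra_simps)
    moreover have "stage x u = 2 * re (adj x * (S * u)) + re (adj u * (R * u))
        + 2 * re (adj (A * x) * (Y * (B * u))) + re (adj (B * u) * (Y * (B * u)))"
      unfolding stage_def by (simp add: S'_def R'_def algebra_simps)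
    ultimately show ?thesis using pos[OF h] by linarith
  qed
  then obtain e where e: "0 < e"
    "\<And>z x u. cmod z = 1 \<Longrightarrow> rw n x \<Longrightarrow> rw m u \<Longrightarrow> sc z * x = A * x + B * u \<Longrightarrow> e * nsq u \<le> stage x u"
    using frequency_uniform by metis
  have co: "coercive e" by (rule frequency_coercive) (rule e(2))
  have real': "rl S'" "rl R'" using real Y by (simp_all add: S'_def R'_def)
  obtain P K where P: "hm P" "rw n P" "rw m K" "cl n K" "rl P" "rl K" "Rt P * K = - Lt P"
    "P + adj K * (Rt P * K) = adj A * (P * A)"
    "\<And>u. rw m u \<Longrightarrow> e * nsq u \<le> re (adj u * (Rt P * u))"
    "decay (A + B * K)"
    using stabilizing_riccati[OF co e(1) real(1,2) real'] by metis
  obtain T where T: "rw m T" "cl m T" "Rt P * T = proj m" "T * Rt P = proj m"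
    using positive_inverse[OF Rt_hm[OF P(1)] Rt_rw e(1) P(9)] by metis
  have "psd (Rt P)" unfolding psd_def
  proof (intro conjI allI)
    fix x
    have "0 \<le> e * nsq (proj m * x)" using e by simp
    also have "\<dots> \<le> re (adj (proj m * x) * (Rt P * (proj m * x)))" by (rule P(9)) simp
    finally show "0 \<le> re (adj x * (Rt P * x))" using form_proj[OF Rt_hm[OF P(1)] Rt_rw] by metis
  qed (rule Rt_hm[OF P(1)])
  moreover have "rl (Rt P)" using real real' P by (simp add: Rt_def)
  ultimately obtain k V W where V: "rw m V" "cl k V" "rw k W" "cl m W" "rl V" "rl W"
    "V * adj V = Rt P" "W * V = proj k"
    using psd_factorization[OF _ Rt_rw] by metis
  \<comment> \<open>Invertibility of \<open>Rt P\<close> makes the left inverse of its factor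
    two-sided, so that the factor is square.\<close>
  have VT: "V * (adj V * T) = proj m" using T(3) V(7) by (simp flip: mult.assoc)
  have "W = W * (V * (adj V * T))" using VT V(4) by simp
  also have "\<dots> = proj k * (adj V * T)" using V(8) by (metis mult.assoc)
  also have "\<dots> = adj V * T" using V(2) by simp
  finally have VW: "V * W = proj m" using VT by simp
  have k: "k = m" using square_of_inverses[OF V(1-4) VW V(8)] by simp
  define D where "D = adj V"
  define D' where "D' = adj W"
  define C where "C = - (D * K)"
  define X where "X = - (P + Y)"
  have DD: "D * D' = proj m" "D' * D = proj m"
    using arg_cong[OF V(8), of adj] arg_cong[OF VW, of adj] by (simp_all add: D_def D'_def k)
  have aDD: "adj D * D = Rt P" by (simp add: D_def V)
  have aDDl: "adj D * (D * Z) = Rt P * Z" for Z using aDD by (metis mult.assoc)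
  have KR: "adj K * Rt P = - adj (Lt P)" 
    using arg_cong[OF P(7), of adj] Rt_hm[OF P(1)] by (simp add: hm_adj)
  have hY: "adj Y = Y" "adj P = P" using Y P hm_adj by auto
  show ?thesis
  proof (rule that[of X C D D'])
    show "adj A * (X * A) - X + adj C * C = Q"
    proof -
      have "adj C * C = adj K * (Rt P * K)" by (simp add: C_def mult.assoc aDDl)
      also have "\<dots> = adj A * (P * A) - P" using P(8) by (metis add_diff_cancel_left')
      finally have "adj A * (X * A) - X + adj C * C = Y - adj A * (Y * A)" by (simp add: X_def algebra_simps)
      also have "\<dots> = Q" using Y(3) by (metis add_diff_cancel_left')
      finally show ?thesis .
    qed
    show "adj A * (X * B) + adj C * D = S"
    proof -
      have "adj C * D = - (adj K * Rt P)" by (simp add: C_def mult.assoc aDD)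
      also have "\<dots> = S' + adj A * (P * B)" by (simp add: KR Lt_def hY mult.assoc)
      finally show ?thesis by (simp add: X_def S'_def algebra_simps)
    qed
    show "adj B * (X * B) + adj D * D = R" unfolding aDD Rt_def by (simp add: X_def R'_def algebra_simps)
    have "D' * C = - K" using P(3) DD(2) by (simp add: C_def flip: mult.assoc)
    then show "decay (A - B * (D' * C))" using P(10) by simp
  qed (use V P Y DD in \<open>simp_all add: D_def D'_def C_def X_def k\<close>)
qed

section \<open>Triangular factorization\<close>

text \<open>The form at any \<open>z\<close> is a sum of two squared norms.\<close>

lemma gram_sum_zero:
  assumes "X * adj X + Y * adj Y = 0"
  shows "X = 0" "Y = 0"
proof -
  have s: "nsq (adj X * z) + nsq (adj Y * z) = 0" for z
  proof -
    have "adj z * ((X * adj X + Y * adj Y) * z) = adj (adj X * z) * (adj X * z) + adj (adj Y * z) * (adj Y * z)"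
      by (simp add: algebra_simps)
    then show ?thesis unfolding nsq_def using assms by (metis re_simps(1,4) mult_zero_left mult_zero_right)
  qed
  have z: "adj X = 0" if "\<And>z. nsq (adj X * z) = 0" for X
  proof (rule lfm_eqI)
    fix i j
    show "ent (adj X) i j = ent 0 i j" using nsq_0D[OF that[of "un j 0"], of i] by simp
  qed
  have "nsq (adj X * z) = 0" "nsq (adj Y * z) = 0" for z
    using s[of z] nsq_nonneg[of "adj X * z"] nsq_nonneg[of "adj Y * z"] by linarith+
  then have "adj X = 0" "adj Y = 0" using z by blast+
  then show "X = 0" "Y = 0" by (metis adj_simps(4,6))+
qed

text \<open>The range of a Gramian is \<open>A\<close>-invariant and contains the range of \<open>B\<close>; in the
  coordinates given by its factorization the Gramian becomes the identity.\<close>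
lemma gramian_reduction:
  assumes A: "rw n A" "cl n A" and B: "rw n B" "cl m B" and P: "psd P" "rw n P" "A * (P * adj A) + B * adj B = P"
    and real: "rl A" "rl B" "rl P"
  obtains r V W A' B' where "r \<le> n" "rw n V" "cl r V" "rw r W" "cl n W" "rl V" "rl W" "W * V = proj r" "V * adj V = P"
    "rw r A'" "cl r A'" "rl A'" "rw r B'" "cl m B'" "rl B'" "A * V = V * A'" "B = V * B'"
    "A' * adj A' + B' * adj B' = proj r"
proof -
  obtain r V W where V: "rw n V" "cl r V" "rw r W" "cl n W" "rl V" "rl W" "V * adj V = P" "W * V = proj r" "r \<le> n"
    using psd_factorization[OF P(1,2) real(3)] by metis
  have Wl: "W * (V * X) = proj r * X" for X using V(8) by (metis mult.assoc)
  define E where "E = proj n - V * W"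
  have "E * V = 0" using V by (simp add: E_def algebra_simps)
  then have "E * P = 0" unfolding V(7)[symmetric] by (metis mult.assoc mult_zero_left)
  \<comment> \<open>\<open>E\<close> kills the range of \<open>P\<close>, so the Gramian equation
    conjugated by \<open>E\<close> becomes a vanishing sum of squares; this is invariance of the
    range under \<open>A\<close> together with the inclusion of the range of
    \<open>B\<close>.\<close>
  have "(E * A * V) * adj (E * A * V) + (E * B) * adj (E * B) = E * (A * ((V * adj V) * adj A) + B * adj B) * adj E"
    by (simp add: algebra_simps)
  also have "\<dots> = 0" unfolding V(7) P(3) \<open>E * P = 0\<close> by simp
  finally have z: "E * A * V = 0" "E * B = 0" using gram_sum_zero by blast+
  define A' where "A' = W * (A * V)"
  define B' where "B' = W * B"
  have AV: "A * V = V * A'" using z(1) A by (simp add: E_def A'_def algebra_simps)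
  have BV: "B = V * B'" using z(2) B by (simp add: E_def B'_def algebra_simps)
  have "A' * adj A' + B' * adj B' = W * (A * ((V * adj V) * adj A) + B * adj B) * adj W"
    by (simp add: A'_def B'_def algebra_simps)
  also have "\<dots> = W * (V * (adj V * adj W))" unfolding V(7) P(3) by (simp add: V(7)[symmetric] mult.assoc)
  also have "adj V * adj W = proj r" using arg_cong[OF V(8), of adj] by simp
  also have "W * (V * proj r) = proj r" using V by simp
  finally have "A' * adj A' + B' * adj B' = proj r" .
  then show ?thesis using that[OF V(9,1-6,8,7) _ _ _ _ _ _ AV BV] V B real by (simp add: A'_def B'_def)
qed

lemma resolvent_unique:
  assumes "decay A" "rw n A" "1 \<le> cmod z" "sc z * x = A * x + b" "sc z * y = A * y + b"
  shows "x = y"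
proof -
  have "A * (x - y) = sc z * (x - y)" using assms(4,5) by (simp add: algebra_simps)
  then show ?thesis using decay_stab[OF assms(1,2)] assms(3) unfolding stab_def by force
qed

lemma resolvent_exists:
  assumes A: "decay A" "rw n A" "cl n A" and z: "1 \<le> cmod z" and b: "rw n b"
  obtains x where "rw n x" "sc z * x = A * x + b"
proof -
  have inj: "x = 0" if x: "rw n x" "(sc z * proj n - A) * x = 0" for x
    using x by (intro resolvent_unique[OF A(1,2) z, where b = 0 and y = 0]) (simp_all add: algebra_simps)
  have "rw n (sc z * proj n - A)" "cl n (sc z * proj n - A)" using A by simp_all
  from inj_inverse[OF this inj] obtain T where T: "rw n T" "(sc z * proj n - A) * T = proj n" by metis
  have "(sc z * proj n - A) * (T * b) = b" using T b by (simp flip: mult.assoc)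
  then show ?thesis using that[of "T * b"] T by (simp add: algebra_simps)
qed

text \<open>On the unit circle the storage terms cancel.\<close>
lemma kyp_frequency:
  assumes kyp: "adj A * (Z * A') - Z + adj C * (N * C') = G11" "adj A * (Z * B') + adj C * (N * D') = G12"
    "adj B * (Z * A') + adj D * (N * C') = G21" "adj B * (Z * B') + adj D * (N * D') = G22"
    and z: "cmod z = 1" "sc z * x = A * x + B * u" "sc z * x' = A' * x' + B' * u'"
  shows "adj (C * x + D * u) * (N * (C' * x' + D' * u')) =
    adj x * (G11 * x') + adj x * (G12 * u') + adj u * (G21 * x') + adj u * (G22 * u')"
proof -
  have "z * cnj z = 1" using z(1) by (simp add: complex_norm_square[symmetric])
  then have "adj (sc z * x) * (Z * (sc z * x')) = adj x * (Z * x')"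
    by (simp add: mult.assoc sc_ac mult.commute[of "cnj z"])
  then have "adj (A * x + B * u) * (Z * (A' * x' + B' * u')) = adj x * (Z * x')" unfolding z(2,3) .
  then show ?thesis unfolding kyp[symmetric] by (simp add: algebra_simps)
qed

text \<open>\<open>C11, D11\<close> realize \<open>U S\<close>, where \<open>S\<close> is the spectral factor with stable inverse and \<open>U\<close> the
  orthogonal (inner) completion of the state equation of \<open>S\<^sup>-\<^sup>1\<close>. The transition matrix of \<open>(x, s)\<close>
  to the next state and output of \<open>U\<close> is orthogonal, so the cross equations can be solved for
  \<open>(\<xi>\<^sup>+, w)\<close>; the solution is a stable system with state \<open>\<xi>\<close> driven by the output of \<open>\<Psi>\<^sub>2\<close>, and this
  is the upper part of \<open>A2, E2, C12, D12\<close>.\<close>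
lemma triangular_factor:
  assumes A: "decay A" "rw n A" "cl n A" and B1: "rw n B1" "cl q B1" and B2: "rw n B2" "cl p B2"
    and C: "rw s C" "cl n C" and D1: "rw s D1" "cl q D1" and D2: "rw s D2" "cl p D2"
    and M: "hm M" "rw s M"
    and real: "rl A" "rl B1" "rl B2" "rl C" "rl D1" "rl D2" "rl M"
    and pos: "\<And>z x u. cmod z = 1 \<Longrightarrow> rw n x \<Longrightarrow> rw q u \<Longrightarrow> sc z * x = A * x + B1 * u \<Longrightarrow> 0 < nsq u \<Longrightarrow>
      0 < re (adj (C * x + D1 * u) * (M * (C * x + D1 * u)))"
    and neg: "\<And>z x2 u2. cmod z = 1 \<Longrightarrow> rw n x2 \<Longrightarrow> rw p u2 \<Longrightarrow> sc z * x2 = A * x2 + B2 * u2 \<Longrightarrow> 0 < nsq u2 \<Longrightarrow>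
      \<exists>x1 u1. rw n x1 \<and> rw q u1 \<and> sc z * x1 = A * x1 + B1 * u1 \<and>
        re (adj ((C * x1 + D1 * u1) + (C * x2 + D2 * u2)) * (M * ((C * x1 + D1 * u1) + (C * x2 + D2 * u2)))) < 0"
  obtains n1 n2 V T A1 A2 E1 E2 C11 C12 C22 D11 D12 D22 D22' C1 C2 Z11 Z12 Z22 where
    "rw n V" "cl n1 V" "rw n T" "cl n2 T" "A * V = V * A1" "B1 = V * E1" "C1 = C * V"
    "T * A2 = A * T" "T * E2 = B2" "C2 = C * T"
    "rw n1 A1" "cl n1 A1" "rw n2 A2" "cl n2 A2" "rw n1 E1" "cl q E1" "rw n2 E2" "cl p E2"
    "rw q C11" "cl n1 C11" "rw q C12" "cl n2 C12" "rw p C22" "cl n2 C22"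
    "rw q D11" "cl q D11" "rw q D12" "cl p D12" "rw p D22" "cl p D22" "rw p D22'" "cl p D22'"
    "hm Z11" "rw n1 Z11" "rw n1 Z12" "cl n2 Z12" "hm Z22" "rw n2 Z22"
    "rl A1" "rl A2" "rl E1" "rl E2" "rl C11" "rl C12" "rl C22" "rl D11" "rl D12" "rl D22" "rl D22'" "rl C1" "rl C2"
    "rl Z11" "rl Z12" "rl Z22"
    "decay A1" "decay A2" "D22 * D22' = proj p" "D22' * D22 = proj p" "decay (A2 - E2 * (D22' * C22))"
    "adj A1 * (Z11 * A1) - Z11 + adj C11 * C11 = adj C1 * (M * C1)"
    "adj A1 * (Z11 * E1) + adj C11 * D11 = adj C1 * (M * D1)"
    "adj E1 * (Z11 * E1) + adj D11 * D11 = adj D1 * (M * D1)"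
    "adj A1 * (Z12 * A2) - Z12 + adj C11 * C12 = adj C1 * (M * C2)"
    "adj A1 * (Z12 * E2) + adj C11 * D12 = adj C1 * (M * D2)"
    "adj E1 * (Z12 * A2) + adj D11 * C12 = adj D1 * (M * C2)"
    "adj E1 * (Z12 * E2) + adj D11 * D12 = adj D1 * (M * D2)"
    "adj A2 * (Z22 * A2) - Z22 + adj C12 * C12 - adj C22 * C22 = adj C2 * (M * C2)"
    "adj A2 * (Z22 * E2) + adj C12 * D12 - adj C22 * D22 = adj C2 * (M * D2)"
    "adj E2 * (Z22 * E2) + adj D12 * D12 - adj D22 * D22 = adj D2 * (M * D2)"
proof -
  have hM: "adj M = M" using M hm_adj by simp
  obtain X Cs Ds Di where X: "hm X" "rw n X" "rl X" "rw q Cs" "cl n Cs" "rl Cs" "rw q Ds" "cl q Ds" "rl Ds"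
    "rw q Di" "cl q Di" "rl Di" "Ds * Di = proj q" "Di * Ds = proj q"
    "adj A * (X * A) - X + adj Cs * Cs = adj C * (M * C)" "adj A * (X * B1) + adj Cs * Ds = adj C * (M * D1)"
    "adj B1 * (X * B1) + adj Ds * Ds = adj D1 * (M * D1)" "decay (A - B1 * (Di * Cs))"
  proof (rule spectral_factor[OF A B1, of "adj C * (M * C)" "adj C * (M * D1)" "adj D1 * (M * D1)"])
    show "0 < re (adj x * (adj C * (M * C) * x)) + 2 * re (adj x * (adj C * (M * D1) * u)) + re (adj u * (adj D1 * (M * D1) * u))"
      if "cmod z = 1" "rw n x" "rw q u" "sc z * x = A * x + B1 * u" "0 < nsq u" for z x u
      using pos[OF that] form_hm_swap[OF M(1), of "C * x" "D1 * u"] by (simp add: algebra_simps)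
  qed (use C D1 M real in simp_all)
  \<comment> \<open>State and input matrices of the inverse spectral factor.\<close>
  define As where "As = A - B1 * (Di * Cs)"
  define Bs where "Bs = B1 * Di"
  have As: "decay As" "rw n As" "cl n As" "rl As" and Bs: "rw n Bs" "cl q Bs" "rl Bs"
    using X A B1 real by (simp_all add: As_def Bs_def)
  have BB: "hm (Bs * adj Bs)" "rw n (Bs * adj Bs)" using Bs by simp_all
  \<comment> \<open>\<open>P\<close> is the reachability Gramian of the inverse factor; in
    coordinates of its range it becomes the identity, which is the orthonormality that
    \<open>inner_completion\<close> asks for.\<close>
  obtain P where P: "rw n P" "As * (P * adj As) + Bs * adj Bs = P" "rl P" "psd P"
    using stein[of "adj As" n "Bs * adj Bs"] As Bs BB psd_gram(2) by auto
  obtain r V W Ar Br where V: "r \<le> n" "rw n V" "cl r V" "rw r W" "cl n W" "rl V" "rl W" "W * V = proj r"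
    and ABr: "rw r Ar" "cl r Ar" "rl Ar" "rw r Br" "cl q Br" "rl Br" "As * V = V * Ar" "Bs = V * Br"
    "Ar * adj Ar + Br * adj Br = proj r"
    using gramian_reduction[OF As(2,3) Bs(1,2) P(4,1,2) As(4) Bs(3) P(3)] by metis
  obtain cu du where cd: "rw q cu" "cl r cu" "rl cu" "rw q du" "cl q du" "rl du"
    and orth: "adj Ar * Ar + adj cu * cu = proj r" "adj Ar * Br + adj cu * du = 0" "adj Br * Br + adj du * du = proj q"
    using inner_completion[OF ABr(1-6,9)] by metis
  have orth': "adj Br * Ar + adj du * cu = 0" using arg_cong[OF orth(2), of adj] by simp
  define cs where "cs = Cs * V"
  \<comment> \<open>\<open>A\<close> is \<open>As\<close> plus a feedback through \<open>Bs\<close>,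
    so the range of \<open>V\<close> is invariant under \<open>A\<close> too. The spectral factor
    and the inner system fed by its output move through the same states, so the cascade
    \<open>C11, D11\<close> keeps the dimension \<open>r\<close>.\<close>
  define A1 where "A1 = Ar + Br * cs"
  define E1 where "E1 = Br * Ds"
  define C1 where "C1 = C * V"
  define C11 where "C11 = cu + du * cs"
  define D11 where "D11 = du * Ds"
  have cs: "rw q cs" "cl r cs" "rl cs" using X V by (simp_all add: cs_def)
  have AV: "A * V = V * A1"
  proof -
    have "A = As + Bs * Cs" by (simp add: As_def Bs_def mult.assoc)
    then have "A * V = As * V + Bs * cs" by (simp add: cs_def distrib_right mult.assoc)
    then show ?thesis unfolding ABr(7) by (simp add: ABr(8) A1_def distrib_left mult.assoc)
  qed
  have BV: "B1 = V * E1"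
  proof -
    have "B1 = Bs * Ds" using X(14) B1 by (simp add: Bs_def mult.assoc)
    then show ?thesis by (simp add: ABr(8) E1_def mult.assoc)
  qed
  have VA: "adj V * adj A = adj A1 * adj V" "adj B1 = adj E1 * adj V"
    using arg_cong[OF AV, of adj] arg_cong[OF BV, of adj] by simp_all
  have VAl: "A * (V * Y) = V * (A1 * Y)" "adj V * (adj A * Y) = adj A1 * (adj V * Y)" for Y
    using AV VA(1) by (metis mult.assoc)+
  define Xr where "Xr = adj V * (X * V)"
  have k1: "adj A1 * (Xr * A1) - Xr + adj cs * cs = adj C1 * (M * C1)"
    using arg_cong[OF X(15), of "\<lambda>Y. adj V * (Y * V)"]
    by (simp add: algebra_simps Xr_def cs_def C1_def AV VA(1) VAl)
  have k2: "adj A1 * (Xr * E1) + adj cs * Ds = adj C1 * (M * D1)"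
    using arg_cong[OF X(16), of "\<lambda>Y. adj V * Y"]
    by (simp add: algebra_simps Xr_def cs_def C1_def VAl) (simp add: BV mult.assoc)
  have k3: "adj E1 * (Xr * E1) + adj Ds * Ds = adj D1 * (M * D1)"
    using X(17) by (simp add: Xr_def mult.assoc) (simp add: BV mult.assoc)
  \<comment> \<open>The storage of the spectral factor plus the identity, which is the storage of
    the lossless system.\<close>
  define Z11 where "Z11 = Xr + proj r"
  have dims1: "rw r A1" "cl r A1" "rl A1" "rw r E1" "cl q E1" "rl E1" "rw q C11" "cl r C11" "rl C11"
    "rw q D11" "cl q D11" "rl D11" "rw s C1" "cl r C1" "rl C1"
    using ABr cs X cd C V real by (simp_all add: A1_def E1_def C11_def D11_def C1_def)
  have o1: "adj A1 * A1 + adj C11 * C11 = proj r + adj cs * cs"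
  proof -
    have "adj A1 * A1 + adj C11 * C11 = (adj Ar * Ar + adj cu * cu) + (adj Ar * Br + adj cu * du) * cs
        + adj cs * (adj Br * Ar + adj du * cu) + adj cs * ((adj Br * Br + adj du * du) * cs)"
      by (simp add: A1_def C11_def algebra_simps)
    then show ?thesis unfolding orth orth' using cs by simp
  qed
  have o2: "adj A1 * E1 + adj C11 * D11 = adj cs * Ds"
  proof -
    have "adj A1 * E1 + adj C11 * D11 = (adj Ar * Br + adj cu * du) * Ds + adj cs * ((adj Br * Br + adj du * du) * Ds)"
      by (simp add: A1_def C11_def E1_def D11_def algebra_simps)
    then show ?thesis unfolding orth using X by simp
  qed
  have o3: "adj E1 * E1 + adj D11 * D11 = adj Ds * Ds"
  proof -
    have "adj E1 * E1 + adj D11 * D11 = adj Ds * ((adj Br * Br + adj du * du) * Ds)"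
      by (simp add: E1_def D11_def algebra_simps)
    then show ?thesis unfolding orth using X by simp
  qed
  have K11: "adj A1 * (Z11 * A1) - Z11 + adj C11 * C11 = adj C1 * (M * C1)"
  proof -
    have "adj A1 * (Z11 * A1) - Z11 + adj C11 * C11 = adj A1 * (Xr * A1) - Xr + (adj A1 * A1 + adj C11 * C11) - proj r"
      using dims1 by (simp add: Z11_def algebra_simps)
    then show ?thesis unfolding o1 k1[symmetric] by (simp add: algebra_simps)
  qed
  have K12: "adj A1 * (Z11 * E1) + adj C11 * D11 = adj C1 * (M * D1)"
  proof -
    have "adj A1 * (Z11 * E1) + adj C11 * D11 = adj A1 * (Xr * E1) + (adj A1 * E1 + adj C11 * D11)"
      using dims1 by (simp add: Z11_def algebra_simps)
    then show ?thesis unfolding o2 k2[symmetric] .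
  qed
  have K13: "adj E1 * (Z11 * E1) + adj D11 * D11 = adj D1 * (M * D1)"
  proof -
    have "adj E1 * (Z11 * E1) + adj D11 * D11 = adj E1 * (Xr * E1) + (adj E1 * E1 + adj D11 * D11)"
      using dims1 by (simp add: Z11_def algebra_simps)
    then show ?thesis unfolding o3 k3[symmetric] .
  qed
  have K12': "adj E1 * (Z11 * A1) + adj D11 * C11 = adj D1 * (M * C1)"
  proof -
    have "adj Z11 = Z11" using X(1) by (simp add: Z11_def Xr_def hm_adj mult.assoc)
    then show ?thesis using arg_cong[OF K12, of adj] by (simp add: hM mult.assoc)
  qed
  \<comment> \<open>\<open>Ar, Br, Cc, Dc\<close> realize \<open>\<Psi>\<^sub>1\<close> times the
    inverse spectral factor. \<open>E\<close> and \<open>F\<close> are the orthogonal matrix of the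
    inner system applied to the adjoints of \<open>Cc\<close> and \<open>Dc\<close>, which converts
    the adjoint system into a stable one.\<close>
  define Dc where "Dc = D1 * Di"
  define Cc where "Cc = C1 - Dc * cs"
  define E where "E = Ar * adj Cc + Br * adj Dc"
  define F where "F = cu * adj Cc + du * adj Dc"
  have cc: "rw s Dc" "cl q Dc" "rl Dc" "rw s Cc" "cl r Cc" "rl Cc"
    using D1 X real dims1 cs by (simp_all add: Dc_def Cc_def)
  have EF: "rw r E" "cl s E" "rl E" "rw q F" "cl s F" "rl F"
    using ABr cd cc by (simp_all add: E_def F_def)
  have DD: "adj Ds * adj Dc = adj D1"
  proof -
    have "Dc * Ds = D1" using X(14) D1 by (simp add: Dc_def mult.assoc)
    then show ?thesis by (metis adj_mult)
  qed
  have CC: "adj Cc + adj cs * adj Dc = adj C1" by (simp add: Cc_def)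
  \<comment> \<open>The second state has \<xi> in its first \<open>r\<close> coordinates and a copy
    of the state of \<open>\<Psi>\<close> in the next \<open>n\<close>; \<open>T\<close> extracts
    that copy.\<close>
  define T where "T = proj n * adj (sh r)"
  define A2 where "A2 = Ar + E * (M * (C * T)) + sh r * (A * T)"
  define E2 where "E2 = E * (M * D2) + sh r * B2"
  define C12 where "C12 = cu + F * (M * (C * T))"
  define D12 where "D12 = F * (M * D2)"
  define C2 where "C2 = C * T"
  define n2 where "n2 = r + n"
  have rn2: "rw n2 X" if "rw r X" for X using rw_mono[OF that] by (simp add: n2_def)
  have cn2: "cl n2 X" if "cl r X" for X using cl_mono[OF that] by (simp add: n2_def)
  have dT: "rw n T" "cl n2 T" "rl T" by (simp_all add: T_def n2_def)
  have cT: "cl n2 (Y * T)" "rl Y \<Longrightarrow> rl (Y * T)" for Y using dT by simp_all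
  have rs: "rw n Y \<Longrightarrow> rw n2 (sh r * Y)" for Y by (simp add: n2_def)
  have dims2: "rw n2 A2" "cl n2 A2" "rl A2" "rw n2 E2" "cl p E2" "rl E2" "rw q C12" "cl n2 C12" "rl C12"
    "rw q D12" "cl p D12" "rl D12" "rw s C2" "cl n2 C2" "rl C2"
    using ABr EF A B2 C D2 cd real M dT
    by (simp_all add: A2_def E2_def C12_def D12_def C2_def rn2 cn2 rs)
  have Tsh: "T * (sh r * Y) = proj n * Y" "rw r Y \<Longrightarrow> T * Y = 0" for Y by (simp_all add: T_def mult.assoc)
  have TA: "T * A2 = A * T" using ABr EF A by (simp add: A2_def distrib_left Tsh)
  have TB: "T * E2 = B2" using EF B2 by (simp add: E2_def distrib_left Tsh)
  \<comment> \<open>\<open>x1\<close> to \<open>x4\<close> are instances of the orthogonality of the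
    matrix with blocks \<open>Ar\<close>, \<open>Br\<close>, \<open>cu\<close>, \<open>du\<close>.
    They become the cross equations with a storage \<open>Z12\<close> that pairs the first state
    with \<xi> by the identity.\<close>
  have x1: "adj A1 * Ar + adj C11 * cu = proj r"
  proof -
    have "adj A1 * Ar + adj C11 * cu = (adj Ar * Ar + adj cu * cu) + adj cs * (adj Br * Ar + adj du * cu)"
      by (simp add: A1_def C11_def algebra_simps)
    then show ?thesis unfolding orth orth' by simp
  qed
  have x2: "adj A1 * E + adj C11 * F = adj C1"
  proof -
    have "adj A1 * E + adj C11 * F = (adj Ar * Ar + adj cu * cu) * adj Cc + (adj Ar * Br + adj cu * du) * adj Dc
       + adj cs * ((adj Br * Ar + adj du * cu) * adj Cc) + adj cs * ((adj Br * Br + adj du * du) * adj Dc)"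
      by (simp add: A1_def C11_def E_def F_def algebra_simps)
    then show ?thesis unfolding orth orth' using cc CC by simp
  qed
  have x3: "adj E1 * Ar + adj D11 * cu = 0"
  proof -
    have "adj E1 * Ar + adj D11 * cu = adj Ds * (adj Br * Ar + adj du * cu)"
      by (simp add: E1_def D11_def algebra_simps)
    then show ?thesis unfolding orth' by simp
  qed
  have x4: "adj E1 * E + adj D11 * F = adj D1"
  proof -
    have "adj E1 * E + adj D11 * F = adj Ds * ((adj Br * Ar + adj du * cu) * adj Cc) + adj Ds * ((adj Br * Br + adj du * du) * adj Dc)"
      by (simp add: E1_def D11_def E_def F_def algebra_simps)
    then show ?thesis unfolding orth orth' using cc DD by simp
  qed
  define Z12 where "Z12 = proj r"
  have A1sh: "adj A1 * (sh r * Y) = 0" "adj E1 * (sh r * Y) = 0" for Y using dims1 by simp_all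
  have K21: "adj A1 * (Z12 * A2) - Z12 + adj C11 * C12 = adj C1 * (M * C2)"
  proof -
    have "adj A1 * (Z12 * A2) - Z12 + adj C11 * C12
        = (adj A1 * Ar + adj C11 * cu) - proj r + (adj A1 * E + adj C11 * F) * (M * C2)"
      using dims1 by (simp add: Z12_def A2_def C12_def C2_def algebra_simps)
    then show ?thesis unfolding x1 x2 by simp
  qed
  have K22: "adj A1 * (Z12 * E2) + adj C11 * D12 = adj C1 * (M * D2)"
  proof -
    have "adj A1 * (Z12 * E2) + adj C11 * D12 = (adj A1 * E + adj C11 * F) * (M * D2)"
      using dims1 by (simp add: Z12_def E2_def D12_def algebra_simps)
    then show ?thesis unfolding x2 by simp
  qed
  have K23: "adj E1 * (Z12 * A2) + adj D11 * C12 = adj D1 * (M * C2)"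
  proof -
    have "adj E1 * (Z12 * A2) + adj D11 * C12 = (adj E1 * Ar + adj D11 * cu) + (adj E1 * E + adj D11 * F) * (M * C2)"
      using dims1 by (simp add: Z12_def A2_def C12_def C2_def algebra_simps)
    then show ?thesis unfolding x3 x4 by simp
  qed
  have K24: "adj E1 * (Z12 * E2) + adj D11 * D12 = adj D1 * (M * D2)"
  proof -
    have "adj E1 * (Z12 * E2) + adj D11 * D12 = (adj E1 * E + adj D11 * F) * (M * D2)"
      using dims1 by (simp add: Z12_def E2_def D12_def algebra_simps)
    then show ?thesis unfolding x4 by simp
  qed
  have decAr: "decay Ar" and decA1: "decay A1"
  proof -
    \<comment> \<open>Stability passes along an intertwining with left invertible \<open>V\<close>,
      which maps eigenvectors to eigenvectors.\<close>
    have red: "decay Y'" if Y: "decay Y" "rw n Y" "Y * V = V * Y'" "rw r Y'" "cl r Y'" for Y Y'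
    proof (rule stab_decay[OF _ Y(4,5)], unfold stab_def, intro allI impI)
      fix x l assume x: "Y' * x = sc l * x \<and> x \<noteq> 0"
      show "cmod l < 1"
      proof (cases "l = 0")
        case False
        have rx: "rw r x" using eigenvector_rw[OF Y(4)] x False by blast
        have "Y * (V * x) = V * (Y' * x)" using Y(3) by (metis mult.assoc)
        then have "Y * (V * x) = sc l * (V * x)" using x by (simp add: mult_sc_left)
        moreover have "V * x \<noteq> 0"
        proof
          assume "V * x = 0"
          then have "W * V * x = 0" by (simp add: mult.assoc)
          then show False using V(8) rx x by simp
        qed
        ultimately show ?thesis using decay_stab[OF Y(1,2)] unfolding stab_def by blast
      qed simp
    qed
    show "decay Ar" by (rule red[OF As(1,2) ABr(7,1,2)])
    show "decay A1" by (rule red[OF A(1,2) AV dims1(1,2)])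
  qed
  \<comment> \<open>\<open>A2\<close> is block triangular: an eigenvector either projects to one of
    \<open>A\<close>, or its projection vanishes and it is one of \<open>Ar\<close>.\<close>
  have decA2: "decay A2"
  proof (rule stab_decay[OF _ dims2(1,2)], unfold stab_def, intro allI impI)
    fix x l assume x: "A2 * x = sc l * x \<and> x \<noteq> 0"
    show "cmod l < 1"
    proof (cases "T * x = 0")
      case False
      have "A * (T * x) = T * (A2 * x)" using TA by (metis mult.assoc)
      then have "A * (T * x) = sc l * (T * x)" using x by (simp add: mult_sc_left)
      then show ?thesis using decay_stab[OF A(1,2)] False unfolding stab_def by blast
    next
      case True
      then have "Ar * x = sc l * x" using x by (simp add: A2_def distrib_right mult.assoc)
      then show ?thesis using decay_stab[OF decAr ABr(1)] x unfolding stab_def by blast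
    qed
  qed
  \<comment> \<open>Coefficients of \<open>nsq w - re (adj y * (M * y))\<close>, with
    \<open>w\<close> the output of \<open>C12, D12\<close> and \<open>y\<close> that of
    \<open>\<Psi>\<^sub>2\<close>; on the circle this is the negative of the Schur
    complement.\<close>
  define Q2 where "Q2 = adj C12 * C12 - adj C2 * (M * C2)"
  define S2 where "S2 = adj C12 * D12 - adj C2 * (M * D2)"
  define R2 where "R2 = adj D12 * D12 - adj D2 * (M * D2)"
  have freq2: "0 < re (adj x * (Q2 * x)) + 2 * re (adj x * (S2 * u)) + re (adj u * (R2 * u))"
    if h: "cmod z = 1" "rw n2 x" "rw p u" "sc z * x = A2 * x + E2 * u" "0 < nsq u" for z x u
  proof -
    define y where "y = C2 * x + D2 * u"
    define w where "w = C12 * x + D12 * u"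
    have yT: "y = C * (T * x) + D2 * u" by (simp add: y_def C2_def mult.assoc)
    have "T * (sc z * x) = T * (A2 * x + E2 * u)" using h(4) by simp
    also have "\<dots> = A * (T * x) + B2 * u" using TA TB by (simp add: distrib_left flip: mult.assoc)
    finally have eT: "sc z * (T * x) = A * (T * x) + B2 * u" by (simp add: mult_sc_left)
    have "rw n (T * x)" using dT by simp
    from neg[OF h(1) this h(3) eT h(5)] obtain x1 u1 where x1: "rw n x1" "rw q u1" "sc z * x1 = A * x1 + B1 * u1"
      "re (adj ((C * x1 + D1 * u1) + y) * (M * ((C * x1 + D1 * u1) + y))) < 0" unfolding yT[symmetric] by blast
    have "rw r (E1 * u1)" using dims1 by simp
    then obtain xr where xr: "rw r xr" "sc z * xr = A1 * xr + E1 * u1"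
      using resolvent_exists[OF decA1 dims1(1,2)] h(1) by (metis order_refl)
    have "sc z * (V * xr) = A * (V * xr) + B1 * u1"
      using arg_cong[OF xr(2), of "\<lambda>t. V * t"] by (simp add: VAl distrib_left mult_sc_left) (simp add: BV mult.assoc)
    then have "x1 = V * xr" using resolvent_unique[OF A(1,2) _ x1(3)] h(1) by simp
    define y1 where "y1 = C1 * xr + D1 * u1"
    define v where "v = C11 * xr + D11 * u1"
    have y1: "C * x1 + D1 * u1 = y1" by (simp add: y1_def C1_def \<open>x1 = V * xr\<close> mult.assoc)
    have vv: "adj v * (1 * v) = adj y1 * (M * y1)"
      unfolding v_def
      by (subst kyp_frequency[OF _ _ _ _ h(1) xr(2) xr(2), where Z = Z11 and N = 1 and
          ?G11.0 = "adj C1 * (M * C1)" and ?G12.0 = "adj C1 * (M * D1)" and ?G21.0 = "adj D1 * (M * C1)" and ?G22.0 = "adj D1 * (M * D1)"])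
        (use K11 K12 K12' K13 in \<open>simp_all add: mult.assoc distrib_left distrib_right y1_def\<close>)
    have vw: "adj v * (1 * w) = adj y1 * (M * y)"
      unfolding v_def w_def
      by (subst kyp_frequency[OF _ _ _ _ h(1) xr(2) h(4), where Z = Z12 and N = 1 and
          ?G11.0 = "adj C1 * (M * C2)" and ?G12.0 = "adj C1 * (M * D2)" and ?G21.0 = "adj D1 * (M * C2)" and ?G22.0 = "adj D1 * (M * D2)"])
        (use K21 K22 K23 K24 in \<open>simp_all add: mult.assoc distrib_left distrib_right y1_def y_def\<close>)
    have "re (adj (y1 + y) * (M * (y1 + y))) = re (adj y1 * (M * y1)) + 2 * re (adj y1 * (M * y)) + re (adj y * (M * y))"
      using form_hm_swap[OF M(1), of y y1] by (simp add: algebra_simps)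
    also have "\<dots> = nsq v + 2 * re (adj v * w) + re (adj y * (M * y))"
      unfolding vv[symmetric] vw[symmetric] nsq_def by simp
    also have "\<dots> = nsq (v + w) - nsq w + re (adj y * (M * y))" unfolding nsq_add by simp
    finally have "0 < nsq w - re (adj y * (M * y))"
      using x1(4) nsq_nonneg[of "v + w"] unfolding y1 by linarith
    also have "nsq w - re (adj y * (M * y)) = re (adj x * (Q2 * x)) + 2 * re (adj x * (S2 * u)) + re (adj u * (R2 * u))"
      using form_hm_swap[OF M(1), of "D2 * u" "C2 * x"] re_swap[of "D12 * u" "C12 * x"]
      by (simp add: nsq_def w_def y_def Q2_def S2_def R2_def algebra_simps)
    finally show ?thesis .
  qed
  obtain X2 C22 D22 D22' where X2: "hm X2" "rw n2 X2" "rl X2" "rw p C22" "cl n2 C22" "rl C22" "rw p D22" "cl p D22" "rl D22"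
    "rw p D22'" "cl p D22'" "rl D22'" "D22 * D22' = proj p" "D22' * D22 = proj p"
    "adj A2 * (X2 * A2) - X2 + adj C22 * C22 = Q2" "adj A2 * (X2 * E2) + adj C22 * D22 = S2"
    "adj E2 * (X2 * E2) + adj D22 * D22 = R2" "decay (A2 - E2 * (D22' * C22))"
  proof (rule spectral_factor[OF decA2 dims2(1,2,4,5), of Q2 S2 R2])
    show "hm Q2" "hm R2" using M by (simp_all add: Q2_def R2_def)
  qed (use dims2 D2 M real freq2 in \<open>simp_all add: Q2_def S2_def R2_def\<close>)
  show ?thesis
  \<comment> \<open>The second factorization is that of the negated form, so its storage enters with
    the opposite sign.\<close>
  proof (rule that[of V r T n2 A1 E1 C1 A2 E2 C2 C11 C12 C22 D11 D12 D22 D22' Z11 Z12 "- X2"])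
    show "adj A2 * (- X2 * A2) - - X2 + adj C12 * C12 - adj C22 * C22 = adj C2 * (M * C2)"
      using X2(15) unfolding Q2_def by (simp add: algebra_simps)
    show "adj A2 * (- X2 * E2) + adj C12 * D12 - adj C22 * D22 = adj C2 * (M * D2)"
      using X2(16) unfolding S2_def by (simp add: algebra_simps)
    show "adj E2 * (- X2 * E2) + adj D12 * D12 - adj D22 * D22 = adj D2 * (M * D2)"
      using X2(17) unfolding R2_def by (simp add: algebra_simps)
    show "hm Z11" "rw r Z11" "rl Z11" using X V by (simp_all add: Z11_def Xr_def)
    show "rw r Z12" "cl n2 Z12" "rl Z12" by (simp_all add: Z12_def cn2)
  qed (use V(2,3) dT AV BV TA TB dims1 dims2 X2 decA1 decA2 K11 K12 K13 K21 K22 K23 K24 in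
      \<open>simp_all only: C1_def C2_def hm_closure rw_closure rl_closure\<close>)
qed

section \<open>Minimal realizations\<close>

definition rF :: "real mat \<Rightarrow> lfm" where "rF X = toF (cm X)"

lemma ent_rF [simp]: "ent (rF X) i j = (if i < dim_row X \<and> j < dim_col X then complex_of_real (X $$ (i, j)) else 0)"
  by (simp add: rF_def cm_def)

lemma rF_rw [simp]: "X \<in> carrier_mat n m \<Longrightarrow> rw n (rF X)"
  and rF_cl [simp]: "X \<in> carrier_mat n m \<Longrightarrow> cl m (rF X)"
  and rF_rl [simp]: "rl (rF X)"
  by (auto simp: rw_ent cl_ent rl_def intro!: lfm_eqI)

lemma rF_mult: "dim_col X = dim_row Y \<Longrightarrow> rF (X * Y) = rF X * rF Y"
proof -
  assume d: "dim_col X = dim_row Y"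
  have "cm (X * Y) = cm X * cm Y"
    by (rule eq_matI) (auto simp: cm_def scalar_prod_def d)
  then show ?thesis using d by (simp add: rF_def toF_mult cm_def)
qed

lemma rF_uminus: "rF (- X) = - rF X"
  and rF_transpose: "rF (transpose_mat X) = adj (rF X)"
  and rF_one: "rF (1\<^sub>m n) = proj n"
  and rF_zero: "rF (0\<^sub>m n m) = 0"
  by (auto intro!: lfm_eqI)

lemma rF_inject: "X \<in> carrier_mat n m \<Longrightarrow> Y \<in> carrier_mat n m \<Longrightarrow> rF X = rF Y \<Longrightarrow> X = Y"
proof (rule eq_matI)
  fix i j assume *: "X \<in> carrier_mat n m" "Y \<in> carrier_mat n m" "rF X = rF Y" "i < dim_row Y" "j < dim_col Y"
  then show "X $$ (i, j) = Y $$ (i, j)" using ent_rF[of X i j] ent_rF[of Y i j] by simp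
qed auto

definition ofR :: "nat \<Rightarrow> nat \<Rightarrow> lfm \<Rightarrow> real mat" where
  "ofR n m X = mat n m (\<lambda>(i, j). Re (ent X i j))"

lemma ofR_carrier [simp]: "ofR n m X \<in> carrier_mat n m" "dim_row (ofR n m X) = n" "dim_col (ofR n m X) = m"
  by (auto simp: ofR_def)

lemma rF_ofR: assumes "rw n X" "cl m X" "rl X" shows "rF (ofR n m X) = X"
proof (rule lfm_eqI)
  fix i j
  have "cnj (ent X i j) = ent X i j" using assms(3) by (metis rl_def ent_simps2(2))
  then have "complex_of_real (Re (ent X i j)) = ent X i j" by (simp add: complex_eq_iff)
  then show "ent (rF (ofR n m X)) i j = ent X i j"
    using assms(1,2) by (auto simp: ofR_def rw_ent cl_ent)
qed

lemma pencil_toF: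
  assumes "A \<in> carrier_mat n n"
  shows "z \<cdot>\<^sub>m 1\<^sub>m n - cm A \<in> carrier_mat n n" "toF (z \<cdot>\<^sub>m 1\<^sub>m n - cm A) = sc z * proj n - rF A"
  using assms by (auto simp: rF_def cm_def toF_simps)

lemma defined_atI:
  assumes "A \<in> carrier_mat n n" "\<And>x. rw n x \<Longrightarrow> rF A * x = sc z * x \<Longrightarrow> x = 0"
  shows "defined_at (A, B, C, D) z"
proof -
  have "det (z \<cdot>\<^sub>m 1\<^sub>m n - cm A) \<noteq> 0"
  proof (rule det_nonzeroI[OF pencil_toF(1)[OF assms(1)]])
    fix x assume x: "rw n x" "toF (z \<cdot>\<^sub>m 1\<^sub>m n - cm A) * x = 0"
    then have "rF A * x = sc z * x" unfolding pencil_toF(2)[OF assms(1)] by (simp add: left_diff_distrib mult.assoc)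
    then show "x = 0" using assms(2) x by blast
  qed
  then show ?thesis using assms(1) by (simp add: defined_at_def)
qed

text \<open>Values of the transfer matrix are handled through the solution \<open>F\<close> of the
  state equation at \<open>z\<close>; its uniqueness identifies transfer matrices of intertwined
  realizations.\<close>

lemma tf_resolvent:
  assumes A: "A \<in> carrier_mat n n" and B: "B \<in> carrier_mat n m" and C: "C \<in> carrier_mat p n" and D: "D \<in> carrier_mat p m"
    and def: "defined_at (A, B, C, D) z"
  obtains F where "rw n F" "cl m F" "sc z * F = rF A * F + rF B" "tf (A, B, C, D) z \<in> carrier_mat p m"
    "toF (tf (A, B, C, D) z) = rF C * F + rF D"
    "\<And>F'. rw n F' \<Longrightarrow> sc z * F' = rF A * F' + rF B \<Longrightarrow> F' = F"
    "\<And>x. rw n x \<Longrightarrow> rF A * x = sc z * x \<Longrightarrow> x = 0"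
proof -
  define X where "X = z \<cdot>\<^sub>m 1\<^sub>m n - cm A"
  have X: "X \<in> carrier_mat n n" "toF X = sc z * proj n - rF A" using pencil_toF[OF A] by (simp_all add: X_def)
  have "det X \<noteq> 0" using def A by (simp add: defined_at_def X_def)
  note mi = minv_toF[OF X(1) this]
  define F where "F = toF (minv X) * rF B"
  have rF: "rw n F" "cl m F" using mi(1) B by (simp_all add: F_def)
  have "toF X * F = rF B" using mi(2) B by (simp add: F_def flip: mult.assoc)
  then have eq: "sc z * F = rF A * F + rF B" unfolding X(2) using rF by (simp add: algebra_simps)
  have un: "F' = F" if "rw n F'" "sc z * F' = rF A * F' + rF B" for F'
  proof -
    have "toF X * F' = rF B" unfolding X(2) using that by (simp add: algebra_simps)
    then have "toF (minv X) * toF X * F' = F" by (simp add: F_def mult.assoc)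
    then show ?thesis using mi(3) that(1) by simp
  qed
  have inj: "x = 0" if "rw n x" "rF A * x = sc z * x" for x
  proof -
    have "toF X * x = 0" unfolding X(2) using that by (simp add: algebra_simps)
    then have "toF (minv X) * toF X * x = 0" by (simp add: mult.assoc)
    then show ?thesis using mi(3) that(1) by simp
  qed
  have t: "tf (A, B, C, D) z = cm C * minv X * cm B + cm D" using A by (simp add: tf_def X_def)
  have "tf (A, B, C, D) z \<in> carrier_mat p m" using mi(1) A B C D unfolding t by (simp add: cm_def)
  moreover have "toF (tf (A, B, C, D) z) = rF C * F + rF D"
    unfolding t using mi(1) A B C D by (simp add: toF_mult toF_add cm_def F_def rF_def mult.assoc)
  ultimately show ?thesis using that rF eq un inj by blast
qed

lemma schur_stable_iff:
  assumes "A \<in> carrier_mat n n"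
  shows "schur_stable A \<longleftrightarrow> stab (rF A)"
proof -
  have a: "cm A \<in> carrier_mat n n" using assms by (simp add: cm_def)
  show ?thesis
  proof
    assume s: "schur_stable A"
    show "stab (rF A)" unfolding stab_def
    proof (intro allI impI)
      fix x l assume x: "rF A * x = sc l * x \<and> x \<noteq> 0"
      show "cmod l < 1"
        using toF_eigen[OF a, of x l] x s unfolding schur_stable_def rF_def by (cases "l = 0") auto
    qed
  next
    assume s: "stab (rF A)"
    show "schur_stable A" unfolding schur_stable_def
    proof (intro allI impI)
      fix l assume "eigenvalue (cm A) l"
      from eigen_toF[OF a this] show "cmod l < 1" using s unfolding stab_def rF_def by metis
    qed
  qed
qed

text \<open>A matrix not yet known to be stable is divided by a number above a bound for its norm,
  so that Gramian series converge. Scaling changes neither invariant subspaces nor the vanishing of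
  Markov parameters.\<close>

lemma scaled_decay:
  assumes A: "rw n A" "cl n A"
  obtains k where "0 < k" "decay (sc (complex_of_real (1 / k)) * A)" "\<And>z x. k \<le> cmod z \<Longrightarrow> A * x = sc z * x \<Longrightarrow> x = 0"
proof -
  obtain c where c: "0 \<le> c" "\<And>x. rw n x \<Longrightarrow> nsq (A * x) \<le> c * nsq x" using operator_bounded[OF A] by blast
  define k where "k = sqrt c + 1"
  have k: "0 < k" using c by (simp add: k_def add_nonneg_pos)
  have ev: "x = 0" if z: "k \<le> cmod z" "A * x = sc z * x" for z x
  proof (rule lfm_eqI)
    fix i j
    have "z \<noteq> 0" using z k by auto
    have rx: "rw n x" by (rule eigenvector_rw[OF A(1) z(2) \<open>z \<noteq> 0\<close>])
    define y where "y = x * un j 0"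
    have "A * y = sc z * y" using z(2) by (simp add: y_def flip: mult.assoc)
    then have "(cmod z)\<^sup>2 * nsq y \<le> c * nsq y" using c(2)[of y] rx by (simp add: y_def)
    moreover have "c < (cmod z)\<^sup>2"
    proof -
      have "(sqrt c)\<^sup>2 < (cmod z)\<^sup>2" using z(1) c(1) by (intro power_strict_mono) (auto simp: k_def)
      then show ?thesis using c(1) by simp
    qed
    ultimately have "nsq y = 0" using nsq_nonneg[of y] by (smt (verit) mult_right_mono mult_strict_right_mono)
    from nsq_0D[OF this, of i] show "ent x i j = ent 0 i j" by (simp add: y_def)
  qed
  have "stab (sc (complex_of_real (1 / k)) * A)" unfolding stab_def
  proof (intro allI impI)
    fix x l assume x: "sc (complex_of_real (1 / k)) * A * x = sc l * x \<and> x \<noteq> 0"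
    have "A * x = sc (complex_of_real k) * (sc (complex_of_real (1 / k)) * A * x)"
      using k by (simp add: mult.assoc sc_mult_left)
    also have "\<dots> = sc (complex_of_real k * l) * x" using x by (simp add: sc_mult_left)
    finally have "\<not> k \<le> cmod (complex_of_real k * l)" using ev x by blast
    then have "k * cmod l < k * 1" using k by (simp add: norm_mult)
    then show "cmod l < 1" using k by (simp only: mult_less_cancel_left_pos)
  qed
  then have "decay (sc (complex_of_real (1 / k)) * A)" by (rule stab_decay[of _ n]) (use A in simp_all)
  then show ?thesis using that k ev by blast
qed

text \<open>The resolvent solution \<open>F\<close> tends to \<open>0\<close> as \<open>t\<close> tends to infinity.\<close>
lemma transfer_vanishes:
  assumes A: "rw n A" "cl n A" and B: "rw n B" "cl m B" and C: "rw s C" "cl n C"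
    and const: "\<And>t. k \<le> t \<Longrightarrow> \<exists>F. rw n F \<and> sc (complex_of_real t) * F = A * F + B \<and> C * F = Y"
  shows "Y = 0"
proof (rule lfm_eqI)
  fix i j
  obtain d where d: "0 < d" "decay (sc (complex_of_real (1 / d)) * A)"
    using scaled_decay[OF A] by metis
  define A' where "A' = sc (complex_of_real (1 / d)) * A"
  define B' where "B' = sc (complex_of_real (1 / d)) * B"
  have A': "decay A'" "rw n A'" "cl n A'" and B': "rw n B'" "cl m B'" using A B d by (simp_all add: A'_def B'_def)
  obtain c where c: "0 \<le> c" "\<And>z x u. 1 \<le> cmod z \<Longrightarrow> rw n x \<Longrightarrow> rw m u \<Longrightarrow> sc z * x = A' * x + B' * u
    \<Longrightarrow> (cmod z)\<^sup>2 * nsq x \<le> c * nsq u"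
    using resolvent_bound[OF A' B'] by metis
  obtain c' where c': "0 \<le> c'" "\<And>x. rw n x \<Longrightarrow> nsq (C * x) \<le> c' * nsq x"
    using operator_bounded[OF C] by blast
  define u where "u = proj m * un j 0"
  have "nsq (Y * un j 0) * (t / d)\<^sup>2 \<le> c' * (c * nsq u)" if t: "max k d \<le> t" for t
  proof -
    obtain F where F: "rw n F" "sc (complex_of_real t) * F = A * F + B" "C * F = Y" using const t by auto
    define x where "x = F * un j 0"
    have x: "rw n x" using F by (simp add: x_def)
    have td: "1 \<le> t / d" "0 \<le> t / d" using t d by (simp_all add: field_simps)
    have "sc (complex_of_real (1 / d)) * (sc (complex_of_real t) * F * un j 0) = A' * x + B' * u"
      unfolding F(2) using B by (simp add: A'_def B'_def x_def u_def algebra_simps)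
    then have "sc (complex_of_real (t / d)) * x = A' * x + B' * u"
      by (simp add: x_def mult.assoc sc_mult_left)
    then have "(cmod (complex_of_real (t / d)))\<^sup>2 * nsq x \<le> c * nsq u"
    proof (intro c(2))
      show "1 \<le> cmod (complex_of_real (t / d))" using td by (simp only: norm_of_real)
      show "rw n x" "rw m u" using x by (simp_all add: u_def)
    qed
    then have b: "(t / d)\<^sup>2 * nsq x \<le> c * nsq u" by (simp add: norm_divide power_divide)
    have "nsq (Y * un j 0) \<le> c' * nsq x"
      using c'(2)[OF x] F(3) by (simp add: x_def flip: mult.assoc)
    then have "nsq (Y * un j 0) * (t / d)\<^sup>2 \<le> c' * nsq x * (t / d)\<^sup>2" by (intro mult_right_mono) auto
    also have "\<dots> = c' * ((t / d)\<^sup>2 * nsq x)" by simp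
    also have "\<dots> \<le> c' * (c * nsq u)" using b c' by (intro mult_left_mono)
    finally show ?thesis .
  qed
  moreover have "\<exists>t\<ge>max k d. c' * (c * nsq u) < e * (t / d)\<^sup>2" if e: "0 < e" for e
  proof -
    \<comment> \<open>\<open>s\<close> covers the threshold as well as the required ratio; the
      summand \<open>1\<close> makes it at least \<open>1\<close>, so that its square dominates
      it.\<close>
    define s where "s = max (max k d / d) (c' * (c * nsq u) / e + 1)"
    have "0 \<le> c' * (c * nsq u) / e" using c c' e by simp
    then have s1: "1 \<le> s" unfolding s_def by linarith
    have "c' * (c * nsq u) / e < s" by (auto simp: s_def max_def)
    also have "s \<le> s\<^sup>2" using s1 by (simp add: power2_eq_square)
    finally have "c' * (c * nsq u) < e * (d * s / d)\<^sup>2" using e d by (simp add: field_simps)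
    moreover have "max k d \<le> d * s"
    proof -
      have "max k d / d \<le> s" by (simp only: s_def max.cobounded1)
      then show ?thesis using d(1) by (simp only: pos_divide_le_eq mult.commute)
    qed
    ultimately show ?thesis by blast
  qed
  ultimately have "\<not> 0 < nsq (Y * un j 0)" by (metis not_le)
  then have "nsq (Y * un j 0) = 0" using nsq_nonneg[of "Y * un j 0"] by linarith
  from nsq_0D[OF this, of i] show "ent Y i j = ent 0 i j" by simp
qed

text \<open>Induction on \<open>j\<close>: if the solution \<open>F\<close> driven by
  \<open>A ^ j * B\<close> has \<open>C * F = 0\<close> for all large \<open>t\<close>, then
  \<open>A * F\<close> is driven by \<open>A ^ Suc j * B\<close> and has the constant output
  \<open>- (C * (A ^ j * B))\<close>, which is zero by \<open>transfer_vanishes\<close>. The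
  constant \<open>Y\<close> allows for different feedthrough terms.\<close>

lemma markov_vanish:
  assumes A: "rw n A" "cl n A" and B: "rw n B" "cl m B" and C: "rw s C" "cl n C"
    and const: "\<And>t. k \<le> t \<Longrightarrow> \<exists>F. rw n F \<and> sc (complex_of_real t) * F = A * F + B \<and> C * F = Y"
  shows "C * (A ^ j * B) = 0"
proof -
  define ok where "ok j \<longleftrightarrow> (\<forall>t\<ge>k. \<exists>F. rw n F \<and> sc (complex_of_real t) * F = A * F + A ^ j * B \<and> C * F = 0)" for j
  have step: "C * (A ^ j * B) = 0 \<and> ok (Suc j)" if "ok j" for j
  proof -
    have rj: "rw n (A ^ Suc j * B)" "cl m (A ^ Suc j * B)" using A B by simp_all
    have new: "\<exists>F. rw n F \<and> sc (complex_of_real t) * F = A * F + A ^ Suc j * B \<and> C * F = - (C * (A ^ j * B))"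
      if t: "k \<le> t" for t
    proof -
      obtain F where F: "rw n F" "sc (complex_of_real t) * F = A * F + A ^ j * B" "C * F = 0"
        using \<open>ok j\<close> t unfolding ok_def by blast
      have "sc (complex_of_real t) * (A * F) = A * (sc (complex_of_real t) * F)" by (simp add: mult_sc_left)
      also have "\<dots> = A * (A * F) + A ^ Suc j * B" unfolding F(2) by (simp add: distrib_left mult.assoc)
      finally have 1: "sc (complex_of_real t) * (A * F) = A * (A * F) + A ^ Suc j * B" .
      have "A * F = sc (complex_of_real t) * F - A ^ j * B" using F(2) by simp
      then have "C * (A * F) = sc (complex_of_real t) * (C * F) - C * (A ^ j * B)"
        by (simp add: right_diff_distrib mult_sc_left)
      then have "C * (A * F) = - (C * (A ^ j * B))" using F(3) by simp
      then show ?thesis using 1 A by (intro exI[of _ "A * F"]) simp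
    qed
    have "- (C * (A ^ j * B)) = 0" by (rule transfer_vanishes[OF A rj C new])
    then show ?thesis using new unfolding ok_def by simp
  qed
  have "Y = 0" by (rule transfer_vanishes[OF A B C const])
  then have "ok 0" using const unfolding ok_def by simp
  then have "ok j" by (induction j) (use step in blast)+
  then show ?thesis using step by blast
qed

text \<open>At a column of \<open>adj Y\<close> no term with \<open>B\<close> survives, so the form
  of \<open>P\<close> there keeps its value along the powers of \<open>adj A\<close>, which tend to
  zero; a semidefinite \<open>P\<close> then kills the column.\<close>

lemma gramian_annihilated:
  assumes A: "decay A" "rw n A" "cl n A" and P: "psd P" "rw n P" "A * (P * adj A) + B * adj B = P"
    and Y: "cl n Y" "\<And>l. Y * (A ^ l * B) = 0"
  shows "Y * P = 0"
proof -
  have eq: "adj (adj A) * (P * adj A) + B * adj B = P" using P(3) by simp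
  have "P * adj Y = 0"
  proof (rule lfm_eqI)
    fix i j
    define y where "y = adj Y * un j 0"
    have ry: "rw n y" using Y by (simp add: y_def)
    have BA: "adj B * (adj A ^ l * y) = 0" for l
    proof -
      have "adj (Y * (A ^ l * B)) * un j 0 = 0" using Y(2) by simp
      then show ?thesis by (simp add: y_def mult.assoc)
    qed
    have step: "re (adj x * (P * x)) = re (adj (adj A * x) * (P * (adj A * x))) + re (adj (adj B * x) * (adj B * x))" for x
      by (subst P(3)[symmetric]) (simp add: algebra_simps)
    have iter: "re (adj y * (P * y)) = re (adj (adj A ^ L * y) * (P * (adj A ^ L * y)))" for L
    proof (induction L)
      case (Suc L)
      have "re (adj (adj A ^ L * y) * (P * (adj A ^ L * y))) = re (adj (adj A * (adj A ^ L * y)) * (P * (adj A * (adj A ^ L * y))))"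
        using step[of "adj A ^ L * y"] unfolding BA by simp
      then show ?case unfolding Suc.IH power_Suc by (simp only: mult.assoc)
    qed simp
    have rl: "rw n (adj A ^ L * y)" for L using A ry by (cases L) auto
    have "(\<lambda>L. re (adj (adj A ^ L * y) * (P * (adj A ^ L * y)))) \<longlonglongrightarrow> re (adj 0 * (P * 0))"
      by (rule form_tendsto[where n = n and m = n]) (use rl A ry in \<open>simp_all add: decay_tendsto(2)[of "adj A" n y]\<close>)
    then have "re (adj y * (P * y)) = 0" unfolding iter[symmetric] by (simp add: LIMSEQ_const_iff)
    from psd_kernel[OF P(1) this, of i] have "ent (P * adj Y * un j 0) i 0 = 0" by (simp add: y_def mult.assoc)
    then show "ent (P * adj Y) i j = ent 0 i j" by simp
  qed
  then have "adj (P * adj Y) = 0" by simp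
  then show ?thesis using P(1) by (simp add: hm_adj)
qed

text \<open>In coordinates of its range, a Gramian of rank \<open>r\<close> gives a realization of
  order \<open>r\<close> with the same transfer matrix, so minimality forces full rank. The second
  alternative is the observability Gramian, reduced dually with \<open>adj V\<close> as
  intertwiner.\<close>

lemma minimal_gramian_invertible:
  assumes min: "minimal_rlz (A, B, C, D)" and dims: "A \<in> carrier_mat n n" "B \<in> carrier_mat n m" "C \<in> carrier_mat s n" "D \<in> carrier_mat s m"
    and k: "0 < k"
    and P: "psd P" "rw n P" "rl P" and A': "A' = sc (complex_of_real (1 / k)) * rF A"
    and eq: "A' * (P * adj A') + rF B * adj (rF B) = P \<or> adj A' * (P * A') + adj (rF C) * rF C = P"
  obtains Q where "rw n Q" "cl n Q" "P * Q = proj n"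
proof -
  have dA': "rw n A'" "cl n A'" "rl A'" using dims by (simp_all add: A')
  have AA': "rF A = sc (complex_of_real k) * A'" using k by (simp add: A' sc_mult_left)
  have key: "n \<le> dim_row A2"
    if "A2 \<in> carrier_mat r r" "B2 \<in> carrier_mat r m" "C2 \<in> carrier_mat s r"
      "same_tf (A, B, C, D) (A2, B2, C2, D)" for A2 B2 C2 r
  proof -
    have "wf_rlz (A2, B2, C2, D)" using that dims by (simp add: wf_rlz_def)
    moreover have "\<And>R'. wf_rlz R' \<and> same_tf (A, B, C, D) R' \<Longrightarrow> dim_row A \<le> dim_row (fst R')"
      using min unfolding minimal_rlz_def fst_conv by blast
    ultimately have "dim_row A \<le> dim_row (fst (A2, B2, C2, D))" using that(4) by blast
    then show ?thesis using dims by simp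
  qed
  have "\<exists>r V W. rw n V \<and> cl r V \<and> rw r W \<and> cl n W \<and> W * V = proj r \<and> V * adj V = P \<and> r \<le> n \<and> n \<le> r"
    using eq
  proof
    assume eq': "A' * (P * adj A') + rF B * adj (rF B) = P"
    obtain r V W Ar Br where r: "r \<le> n" "rw n V" "cl r V" "rw r W" "cl n W" "rl V" "rl W" "W * V = proj r" "V * adj V = P"
    "rw r Ar" "cl r Ar" "rl Ar" "rw r Br" "cl m Br" "rl Br" "A' * V = V * Ar" "rF B = V * Br"
      using gramian_reduction[OF dA'(1,2) rF_rw[OF dims(2)] rF_cl[OF dims(2)] P(1,2) eq' dA'(3) rF_rl P(3)] by metis
    define A2 where "A2 = ofR r r (sc (complex_of_real k) * Ar)"
    define B2 where "B2 = ofR r m Br"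
    define C2 where "C2 = ofR s r (rF C * V)"
    have F2: "rF A2 = sc (complex_of_real k) * Ar" "rF B2 = Br" "rF C2 = rF C * V"
      using r dims by (simp_all add: A2_def B2_def C2_def rF_ofR)
    have d2: "A2 \<in> carrier_mat r r" "B2 \<in> carrier_mat r m" "C2 \<in> carrier_mat s r" by (simp_all add: A2_def B2_def C2_def)
    have "same_tf (A, B, C, D) (A2, B2, C2, D)" unfolding same_tf_def
    proof (intro allI impI, elim conjE)
      fix z assume def: "defined_at (A, B, C, D) z" "defined_at (A2, B2, C2, D) z"
      obtain F where F: "tf (A, B, C, D) z \<in> carrier_mat s m" "toF (tf (A, B, C, D) z) = rF C * F + rF D"
        "\<And>F'. rw n F' \<Longrightarrow> sc z * F' = rF A * F' + rF B \<Longrightarrow> F' = F"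
        using tf_resolvent[OF dims def(1)] by metis
      obtain G where G: "sc z * G = rF A2 * G + rF B2" "tf (A2, B2, C2, D) z \<in> carrier_mat s m" "toF (tf (A2, B2, C2, D) z) = rF C2 * G + rF D"
        using tf_resolvent[OF d2 dims(4) def(2)] by metis
      have AV: "rF A * V = V * rF A2" unfolding F2 AA' by (simp add: mult.assoc r(16) mult_sc_left)
      have "sc z * (V * G) = V * (sc z * G)" by (simp add: mult_sc_left)
      also have "\<dots> = (V * rF A2) * G + V * rF B2" unfolding G(1) by (simp add: distrib_left mult.assoc)
      also have "\<dots> = rF A * (V * G) + rF B" unfolding AV[symmetric] F2(2) r(17)[symmetric] by (simp add: mult.assoc)
      finally have "V * G = F" using F(3) r(2) by simp
      then show "tf (A, B, C, D) z = tf (A2, B2, C2, D) z"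
        by (intro toF_inject[OF F(1) G(2)]) (simp add: F(2) G(3) F2 mult.assoc)
    qed
    then have "n \<le> r" using key[OF d2] d2(1) by auto
    then show ?thesis using r by blast
  next
    assume "adj A' * (P * A') + adj (rF C) * rF C = P"
    then have eq': "adj A' * (P * adj (adj A')) + adj (rF C) * adj (adj (rF C)) = P" by simp
    have h: "rw n (adj A')" "cl n (adj A')" "rw n (adj (rF C))" "cl s (adj (rF C))" "rl (adj A')" "rl (adj (rF C))"
      using dims dA' by simp_all
    obtain r V W Ar Br where r: "r \<le> n" "rw n V" "cl r V" "rw r W" "cl n W" "rl V" "rl W" "W * V = proj r" "V * adj V = P"
    "rw r Ar" "cl r Ar" "rl Ar" "rw r Br" "cl s Br" "rl Br" "adj A' * V = V * Ar" "adj (rF C) = V * Br"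
      using gramian_reduction[OF h(1-4) P(1,2) eq' h(5,6) P(3)] by metis
    have AVr: "adj V * A' = adj Ar * adj V" "rF C = adj Br * adj V"
      using arg_cong[OF r(16), of adj] arg_cong[OF r(17), of adj] by simp_all
    define A2 where "A2 = ofR r r (sc (complex_of_real k) * adj Ar)"
    define B2 where "B2 = ofR r m (adj V * rF B)"
    define C2 where "C2 = ofR s r (adj Br)"
    have F2: "rF A2 = sc (complex_of_real k) * adj Ar" "rF B2 = adj V * rF B" "rF C2 = adj Br"
      using r dims by (simp_all add: A2_def B2_def C2_def rF_ofR)
    have d2: "A2 \<in> carrier_mat r r" "B2 \<in> carrier_mat r m" "C2 \<in> carrier_mat s r" by (simp_all add: A2_def B2_def C2_def)
    have "same_tf (A, B, C, D) (A2, B2, C2, D)" unfolding same_tf_def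
    proof (intro allI impI, elim conjE)
      fix z assume def: "defined_at (A, B, C, D) z" "defined_at (A2, B2, C2, D) z"
      obtain F where F: "sc z * F = rF A * F + rF B" "tf (A, B, C, D) z \<in> carrier_mat s m" "toF (tf (A, B, C, D) z) = rF C * F + rF D"
        using tf_resolvent[OF dims def(1)] by metis
      obtain G where G: "tf (A2, B2, C2, D) z \<in> carrier_mat s m" "toF (tf (A2, B2, C2, D) z) = rF C2 * G + rF D"
        "\<And>F'. rw r F' \<Longrightarrow> sc z * F' = rF A2 * F' + rF B2 \<Longrightarrow> F' = G"
        using tf_resolvent[OF d2 dims(4) def(2)] by metis
      have AV: "adj V * rF A = rF A2 * adj V" unfolding F2 AA' by (simp add: mult.assoc AVr(1) mult_sc_left)
      have "sc z * (adj V * F) = adj V * (sc z * F)" by (simp add: mult_sc_left)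
      also have "\<dots> = (adj V * rF A) * F + adj V * rF B" unfolding F(1) by (simp add: distrib_left mult.assoc)
      also have "\<dots> = rF A2 * (adj V * F) + rF B2" unfolding AV F2(2) by (simp add: mult.assoc)
      finally have "adj V * F = G" using G(3) r(3) by simp
      then show "tf (A, B, C, D) z = tf (A2, B2, C2, D) z"
        by (intro toF_inject[OF F(2) G(1)]) (simp add: F(3) G(2) F2(3) AVr(2) mult.assoc)
    qed
    then have "n \<le> r" using key[OF d2] d2(1) by auto
    then show ?thesis using r by blast
  qed
  \<comment> \<open>With \<open>r = n\<close> the factor \<open>V\<close> is square with a left
    inverse, hence invertible, and so is \<open>V * adj V\<close>.\<close>
  then obtain V W where V: "rw n V" "cl n V" "rw n W" "cl n W" "W * V = proj n" "V * adj V = P"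
    by (metis le_antisym)
  have "x = 0" if "rw n x" "V * x = 0" for x
  proof -
    have "W * V * x = 0" using that by (simp add: mult.assoc)
    then show ?thesis using V(5) that by simp
  qed
  from inj_inverse[OF V(1,2) this] obtain T where T: "rw n T" "V * T = proj n" by metis
  have "W = W * (V * T)" using T V by simp
  also have "\<dots> = proj n * T" using V(5) by (metis mult.assoc)
  finally have VW: "V * W = proj n" using T by simp
  have "P * (adj W * W) = V * ((adj V * adj W) * W)" by (simp add: V(6)[symmetric] mult.assoc)
  also have "adj V * adj W = proj n" using arg_cong[OF V(5), of adj] by simp
  finally have "P * (adj W * W) = proj n" using V VW by simp
  then show ?thesis using that[of "adj W * W"] V by simp
qed

text \<open>If \<open>v\<close> is an eigenvector for an
  eigenvalue outside the disc, reachability turns equality of the transfer functions into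
  \<open>C A\<^sup>k v = C' A'\<^sup>k t\<close> for all \<open>k\<close>; the right-hand side decays, so \<open>C v = 0\<close>, against observability.\<close>
lemma minimal_stable:
  assumes min: "minimal_rlz (A, B, C, D)" and dims: "A \<in> carrier_mat n n" "B \<in> carrier_mat n m" "C \<in> carrier_mat s n" "D \<in> carrier_mat s m"
    and RH: "in_RH (A, B, C, D)"
  shows "stab (rF A)"
proof -
  obtain A2 B2 C2 D2 where R2: "wf_rlz (A2, B2, C2, D2)" "schur_stable A2" "same_tf (A, B, C, D) (A2, B2, C2, D2)"
    using RH unfolding in_RH_def by auto
  define n2 where "n2 = dim_row A2"
  have d2': "A2 \<in> carrier_mat n2 n2" "B2 \<in> carrier_mat n2 (dim_col D2)" "C2 \<in> carrier_mat (dim_row D2) n2" "D2 \<in> carrier_mat (dim_row D2) (dim_col D2)"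
    using R2(1) by (simp_all add: wf_rlz_def n2_def)
  have "stab (rF A2)" using R2(2) schur_stable_iff[OF d2'(1)] by simp
  then have st2: "decay (rF A2)" by (rule stab_decay[OF _ rF_rw[OF d2'(1)] rF_cl[OF d2'(1)]])
  define N where "N = n + n2"
  have cN: "cl (n + n2) X" if "cl n X" for X using cl_mono[OF that] by simp
  have rN: "rw (n + n2) X" if "rw n X" for X using rw_mono[OF that] by simp
  \<comment> \<open>Direct sum of the minimal realization and a stable one; with \<open>Be\<close>
    and \<open>Ce\<close> it realizes the difference of the two transfer matrices up to the
    feedthrough terms.\<close>
  define Ae where "Ae = rF A + sh n * (rF A2 * adj (sh n))"
  have Ae: "rw N Ae" "cl N Ae" "rl Ae"
  proof -
    show "rw N Ae" unfolding Ae_def N_def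
      by (intro rw_closure(1) rN rw_sh rw_mult rF_rw[OF dims(1)] rF_rw[OF d2'(1)])
    show "cl N Ae" unfolding Ae_def N_def
      by (intro cl_closure(1) cN cl_mult cl_sh rF_cl[OF dims(1)] rF_cl[OF d2'(1)])
    show "rl Ae" by (simp add: Ae_def)
  qed
  obtain k where k: "0 < k" "decay (sc (complex_of_real (1 / k)) * Ae)" "\<And>z x. k \<le> cmod z \<Longrightarrow> Ae * x = sc z * x \<Longrightarrow> x = 0"
    using scaled_decay[OF Ae(1,2)] by metis
  have AeV: "Ae * X = rF A * X" if "rw n X" for X using that by (simp add: Ae_def distrib_right mult.assoc)
  have AeS: "Ae * (sh n * X) = sh n * (rF A2 * X)" for X using dims by (simp add: Ae_def distrib_right mult.assoc)
  have defd: "defined_at (A, B, C, D) z" "defined_at (A2, B2, C2, D2) z" if z: "k \<le> cmod z" for z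
  proof -
    show "defined_at (A, B, C, D) z"
    proof (rule defined_atI[OF dims(1)])
      fix x assume "rw n x" "rF A * x = sc z * x"
      then show "x = 0" using k(3)[OF z, of x] AeV by simp
    qed
    show "defined_at (A2, B2, C2, D2) z"
    proof (rule defined_atI[OF d2'(1)])
      fix x assume "rw n2 x" "rF A2 * x = sc z * x"
      then have "sh n * x = 0" using k(3)[OF z, of "sh n * x"] AeS by (simp add: mult_sc_left)
      then have "adj (sh n) * (sh n * x) = 0" by simp
      then show "x = 0" by simp
    qed
  qed
  \<comment> \<open>\<open>same_tf\<close> compares matrices where both realizations are defined;
    one such point is enough to match the sizes.\<close>
  have mm: "dim_col D2 = m" "dim_row D2 = s"
  proof -
    have z: "k \<le> cmod (complex_of_real k)" using k by simp
    from tf_resolvent[OF dims defd(1)[OF z]] have t1: "tf (A, B, C, D) (complex_of_real k) \<in> carrier_mat s m" by metis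
    from tf_resolvent[OF d2' defd(2)[OF z]] have t2: "tf (A2, B2, C2, D2) (complex_of_real k) \<in> carrier_mat (dim_row D2) (dim_col D2)" by metis
    have "tf (A, B, C, D) (complex_of_real k) = tf (A2, B2, C2, D2) (complex_of_real k)"
      using R2(3) defd[OF z] unfolding same_tf_def by blast
    then show "dim_col D2 = m" "dim_row D2 = s" using t1 t2 by auto
  qed
  note d2 = d2'[unfolded mm]
  define Be where "Be = rF B + sh n * rF B2"
  define Ce where "Ce = rF C - rF C2 * adj (sh n)"
  have Be: "rw N Be" "cl m Be" "rl Be" and Ce: "rw s Ce" "cl N Ce" "rl Ce"
  proof -
    show "rw N Be" unfolding Be_def N_def
      by (intro rw_closure(1) rN rw_sh rF_rw[OF dims(2)] rF_rw[OF d2(2)])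
    show "cl N Ce" unfolding Ce_def N_def
      by (intro cl_closure(2) cN cl_sh rF_cl[OF dims(3)] rF_cl[OF d2(3)])
    show "cl m Be" unfolding Be_def by (intro cl_closure(1) cl_mult rF_cl[OF dims(2)] rF_cl[OF d2(2)])
    show "rw s Ce" unfolding Ce_def by (intro rw_closure(2) rw_mult rF_rw[OF dims(3)] rF_rw[OF d2(3)])
    show "rl Be" "rl Ce" by (simp_all add: Be_def Ce_def)
  qed
  have const: "\<exists>F. rw N F \<and> sc (complex_of_real t) * F = Ae * F + Be \<and> Ce * F = rF D2 - rF D" if t: "k \<le> t" for t
  proof -
    have z: "k \<le> cmod (complex_of_real t)" using t k(1) by simp
    obtain F where F: "rw n F" "sc (complex_of_real t) * F = rF A * F + rF B"
        "toF (tf (A, B, C, D) (complex_of_real t)) = rF C * F + rF D"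
      using tf_resolvent[OF dims defd(1)[OF z]] by metis
    obtain G where G: "rw n2 G" "sc (complex_of_real t) * G = rF A2 * G + rF B2"
        "toF (tf (A2, B2, C2, D2) (complex_of_real t)) = rF C2 * G + rF D2"
      using tf_resolvent[OF d2 defd(2)[OF z]] by metis
    have "tf (A, B, C, D) (complex_of_real t) = tf (A2, B2, C2, D2) (complex_of_real t)"
      using R2(3) defd[OF z] unfolding same_tf_def by blast
    then have CC: "rF C * F + rF D = rF C2 * G + rF D2" using F G by simp
    have "sc (complex_of_real t) * (sh n * G) = sh n * (sc (complex_of_real t) * G)" by (simp add: mult_sc_left)
    also have "\<dots> = sh n * (rF A2 * G) + sh n * rF B2" unfolding G(2) by (simp add: distrib_left)
    finally have "sc (complex_of_real t) * (F + sh n * G) = Ae * (F + sh n * G) + Be"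
      using F G by (simp add: distrib_left AeV AeS Be_def)
    moreover have "Ce * (F + sh n * G) = rF C * F - rF C2 * G"
      using F dims by (simp add: Ce_def algebra_simps)
    moreover have "rF C * F - rF C2 * G = rF D2 - rF D" using CC by (simp add: algebra_simps)
    ultimately have "Ce * (F + sh n * G) = rF D2 - rF D"
      "sc (complex_of_real t) * (F + sh n * G) = Ae * (F + sh n * G) + Be" by simp_all
    moreover have "rw N (F + sh n * G)" unfolding N_def by (rule rw_closure(1)[OF rN[OF F(1)] rw_sh[OF G(1)]])
    ultimately show ?thesis by (intro exI[of _ "F + sh n * G"] conjI)
  qed
  have markov: "Ce * (Ae ^ j * Be) = 0" for j by (rule markov_vanish[OF Ae(1,2) Be(1,2) Ce(1,2) const])
  define Ak where "Ak = sc (complex_of_real (1 / k)) * Ae"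
  have Ak: "decay Ak" "rw N Ak" "cl N Ak" "rl Ak" using k Ae by (simp_all add: Ak_def)
  have "hm (Be * adj Be)" "rw N (Be * adj Be)" using Be by simp_all
  then obtain Pe where Pe: "hm Pe" "rw N Pe" "Ak * (Pe * adj Ak) + Be * adj Be = Pe" "rl Pe" "psd Pe"
    using stein[of "adj Ak" N "Be * adj Be"] Ak Be psd_gram(2) by auto
  have ann: "Ce * (Ae ^ j * Pe) = 0" for j
  proof -
    have "(Ce * Ae ^ j) * Pe = 0"
    proof (rule gramian_annihilated[OF Ak(1-3) Pe(5,2,3)])
      show "cl N (Ce * Ae ^ j)" using Ae Ce by (cases j) (simp_all add: power_Suc2 del: power_Suc)
      fix l
      have "Ce * Ae ^ j * (Ak ^ l * Be) = sc (complex_of_real (1 / k) ^ l) * (Ce * (Ae ^ (j + l) * Be))"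
        unfolding Ak_def sc_mult_power by (simp add: mult.assoc mult_sc_left power_add)
      then show "Ce * Ae ^ j * (Ak ^ l * Be) = 0" using markov by simp
    qed
    then show ?thesis by (simp add: mult.assoc)
  qed
  define A' where "A' = sc (complex_of_real (1 / k)) * rF A"
  have A': "decay A'" "rw n A'" "cl n A'" "rl A'"
  proof -
    show "rw n A'" "cl n A'" "rl A'" using dims by (simp_all add: A'_def)
    have "stab A'" unfolding stab_def
    proof (intro allI impI)
      fix x l assume x: "A' * x = sc l * x \<and> x \<noteq> 0"
      show "cmod l < 1"
      proof (cases "l = 0")
        case False
        have rx: "rw n x" using eigenvector_rw[OF \<open>rw n A'\<close>] x False by blast
        have "Ak * x = sc l * x" using x AeV[OF rx] by (simp add: Ak_def A'_def mult.assoc)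
        then show ?thesis using decay_stab[OF Ak(1,2)] x unfolding stab_def by blast
      qed simp
    qed
    then show "decay A'" using stab_decay \<open>rw n A'\<close> \<open>cl n A'\<close> by blast
  qed
  \<comment> \<open>The corner of the joint Gramian is the Gramian of the given realization
    alone.\<close>
  define P where "P = proj n * (Pe * proj n)"
  have P: "psd P" "rw n P" "rl P" using Pe psd_conj[OF Pe(5), of "proj n"] by (simp_all add: P_def)
  have pA: "proj n * Ak = A'" "proj n * Be = rF B"
    using dims by (simp_all add: Ak_def A'_def Ae_def Be_def distrib_left mult_sc_left)
  have Ap: "adj Ak * proj n = adj A'" "adj Be * proj n = adj (rF B)"
    using arg_cong[OF pA(1), of adj] arg_cong[OF pA(2), of adj] by simp_all
  have "A' * (P * adj A') + rF B * adj (rF B) = P"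
  proof -
    have "P = proj n * ((Ak * (Pe * adj Ak) + Be * adj Be) * proj n)" unfolding Pe(3) P_def by simp
    also have "\<dots> = (proj n * Ak) * (Pe * (adj Ak * proj n)) + (proj n * Be) * (adj Be * proj n)"
      by (simp add: algebra_simps)
    also have "\<dots> = A' * (Pe * adj A') + rF B * adj (rF B)" unfolding pA Ap by simp
    finally have "P = A' * (Pe * adj A') + rF B * adj (rF B)" .
    moreover have "A' * (P * adj A') = A' * (Pe * adj A')" unfolding P_def using A'(3) by (simp add: mult.assoc)
    ultimately show ?thesis by simp
  qed
  then obtain Pi where Pi: "rw n Pi" "P * Pi = proj n"
    using minimal_gramian_invertible[OF min dims k(1) P A'_def] by metis
  have "hm (adj (rF C) * rF C)" "rw n (adj (rF C) * rF C)" "rl (adj (rF C) * rF C)" using dims by simp_all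
  then obtain Q where Q: "rw n Q" "adj A' * (Q * A') + adj (rF C) * rF C = Q" "rl Q" "psd Q"
    using stein[OF A'(1-3), of "adj (rF C) * rF C"] A'(4) psd_gram(1) by metis
  then obtain Qi where Qi: "rw n Qi" "Q * Qi = proj n"
    using minimal_gramian_invertible[OF min dims k(1) Q(4,1,3) A'_def] by metis
  show ?thesis unfolding stab_def
  proof (intro allI impI)
    fix v l assume v: "rF A * v = sc l * v \<and> v \<noteq> 0"
    show "cmod l < 1"
    proof (rule ccontr)
      assume l: "\<not> cmod l < 1"
      have rv: "rw n v" using eigenvector_rw[OF rF_rw[OF dims(1)]] v l by force
      \<comment> \<open>Invertibility of \<open>P\<close> lifts \<open>v\<close> to a vector
        \<open>t\<close> in the range of the joint Gramian with first component \<open>v\<close>;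
        \<open>Ce\<close> annihilates \<open>Ae ^ j * t\<close> for all \<open>j\<close>.\<close>
      define t where "t = Pe * (Pi * v)"
      have pt: "proj n * t = v"
      proof -
        have "proj n * t = P * Pi * v" using Pi(1) by (simp add: t_def P_def mult.assoc)
        then show ?thesis using Pi(2) rv by simp
      qed
      define w where "w = adj (sh n) * t"
      have tdec: "t = v + sh n * w"
      proof (rule lfm_eqI)
        fix i j
        show "ent t i j = ent (v + sh n * w) i j"
          using rv by (auto simp: pt[symmetric] w_def rw_ent)
      qed
      have rw_w: "rw n2 w"
      proof -
        have "rw N t" using Pe by (simp add: t_def)
        then show ?thesis by (simp add: w_def rw_ent N_def)
      qed
      have Aet: "Ae ^ j * t = sc (l ^ j) * v + sh n * (rF A2 ^ j * w)" for j
      proof (induction j)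
        case (Suc j)
        have "Ae ^ Suc j * t = Ae * (sc (l ^ j) * v) + Ae * (sh n * (rF A2 ^ j * w))"
          by (simp add: mult.assoc Suc distrib_left)
        also have "Ae * (sc (l ^ j) * v) = sc (l ^ j) * (sc l * v)" using v AeV[OF rv] by (simp add: mult_sc_left_nm)
        also have "\<dots> = sc (l ^ Suc j) * v" by (simp add: sc_mult_left mult.commute)
        finally show ?case by (simp add: AeS mult.assoc)
      qed (simp add: tdec)
      have CAv: "sc (l ^ j) * (rF C * v) = rF C2 * (rF A2 ^ j * w)" for j
      proof -
        have "Ce * (Ae ^ j * t) = 0" using ann[of j] by (simp add: t_def flip: mult.assoc)
        then have "Ce * (sc (l ^ j) * v + sh n * (rF A2 ^ j * w)) = 0" unfolding Aet .
        then show ?thesis using rv dims by (simp add: Ce_def algebra_simps mult_sc_left_nm)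
      qed
      have Cv: "rF C * v = 0"
      proof (rule lfm_eqI)
        fix i c
        have rwc: "rw n2 (w * un c 0)" using rw_w by simp
        have rk: "rw n2 (rF A2 ^ j * (w * un c 0))" for j using rwc d2 by (cases j) auto
        have "(\<lambda>j. ent (rF C2 * (rF A2 ^ j * (w * un c 0))) i 0) \<longlonglongrightarrow> ent (rF C2 * 0) i 0"
          by (rule ent_mult_tendsto[OF rk]) (use decay_tendsto(2)[OF st2 _ rwc] d2 in \<open>simp_all\<close>)
        moreover have "rF C2 * (rF A2 ^ j * (w * un c 0)) = sc (l ^ j) * (rF C * v) * un c 0" for j
          unfolding CAv by (simp add: mult.assoc)
        ultimately have "(\<lambda>j. l ^ j * ent (rF C * v) i c) \<longlonglongrightarrow> 0" by simp
        then have "(\<lambda>j. cmod (l ^ j * ent (rF C * v) i c)) \<longlonglongrightarrow> 0" by (rule tendsto_norm_zero)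
        moreover have "cmod (l ^ j * ent (rF C * v) i c) \<ge> cmod (ent (rF C * v) i c)" for j
          using l one_le_power[of "cmod l" j] mult_right_mono[of 1 "cmod l ^ j" "cmod (ent (rF C * v) i c)"]
          by (simp add: norm_mult norm_power)
        ultimately have "cmod (ent (rF C * v) i c) \<le> 0" by (intro LIMSEQ_le_const) auto
        then show "ent (rF C * v) i c = ent 0 i c" by simp
      qed
      have A'v: "A' * v = sc (l / complex_of_real k) * v"
        using v by (simp add: A'_def mult.assoc sc_mult_left)
      have lk: "cmod (l / complex_of_real k) < 1"
        using decay_stab[OF A'(1,2)] A'v v unfolding stab_def by blast
      \<comment> \<open>With zero output, the observability energy of the eigenvector reproduces
        itself with a factor below \<open>1\<close>, so it vanishes.\<close>
      have "Q * v = 0"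
      proof (rule lfm_eqI)
        fix i c
        define y where "y = v * un c 0"
        have y: "A' * y = sc (l / complex_of_real k) * y" "rF C * y = 0"
          using A'v Cv by (simp_all add: y_def flip: mult.assoc)
        have "re (adj y * (Q * y)) = re (adj (A' * y) * (Q * (A' * y))) + re (adj (rF C * y) * (rF C * y))"
          by (subst Q(2)[symmetric]) (simp add: algebra_simps)
        also have "\<dots> = (cmod (l / complex_of_real k))\<^sup>2 * re (adj y * (Q * y))"
          unfolding y form_sc by simp
        finally have "(1 - (cmod (l / complex_of_real k))\<^sup>2) * re (adj y * (Q * y)) = 0" by (simp add: algebra_simps)
        moreover have "(cmod (l / complex_of_real k))\<^sup>2 < 1" using lk by (simp add: abs_square_less_1)
        ultimately have "re (adj y * (Q * y)) = 0" by simp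
        from psd_kernel[OF Q(4) this, of i] have "ent (Q * v * un c 0) i 0 = 0" by (simp add: y_def mult.assoc)
        then show "ent (Q * v) i c = ent 0 i c" by simp
      qed
      have "adj Qi * Q = proj n" using arg_cong[OF Qi(2), of adj] Q(4) by (simp add: hm_adj)
      then have "v = adj Qi * (Q * v)" using rv by (simp flip: mult.assoc)
      then show False using \<open>Q * v = 0\<close> v by simp
    qed
  qed
qed

section \<open>Assembling the factorization\<close>

lemma block_diag_stab:
  assumes A: "decay A1" "rw n1 A1" "cl n1 A1" "decay A2" "rw n2 A2" "cl n2 A2"
  shows "stab (A1 + sh n1 * (A2 * adj (sh n1)))"
  unfolding stab_def
proof (intro allI impI)
  fix x l assume x: "(A1 + sh n1 * (A2 * adj (sh n1))) * x = sc l * x \<and> x \<noteq> 0"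
  define y where "y = adj (sh n1) * x"
  have e: "A1 * x + sh n1 * (A2 * y) = sc l * x" using x by (simp add: y_def distrib_right mult.assoc)
  show "cmod l < 1"
  proof (cases "y = 0")
    case True
    then have "A1 * x = sc l * x" using e by simp
    then show ?thesis using decay_stab[OF A(1,2)] x unfolding stab_def by blast
  next
    case False
    have "adj (sh n1) * (A1 * x + sh n1 * (A2 * y)) = A2 * y" using A by (simp add: distrib_left)
    then have "A2 * y = sc l * y" unfolding e by (simp add: y_def mult_sc_left)
    then show ?thesis using decay_stab[OF A(4,5)] False unfolding stab_def by blast
  qed
qed

text \<open>Each of the four products has four blocks. Ten of the sixteen are given, the other six
  are adjoints of them. The second output block enters with a minus sign through
  \<open>N\<close>.\<close>

lemma composite_kyp:
  fixes n1 n2 q p :: nat and C1 C2 D1 D2 :: lfm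
  assumes dims: "rw n1 A1" "cl n1 A1" "rw n2 A2" "cl n2 A2" "rw n1 E1" "cl q E1" "rw n2 E2" "cl p E2"
    "rw q C11" "cl n1 C11" "rw q C12" "cl n2 C12" "rw p C22" "cl n2 C22"
    "rw q D11" "cl q D11" "rw q D12" "cl p D12" "rw p D22" "cl p D22"
    "hm Z11" "rw n1 Z11" "rw n1 Z12" "cl n2 Z12" "hm Z22" "rw n2 Z22" "hm M"
  and K: "adj A1 * (Z11 * A1) - Z11 + adj C11 * C11 = adj C1 * (M * C1)"
    "adj A1 * (Z11 * E1) + adj C11 * D11 = adj C1 * (M * D1)"
    "adj E1 * (Z11 * E1) + adj D11 * D11 = adj D1 * (M * D1)"
    "adj A1 * (Z12 * A2) - Z12 + adj C11 * C12 = adj C1 * (M * C2)"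
    "adj A1 * (Z12 * E2) + adj C11 * D12 = adj C1 * (M * D2)"
    "adj E1 * (Z12 * A2) + adj D11 * C12 = adj D1 * (M * C2)"
    "adj E1 * (Z12 * E2) + adj D11 * D12 = adj D1 * (M * D2)"
    "adj A2 * (Z22 * A2) - Z22 + adj C12 * C12 - adj C22 * C22 = adj C2 * (M * C2)"
    "adj A2 * (Z22 * E2) + adj C12 * D12 - adj C22 * D22 = adj C2 * (M * D2)"
    "adj E2 * (Z22 * E2) + adj D12 * D12 - adj D22 * D22 = adj D2 * (M * D2)"
  defines "A \<equiv> A1 + sh n1 * (A2 * adj (sh n1))" and "B \<equiv> E1 + sh n1 * (E2 * adj (sh q))"
    and "C \<equiv> C11 + C12 * adj (sh n1) + sh q * (C22 * adj (sh n1))"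
    and "D \<equiv> D11 + D12 * adj (sh q) + sh q * (D22 * adj (sh q))"
    and "N \<equiv> proj q - sh q * (proj p * adj (sh q))"
    and "Z \<equiv> Z11 + Z12 * adj (sh n1) + sh n1 * adj Z12 + sh n1 * (Z22 * adj (sh n1))"
  shows "adj A * (Z * A) - Z + adj C * (N * C) = adj (C1 + C2 * adj (sh n1)) * (M * (C1 + C2 * adj (sh n1)))"
    "adj A * (Z * B) + adj C * (N * D) = adj (C1 + C2 * adj (sh n1)) * (M * (D1 + D2 * adj (sh q)))"
    "adj B * (Z * A) + adj D * (N * C) = adj (D1 + D2 * adj (sh q)) * (M * (C1 + C2 * adj (sh n1)))"
    "adj B * (Z * B) + adj D * (N * D) = adj (D1 + D2 * adj (sh q)) * (M * (D1 + D2 * adj (sh q)))"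
proof -
  note h = hm_adj[OF dims(21)] hm_adj[OF dims(25)] hm_adj[OF dims(27)]
  have c: "cl n1 Z11" "cl n2 Z22" using dims hm_cl by blast+
  note d = dims c
  have Ka: "adj A2 * (adj Z12 * A1) - adj Z12 + adj C12 * C11 = adj C2 * (M * C1)"
    "adj E2 * (adj Z12 * A1) + adj D12 * C11 = adj D2 * (M * C1)"
    "adj A2 * (adj Z12 * E1) + adj C12 * D11 = adj C2 * (M * D1)"
    "adj E2 * (adj Z12 * E1) + adj D12 * D11 = adj D2 * (M * D1)"
    "adj E1 * (Z11 * A1) + adj D11 * C11 = adj D1 * (M * C1)"
    "adj E2 * (Z22 * A2) + adj D12 * C12 - adj D22 * C22 = adj D2 * (M * C2)"
    using arg_cong[OF K(4), of adj] arg_cong[OF K(5), of adj] arg_cong[OF K(6), of adj] arg_cong[OF K(7), of adj]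
      arg_cong[OF K(2), of adj] arg_cong[OF K(9), of adj] by (simp_all add: h mult.assoc)
  let ?s = "sh n1" and ?t = "sh q"
  have "adj A * (Z * A) - Z + adj C * (N * C) =
      (adj A1 * (Z11 * A1) - Z11 + adj C11 * C11) + (adj A1 * (Z12 * A2) - Z12 + adj C11 * C12) * adj ?s
      + ?s * (adj A2 * (adj Z12 * A1) - adj Z12 + adj C12 * C11)
      + ?s * ((adj A2 * (Z22 * A2) - Z22 + adj C12 * C12 - adj C22 * C22) * adj ?s)"
    unfolding A_def C_def N_def Z_def using d by (simp add: algebra_simps)
  also have "\<dots> = adj (C1 + C2 * adj ?s) * (M * (C1 + C2 * adj ?s))"
    unfolding K Ka by (simp add: algebra_simps)
  finally show "adj A * (Z * A) - Z + adj C * (N * C) = adj (C1 + C2 * adj ?s) * (M * (C1 + C2 * adj ?s))" .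
  have "adj A * (Z * B) + adj C * (N * D) =
      (adj A1 * (Z11 * E1) + adj C11 * D11) + (adj A1 * (Z12 * E2) + adj C11 * D12) * adj ?t
      + ?s * (adj A2 * (adj Z12 * E1) + adj C12 * D11)
      + ?s * ((adj A2 * (Z22 * E2) + adj C12 * D12 - adj C22 * D22) * adj ?t)"
    unfolding A_def B_def C_def D_def N_def Z_def using d by (simp add: algebra_simps)
  also have "\<dots> = adj (C1 + C2 * adj ?s) * (M * (D1 + D2 * adj ?t))"
    unfolding K Ka by (simp add: algebra_simps)
  finally show "adj A * (Z * B) + adj C * (N * D) = adj (C1 + C2 * adj ?s) * (M * (D1 + D2 * adj ?t))" .
  have "adj B * (Z * A) + adj D * (N * C) =
      (adj E1 * (Z11 * A1) + adj D11 * C11) + (adj E1 * (Z12 * A2) + adj D11 * C12) * adj ?s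
      + ?t * (adj E2 * (adj Z12 * A1) + adj D12 * C11)
      + ?t * ((adj E2 * (Z22 * A2) + adj D12 * C12 - adj D22 * C22) * adj ?s)"
    unfolding A_def B_def C_def D_def N_def Z_def using d by (simp add: algebra_simps)
  also have "\<dots> = adj (D1 + D2 * adj ?t) * (M * (C1 + C2 * adj ?s))"
    unfolding K Ka by (simp add: algebra_simps)
  finally show "adj B * (Z * A) + adj D * (N * C) = adj (D1 + D2 * adj ?t) * (M * (C1 + C2 * adj ?s))" .
  have "adj B * (Z * B) + adj D * (N * D) =
      (adj E1 * (Z11 * E1) + adj D11 * D11) + (adj E1 * (Z12 * E2) + adj D11 * D12) * adj ?t
      + ?t * (adj E2 * (adj Z12 * E1) + adj D12 * D11)
      + ?t * ((adj E2 * (Z22 * E2) + adj D12 * D12 - adj D22 * D22) * adj ?t)"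
    unfolding B_def D_def N_def Z_def using d by (simp add: algebra_simps)
  also have "\<dots> = adj (D1 + D2 * adj ?t) * (M * (D1 + D2 * adj ?t))"
    unfolding K Ka by (simp add: algebra_simps)
  finally show "adj B * (Z * B) + adj D * (N * D) = adj (D1 + D2 * adj ?t) * (M * (D1 + D2 * adj ?t))" .
qed

section \<open>Passing between finite matrices, transfer values and ring elements\<close>

lemma rF_four_block:
  assumes "X \<in> carrier_mat r1 c1" "Y \<in> carrier_mat r1 c2" "Z \<in> carrier_mat r2 c1" "W \<in> carrier_mat r2 c2"
  shows "rF (four_block_mat X Y Z W) = rF X + rF Y * adj (sh c1) + sh r1 * rF Z + sh r1 * (rF W * adj (sh c1))"
  using assms by (intro lfm_eqI) auto

lemma rF_append_rows:
  assumes "X \<in> carrier_mat r1 c" "Y \<in> carrier_mat r2 c"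
  shows "rF (X @\<^sub>r Y) = rF X + sh r1 * rF Y"
  using assms unfolding append_rows_def by (subst rF_four_block[of _ r1 c _ 0 _ r2]) (auto simp: rF_zero)

lemma rF_hcat:
  assumes "X \<in> carrier_mat r c1" "Y \<in> carrier_mat r c2"
  shows "rF (hcat X Y) = rF X + rF Y * adj (sh c1)"
  using assms unfolding hcat_def by (subst rF_four_block[of _ r c1 _ c2 _ 0]) (auto simp: rF_zero)

text \<open>On the circle \<open>inverse z = cnj z\<close>, and since the matrices are real,
  conjugating the state equation at \<open>z\<close> gives the one at \<open>inverse z\<close>. This
  turns the paraconjugate in \<open>para\<close> into an adjoint.\<close>

lemma tf_cnj:
  assumes A: "A \<in> carrier_mat n n" and B: "B \<in> carrier_mat n m" and C: "C \<in> carrier_mat p n" and D: "D \<in> carrier_mat p m"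
    and z: "cmod z = 1" and def: "defined_at (A, B, C, D) z" "defined_at (A, B, C, D) (inverse z)"
  shows "toF (tf (A, B, C, D) (inverse z)) = cj (toF (tf (A, B, C, D) z))"
proof -
  have iz: "inverse z = cnj z" using z by (simp add: inverse_complex_def cmod_power2 complex_eq_iff power2_eq_square cmod_def)
  obtain F where F: "rw n F" "sc z * F = rF A * F + rF B" "toF (tf (A, B, C, D) z) = rF C * F + rF D"
    using tf_resolvent[OF A B C D def(1)] by metis
  obtain G where G: "toF (tf (A, B, C, D) (inverse z)) = rF C * G + rF D"
    "\<And>F'. rw n F' \<Longrightarrow> sc (inverse z) * F' = rF A * F' + rF B \<Longrightarrow> F' = G"
    using tf_resolvent[OF A B C D def(2)] by metis
  have r: "cj (rF X) = rF X" for X using rF_rl[of X] by (simp add: rl_def)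
  have "sc (inverse z) * cj F = rF A * cj F + rF B"
    using arg_cong[OF F(2), of cj] by (simp add: iz r)
  then have "cj F = G" using G(2) F(1) by simp
  then show ?thesis unfolding G(1) F(3) by (simp add: r)
qed

lemma toF_transpose: "toF (transpose_mat X) = adj (cj (toF X))"
  by (auto intro!: lfm_eqI)

lemma para_toF:
  assumes "G1 (inverse z) \<in> carrier_mat s m1" "G2 z \<in> carrier_mat s m2" "M \<in> carrier_mat s s"
    and "toF (G1 (inverse z)) = cj T1" "toF (G2 z) = T2"
  shows "para G1 (cm M) G2 z \<in> carrier_mat m1 m2" "toF (para G1 (cm M) G2 z) = adj T1 * (rF M * T2)"
proof -
  have M: "cm M \<in> carrier_mat s s" using assms(3) by (simp add: cm_def)
  show "para G1 (cm M) G2 z \<in> carrier_mat m1 m2"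
    using assms(1,2) M by (simp add: para_def)
  show "toF (para G1 (cm M) G2 z) = adj T1 * (rF M * T2)"
    using assms M by (simp add: para_def toF_mult toF_transpose rF_def mult.assoc)
qed

lemma vF_form:
  assumes "v \<in> carrier_vec m" "w \<in> carrier_vec m"
  shows "Re (map_vec cnj v \<bullet> w) = re (adj (vF v) * vF w)"
proof -
  have "ent (adj (vF v) * vF w) 0 0 = (\<Sum>i<m. ent (adj (vF v)) 0 i * ent (vF w) i 0)"
    by (rule ent_mult_row) (use assms in auto)
  also have "\<dots> = map_vec cnj v \<bullet> w"
    using assms by (auto simp: scalar_prod_def lessThan_atLeast0 intro!: sum.cong)
  finally show ?thesis by (simp add: re_def)
qed

lemma pos_def_form:
  assumes "pos_def H" "H \<in> carrier_mat m m" "rw m u" "0 < nsq u"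
  shows "0 < re (adj u * (toF H * u))"
proof -
  define v where "v = vec m (\<lambda>i. ent u i 0)"
  have v: "v \<in> carrier_vec m" by (simp add: v_def)
  have vu: "vF v = u * un 0 0" using assms(3) by (intro lfm_eqI) (auto simp: v_def rw_ent)
  have "v \<noteq> 0\<^sub>v m"
  proof
    assume "v = 0\<^sub>v m"
    then have "u * un 0 0 = 0" using vu vF_0_iff[OF v] by simp
    then have "nsq u = 0" by (subst nsq_col0) (simp add: nsq_def)
    then show False using assms(4) by simp
  qed
  then have "0 < Re (map_vec cnj v \<bullet> (H *\<^sub>v v))" using assms(1,2) v unfolding pos_def_def by auto
  also have "\<dots> = re (adj (vF v) * vF (H *\<^sub>v v))" using vF_form[OF v, of "H *\<^sub>v v"] assms(2) v by simp
  also have "vF (H *\<^sub>v v) = toF H * vF v" using vF_mult[of H v] assms(2) v by simp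
  also have "re (adj (vF v) * (toF H * vF v)) = re (adj u * (toF H * u))" unfolding vu by (rule re_col0)
  finally show ?thesis .
qed

lemma pos_def_det:
  assumes "pos_def H" "H \<in> carrier_mat m m"
  shows "det H \<noteq> 0"
proof (rule det_nonzeroI[OF assms(2)], rule ccontr)
  fix x assume x: "rw m x" "toF H * x = 0" "x \<noteq> 0"
  then obtain i j where ij: "ent x i j \<noteq> 0" by (metis ent_simps(1) lfm_eqI)
  define u where "u = x * un j 0"
  have "nsq u \<noteq> 0"
  proof
    assume "nsq u = 0"
    from nsq_0D[OF this, of i] show False using ij by (simp add: u_def)
  qed
  then have "0 < nsq u" using nsq_nonneg[of u] by linarith
  then have "0 < re (adj u * (toF H * u))" using pos_def_form[OF assms, of u] x(1) by (simp add: u_def)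
  moreover have "toF H * u = 0" using x(2) by (simp add: u_def flip: mult.assoc)
  ultimately show False by simp
qed

lemma toF_cols_first:
  assumes "G \<in> carrier_mat s (q + p)" shows "toF (cols_first q G) = toF G * proj q" "cols_first q G \<in> carrier_mat s q"
  using assms by (auto intro!: lfm_eqI simp: cols_first_def)

lemma toF_cols_last:
  assumes "G \<in> carrier_mat s (q + p)" shows "toF (cols_last q p G) = toF G * sh q" "cols_last q p G \<in> carrier_mat s p"
  using assms by (auto intro!: lfm_eqI simp: cols_last_def)

lemma cl_mult_sh: "cl (q + p) X \<Longrightarrow> cl p (X * sh q)"
  by (auto simp: cl_ent)

lemma split_cols: "cl (q + p) X \<Longrightarrow> X = X * proj q + X * sh q * adj (sh q)"
  by (rule lfm_eqI) (auto simp: cl_ent)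

text \<open>The inverse is realized by \<open>A - B D' C\<close>, \<open>B D'\<close>,
  \<open>- D' C\<close> and \<open>D'\<close>. Driving the original system with the output
  \<open>T'\<close> of this one reproduces its state \<open>H\<close>, so the cascade is the
  identity.\<close>

lemma stable_inverse_realization:
  assumes dims: "A \<in> carrier_mat n n" "B \<in> carrier_mat n p" "C \<in> carrier_mat p n" "D \<in> carrier_mat p p"
    and D': "rw p D'" "cl p D'" "rl D'" "rF D * D' = proj p" "D' * rF D = proj p"
    and dec: "decay (rF A - rF B * (D' * rF C))"
  shows "stable_inverse p (A, B, C, D)"
proof -
  define Ai where "Ai = ofR n n (rF A - rF B * (D' * rF C))"
  define Bi where "Bi = ofR n p (rF B * D')"
  define Ci where "Ci = ofR p n (- (D' * rF C))"
  define Di where "Di = ofR p p D'"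
  have F: "rF Ai = rF A - rF B * (D' * rF C)" "rF Bi = rF B * D'" "rF Ci = - (D' * rF C)" "rF Di = D'"
    using dims D' by (simp_all add: Ai_def Bi_def Ci_def Di_def rF_ofR)
  have di: "Ai \<in> carrier_mat n n" "Bi \<in> carrier_mat n p" "Ci \<in> carrier_mat p n" "Di \<in> carrier_mat p p"
    by (simp_all add: Ai_def Bi_def Ci_def Di_def)
  have "wf_rlz (Ai, Bi, Ci, Di)" using di by (simp add: wf_rlz_def)
  moreover have "schur_stable Ai"
    unfolding schur_stable_iff[OF di(1)] F using dec by (rule decay_stab[of _ n]) (use dims in simp)
  moreover have "tf (A, B, C, D) z * tf (Ai, Bi, Ci, Di) z = 1\<^sub>m p \<and> tf (Ai, Bi, Ci, Di) z * tf (A, B, C, D) z = 1\<^sub>m p"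
    if def: "defined_at (A, B, C, D) z" "defined_at (Ai, Bi, Ci, Di) z" for z
  proof -
    obtain G where G: "rw n G" "sc z * G = rF A * G + rF B" "tf (A, B, C, D) z \<in> carrier_mat p p"
      "toF (tf (A, B, C, D) z) = rF C * G + rF D" "\<And>x. rw n x \<Longrightarrow> rF A * x = sc z * x \<Longrightarrow> x = 0"
      using tf_resolvent[OF dims def(1)] by metis
    obtain H where H: "rw n H" "sc z * H = rF Ai * H + rF Bi" "tf (Ai, Bi, Ci, Di) z \<in> carrier_mat p p"
      "toF (tf (Ai, Bi, Ci, Di) z) = rF Ci * H + rF Di"
      using tf_resolvent[OF di def(2)] by metis
    define T' where "T' = rF Ci * H + rF Di"
    have T': "T' = D' - D' * (rF C * H)" by (simp add: T'_def F mult.assoc)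
    have "sc z * (G * T') = rF A * (G * T') + rF B * T'"
      using G(2) by (simp add: distrib_right flip: mult.assoc)
    moreover have "sc z * H = rF A * H + rF B * T'"
      unfolding H(2) F T' by (simp add: algebra_simps)
    ultimately have "rF A * (H - G * T') = sc z * (H - G * T')" by (simp add: right_diff_distrib)
    moreover have "rw n (H - G * T')" using G H by simp
    ultimately have "H - G * T' = 0" using G(5) by blast
    then have GT: "G * T' = H" by simp
    have "(rF C * G + rF D) * T' = rF C * H + rF D * T'" by (simp add: distrib_right mult.assoc GT)
    also have "rF D * T' = proj p - rF C * H"
    proof -
      have "rF D * T' = rF D * D' - rF D * D' * (rF C * H)" by (simp add: T' right_diff_distrib mult.assoc)
      then show ?thesis using D'(4) dims by simp
    qed
    finally have "(rF C * G + rF D) * T' = proj p" by simp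
    then have "toF (tf (A, B, C, D) z * tf (Ai, Bi, Ci, Di) z) = toF (1\<^sub>m p)"
      using G(3,4) H(3,4) by (simp add: toF_mult toF_one T'_def)
    then have 1: "tf (A, B, C, D) z * tf (Ai, Bi, Ci, Di) z = 1\<^sub>m p"
      by (intro toF_inject[of _ p p]) (use G(3) H(3) in auto)
    then show ?thesis using mat_mult_left_right_inverse[OF G(3) H(3) 1] by simp
  qed
  ultimately show ?thesis unfolding stable_inverse_def by (intro exI[of _ "(Ai, Bi, Ci, Di)"]) simp
qed

lemma tf_circle:
  assumes dims: "A \<in> carrier_mat n n" "B \<in> carrier_mat n m" "C \<in> carrier_mat s n" "D \<in> carrier_mat s m"
    and st: "stab (rF A)" and z: "cmod z = 1"
  obtains F where "rw n F" "cl m F" "sc z * F = rF A * F + rF B"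
    "tf (A, B, C, D) z \<in> carrier_mat s m" "toF (tf (A, B, C, D) z) = rF C * F + rF D"
    "tf (A, B, C, D) (inverse z) \<in> carrier_mat s m" "toF (tf (A, B, C, D) (inverse z)) = cj (rF C * F + rF D)"
proof -
  have def: "defined_at (A, B, C, D) w" if "cmod w = 1" for w
  proof (rule defined_atI[OF dims(1)])
    fix x assume "rF A * x = sc w * x"
    then show "x = 0" using st that unfolding stab_def by force
  qed
  have iz: "cmod (inverse z) = 1" using z by (simp add: norm_inverse)
  obtain F where F: "rw n F" "cl m F" "sc z * F = rF A * F + rF B"
    "tf (A, B, C, D) z \<in> carrier_mat s m" "toF (tf (A, B, C, D) z) = rF C * F + rF D"
    using tf_resolvent[OF dims def[OF z]] by metis
  have "tf (A, B, C, D) (inverse z) \<in> carrier_mat s m" using tf_resolvent[OF dims def[OF iz]] by metis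
  moreover have "toF (tf (A, B, C, D) (inverse z)) = cj (rF C * F + rF D)"
    using tf_cnj[OF dims z def[OF z] def[OF iz]] unfolding F(5) .
  ultimately show ?thesis using that F by blast
qed

text \<open>The state is determined by the input as \<open>F * u\<close>, so positivity of the
  Hermitian matrix at \<open>z\<close> is positivity along solutions of the state equation.\<close>

lemma frequency_positive:
  assumes dims: "A \<in> carrier_mat n n" "B \<in> carrier_mat n (q + p)" "C \<in> carrier_mat s n" "D \<in> carrier_mat s (q + p)"
    "M \<in> carrier_mat s s"
    and dec: "decay (rF A)" and z: "cmod z = 1"
    and pos: "pos_def (para (\<lambda>z. cols_first q (tf (A, B, C, D) z)) (cm M) (\<lambda>z. cols_first q (tf (A, B, C, D) z)) z)"
    and x: "rw q u" "sc z * x = rF A * x + rF B * proj q * u" "0 < nsq u"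
  shows "0 < re (adj (rF C * x + rF D * proj q * u) * (rF M * (rF C * x + rF D * proj q * u)))"
proof -
  have st: "stab (rF A)" by (rule decay_stab[OF dec rF_rw[OF dims(1)]])
  obtain F where F: "rw n F" "cl (q + p) F" "sc z * F = rF A * F + rF B"
    "tf (A, B, C, D) z \<in> carrier_mat s (q + p)" "toF (tf (A, B, C, D) z) = rF C * F + rF D"
    "tf (A, B, C, D) (inverse z) \<in> carrier_mat s (q + p)" "toF (tf (A, B, C, D) (inverse z)) = cj (rF C * F + rF D)"
    using tf_circle[OF dims(1-4) st z] by metis
  define T1 where "T1 = (rF C * F + rF D) * proj q"
  define \<Psi>1 where "\<Psi>1 = (\<lambda>z. cols_first q (tf (A, B, C, D) z))"
  have c1: "\<Psi>1 (inverse z) \<in> carrier_mat s q" "\<Psi>1 z \<in> carrier_mat s q"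
    "toF (\<Psi>1 (inverse z)) = cj T1" "toF (\<Psi>1 z) = T1"
    using toF_cols_first[OF F(6)] toF_cols_first[OF F(4)] F(5,7) by (simp_all add: \<Psi>1_def T1_def)
  note H = para_toF[where ?G1.0 = \<Psi>1 and ?G2.0 = \<Psi>1 and z = z, OF c1(1,2) dims(5) c1(3,4)]
  have "sc z * (F * u) = rF A * (F * u) + rF B * proj q * u"
    using F(3) x(1) by (simp add: distrib_right mult.assoc flip: mult.assoc[of "sc z"])
  then have "x = F * u" by (intro resolvent_unique[OF dec rF_rw[OF dims(1)] _ x(2)]) (simp_all add: z)
  then have "rF C * x + rF D * proj q * u = T1 * u" using x(1) by (simp add: T1_def distrib_right mult.assoc)
  moreover have "0 < re (adj u * (adj T1 * (rF M * T1) * u))"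
    using pos_def_form[OF pos[folded \<Psi>1_def] H(1) x(1,3)] unfolding H(2) .
  ultimately show ?thesis by (simp add: mult.assoc)
qed

text \<open>The Schur complement is the value of the form at the input completing \<open>u2\<close> that minimizes it.\<close>
lemma frequency_negative:
  assumes dims: "A \<in> carrier_mat n n" "B \<in> carrier_mat n (q + p)" "C \<in> carrier_mat s n" "D \<in> carrier_mat s (q + p)"
    "M \<in> carrier_mat s s"
    and dec: "decay (rF A)" and z: "cmod z = 1"
  defines "\<Psi>1 \<equiv> (\<lambda>z. cols_first q (tf (A, B, C, D) z))" and "\<Psi>2 \<equiv> (\<lambda>z. cols_last q p (tf (A, B, C, D) z))"
  assumes pos: "pos_def (para \<Psi>1 (cm M) \<Psi>1 z)"
    and neg: "neg_def (para \<Psi>2 (cm M) \<Psi>2 z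
                - para \<Psi>2 (cm M) \<Psi>1 z * minv (para \<Psi>1 (cm M) \<Psi>1 z) * para \<Psi>1 (cm M) \<Psi>2 z)"
    and x: "rw p u2" "sc z * x2 = rF A * x2 + rF B * sh q * u2" "0 < nsq u2"
  shows "\<exists>x1 u1. rw n x1 \<and> rw q u1 \<and> sc z * x1 = rF A * x1 + rF B * proj q * u1 \<and>
    re (adj ((rF C * x1 + rF D * proj q * u1) + (rF C * x2 + rF D * sh q * u2)) *
      (rF M * ((rF C * x1 + rF D * proj q * u1) + (rF C * x2 + rF D * sh q * u2)))) < 0"
proof -
  have st: "stab (rF A)" by (rule decay_stab[OF dec rF_rw[OF dims(1)]])
  obtain F where F: "rw n F" "cl (q + p) F" "sc z * F = rF A * F + rF B"
    "tf (A, B, C, D) z \<in> carrier_mat s (q + p)" "toF (tf (A, B, C, D) z) = rF C * F + rF D"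
    "tf (A, B, C, D) (inverse z) \<in> carrier_mat s (q + p)" "toF (tf (A, B, C, D) (inverse z)) = cj (rF C * F + rF D)"
    using tf_circle[OF dims(1-4) st z] by metis
  define T1 where "T1 = (rF C * F + rF D) * proj q"
  define T2 where "T2 = (rF C * F + rF D) * sh q"
  have c1: "\<Psi>1 (inverse z) \<in> carrier_mat s q" "\<Psi>1 z \<in> carrier_mat s q"
    "toF (\<Psi>1 (inverse z)) = cj T1" "toF (\<Psi>1 z) = T1"
    using toF_cols_first[OF F(6)] toF_cols_first[OF F(4)] F(5,7) by (simp_all add: \<Psi>1_def T1_def)
  have c2: "\<Psi>2 (inverse z) \<in> carrier_mat s p" "\<Psi>2 z \<in> carrier_mat s p"
    "toF (\<Psi>2 (inverse z)) = cj T2" "toF (\<Psi>2 z) = T2"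
    using toF_cols_last[OF F(6)] toF_cols_last[OF F(4)] F(5,7) by (simp_all add: \<Psi>2_def T2_def)
  note H11 = para_toF[where ?G1.0 = \<Psi>1 and ?G2.0 = \<Psi>1 and z = z, OF c1(1,2) dims(5) c1(3,4)]
  note H12 = para_toF[where ?G1.0 = \<Psi>1 and ?G2.0 = \<Psi>2 and z = z, OF c1(1) c2(2) dims(5) c1(3) c2(4)]
  note H21 = para_toF[where ?G1.0 = \<Psi>2 and ?G2.0 = \<Psi>1 and z = z, OF c2(1) c1(2) dims(5) c2(3) c1(4)]
  note H22 = para_toF[where ?G1.0 = \<Psi>2 and ?G2.0 = \<Psi>2 and z = z, OF c2(1,2) dims(5) c2(3,4)]
  note mi = minv_toF[OF H11(1) pos_def_det[OF pos H11(1)]]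
  define W where "W = toF (minv (para \<Psi>1 (cm M) \<Psi>1 z))"
  define S where "S = para \<Psi>2 (cm M) \<Psi>2 z
                - para \<Psi>2 (cm M) \<Psi>1 z * minv (para \<Psi>1 (cm M) \<Psi>1 z) * para \<Psi>1 (cm M) \<Psi>2 z"
  have S: "S \<in> carrier_mat p p" "toF S = adj T2 * (rF M * T2) - adj T2 * (rF M * T1) * W * (adj T1 * (rF M * T2))"
  proof -
    note m = mult_carrier_mat[OF mult_carrier_mat[OF H21(1) mi(1)] H12(1)]
    show "S \<in> carrier_mat p p" unfolding S_def by (rule minus_carrier_mat[OF m])
    show "toF S = adj T2 * (rF M * T2) - adj T2 * (rF M * T1) * W * (adj T1 * (rF M * T2))"
      using H12 H21 H22 mi(1) m by (simp add: S_def toF_minus toF_mult W_def mult.assoc)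
  qed
  \<comment> \<open>The stationary point: \<open>rF M * (T1 * u1 + T2 * u2)\<close> becomes
    orthogonal to the range of \<open>T1\<close>, which reduces the form to the Schur
    complement.\<close>
  define u1 where "u1 = - (W * (adj T1 * (rF M * (T2 * u2))))"
  have u1: "rw q u1" using mi(1) by (simp add: u1_def W_def)
  have T1r: "rw q (adj T1)" by (simp add: T1_def)
  have z1: "adj T1 * (rF M * (T1 * u1 + T2 * u2)) = 0"
  proof -
    have "adj T1 * (rF M * (T1 * u1)) = - (((adj T1 * (rF M * T1)) * W) * (adj T1 * (rF M * (T2 * u2))))"
      by (simp add: u1_def mult.assoc)
    also have "(adj T1 * (rF M * T1)) * W = proj q" using mi(2) unfolding H11(2) W_def .
    also have "proj q * (adj T1 * (rF M * (T2 * u2))) = adj T1 * (rF M * (T2 * u2))" using T1r by simp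
    finally show ?thesis by (simp add: distrib_left)
  qed
  have "adj (T1 * u1 + T2 * u2) * (rF M * (T1 * u1 + T2 * u2)) = adj u2 * (adj T2 * (rF M * (T1 * u1 + T2 * u2)))
      + adj u1 * (adj T1 * (rF M * (T1 * u1 + T2 * u2)))"
    by (simp add: algebra_simps)
  also have "\<dots> = adj u2 * (toF S * u2)" unfolding z1 S(2) by (simp add: u1_def algebra_simps)
  finally have form: "adj (T1 * u1 + T2 * u2) * (rF M * (T1 * u1 + T2 * u2)) = adj u2 * (toF S * u2)" .
  have "0 < re (adj u2 * (toF (- S) * u2))"
    by (rule pos_def_form[of _ p]) (use neg S(1) x in \<open>simp_all add: neg_def_def S_def\<close>)
  then have neg': "re (adj u2 * (toF S * u2)) < 0" by (simp add: toF_uminus)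
  have eq: "sc z * (F * u) = rF A * (F * u) + rF B * u" for u
    using F(3) by (simp add: distrib_right flip: mult.assoc)
  have pu: "proj q * u1 = u1" using u1 by simp
  have "sc z * (F * (sh q * u2)) = rF A * (F * (sh q * u2)) + rF B * sh q * u2"
    using eq[of "sh q * u2"] by (simp add: mult.assoc)
  then have x2: "x2 = F * (sh q * u2)" by (intro resolvent_unique[OF dec rF_rw[OF dims(1)] _ x(2)]) (simp_all add: z)
  have "(rF C * (F * u1) + rF D * proj q * u1) + (rF C * x2 + rF D * sh q * u2) = T1 * u1 + T2 * u2"
    by (simp add: T1_def T2_def x2 pu distrib_right mult.assoc)
  then show ?thesis
    using F(1) u1 eq[of u1] form neg' pu by (intro exI[of _ "F * u1"] exI[of _ u1]) (simp add: mult.assoc)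
qed

text \<open>\<open>L\<close> is the outer factor with block rows state, next state and output, and
  \<open>W\<close> is \<open>diag(-Z, Z, R)\<close>; the product splits into four blocks, one for
  each equation in \<open>K\<close>.\<close>

lemma kyp_block:
  assumes dims: "rw N A" "cl N A" "rw N B" "cl k B" "rw k C" "cl N C" "rw k D" "cl k D" "hm Z" "rw N Z"
  and K: "adj A * (Z * A) - Z + adj C * (R * C) = adj C' * (M * C')"
    "adj A * (Z * B) + adj C * (R * D) = adj C' * (M * D')"
    "adj B * (Z * A) + adj D * (R * C) = adj D' * (M * C')"
    "adj B * (Z * B) + adj D * (R * D) = adj D' * (M * D')"
  defines "L \<equiv> proj N + sh N * (A + sh N * C) + sh N * ((B + sh N * D) * adj (sh N))"
    and "W \<equiv> - Z + sh N * ((Z + sh N * (R * adj (sh N))) * adj (sh N))"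
  shows "adj L * (W * L) = adj (C' + D' * adj (sh N)) * (M * (C' + D' * adj (sh N)))"
proof -
  have cZ: "cl N Z" using dims hm_cl by blast
  have "adj L * (W * L) = (adj A * (Z * A) - Z + adj C * (R * C))
      + (adj A * (Z * B) + adj C * (R * D)) * adj (sh N)
      + sh N * (adj B * (Z * A) + adj D * (R * C))
      + sh N * ((adj B * (Z * B) + adj D * (R * D)) * adj (sh N))"
    unfolding L_def W_def using dims cZ by (simp add: algebra_simps)
  also have "\<dots> = adj (C' + D' * adj (sh N)) * (M * (C' + D' * adj (sh N)))"
    unfolding K by (simp add: algebra_simps)
  finally show ?thesis .
qed

lemma in_RH_stable:
  assumes "A \<in> carrier_mat n n" "B \<in> carrier_mat n m" "C \<in> carrier_mat s n" "D \<in> carrier_mat s m" "stab (rF A)"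
  shows "in_RH (A, B, C, D)"
proof -
  have "wf_rlz (A, B, C, D)" using assms by (simp add: wf_rlz_def)
  then show ?thesis unfolding in_RH_def
    using schur_stable_iff[OF assms(1)] assms(5) by (intro exI[of _ "(A, B, C, D)"]) (simp add: same_tf_def)
qed

lemma rF_signature:
  "rF (four_block_mat (1\<^sub>m q) (0\<^sub>m q p) (0\<^sub>m p q) (- 1\<^sub>m p)) = proj q - sh q * (proj p * adj (sh q))"
  by (subst rF_four_block[of _ q q _ p _ p]) (simp_all add: rF_zero rF_one rF_uminus)

theorem theorem4:
  fixes ns nq np :: nat
    and A\<^sub>\<Psi> B\<^sub>\<Psi> C\<^sub>\<Psi> D\<^sub>\<Psi> M :: "real mat"
  defines "\<Psi> \<equiv> tf (A\<^sub>\<Psi>, B\<^sub>\<Psi>, C\<^sub>\<Psi>, D\<^sub>\<Psi>)"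
  defines "\<Psi>1 \<equiv> (\<lambda>z. cols_first nq (\<Psi> z))"
  defines "\<Psi>2 \<equiv> (\<lambda>z. cols_last nq np (\<Psi> z))"
  defines "Mh \<equiv> four_block_mat (1\<^sub>m nq) (0\<^sub>m nq np) (0\<^sub>m np nq) (- 1\<^sub>m np)"
  assumes dimB: "B\<^sub>\<Psi> \<in> carrier_mat (dim_row A\<^sub>\<Psi>) (nq + np)"
    and dimC: "C\<^sub>\<Psi> \<in> carrier_mat ns (dim_row A\<^sub>\<Psi>)"
    and dimD: "D\<^sub>\<Psi> \<in> carrier_mat ns (nq + np)"
    and minimal: "minimal_rlz (A\<^sub>\<Psi>, B\<^sub>\<Psi>, C\<^sub>\<Psi>, D\<^sub>\<Psi>)"
    and RH: "in_RH (A\<^sub>\<Psi>, B\<^sub>\<Psi>, C\<^sub>\<Psi>, D\<^sub>\<Psi>)"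
    and M_sym: "M \<in> carrier_mat ns ns" "transpose_mat M = M"
    and pos: "\<And>\<zeta>. cmod \<zeta> = 1 \<Longrightarrow> pos_def (para \<Psi>1 (cm M) \<Psi>1 \<zeta>)"
    and neg: "\<And>\<zeta>. cmod \<zeta> = 1 \<Longrightarrow>
       neg_def (para \<Psi>2 (cm M) \<Psi>2 \<zeta>
                - para \<Psi>2 (cm M) \<Psi>1 \<zeta> * minv (para \<Psi>1 (cm M) \<Psi>1 \<zeta>) * para \<Psi>1 (cm M) \<Psi>2 \<zeta>)"
  shows "\<exists>n1 n2 A1 A2 B1 B2 C11 C12 C22 D11 D12 D22 Ah Bh Ch Dh Ch\<^sub>\<Psi> Z.
     A1 \<in> carrier_mat n1 n1 \<and> A2 \<in> carrier_mat n2 n2 \<and>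
     B1 \<in> carrier_mat n1 nq \<and> B2 \<in> carrier_mat n2 np \<and>
     C11 \<in> carrier_mat nq n1 \<and> C12 \<in> carrier_mat nq n2 \<and> C22 \<in> carrier_mat np n2 \<and>
     D11 \<in> carrier_mat nq nq \<and> D12 \<in> carrier_mat nq np \<and> D22 \<in> carrier_mat np np \<and>
     Ah = four_block_mat A1 (0\<^sub>m n1 n2) (0\<^sub>m n2 n1) A2 \<and>
     Bh = four_block_mat B1 (0\<^sub>m n1 np) (0\<^sub>m n2 nq) B2 \<and>
     Ch = four_block_mat C11 C12 (0\<^sub>m np n1) C22 \<and>
     Dh = four_block_mat D11 D12 (0\<^sub>m np nq) D22 \<and>
     in_RH (Ah, Bh, Ch, Dh) \<and>
     (\<forall>\<zeta>. cmod \<zeta> = 1 \<and> defined_at (Ah, Bh, Ch, Dh) \<zeta> \<and> defined_at (Ah, Bh, Ch, Dh) (inverse \<zeta>)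
        \<and> defined_at (A\<^sub>\<Psi>, B\<^sub>\<Psi>, C\<^sub>\<Psi>, D\<^sub>\<Psi>) \<zeta> \<and> defined_at (A\<^sub>\<Psi>, B\<^sub>\<Psi>, C\<^sub>\<Psi>, D\<^sub>\<Psi>) (inverse \<zeta>) \<longrightarrow>
        para (tf (Ah, Bh, Ch, Dh)) (cm Mh) (tf (Ah, Bh, Ch, Dh)) \<zeta> = para \<Psi> (cm M) \<Psi> \<zeta>) \<and>
     in_RH (A2, B2, C22, D22) \<and> stable_inverse np (A2, B2, C22, D22) \<and>
     Ch\<^sub>\<Psi> \<in> carrier_mat ns (n1 + n2) \<and>
     Z \<in> carrier_mat (n1 + n2) (n1 + n2) \<and> transpose_mat Z = Z \<and>
     same_tf (A\<^sub>\<Psi>, B\<^sub>\<Psi>, C\<^sub>\<Psi>, D\<^sub>\<Psi>) (Ah, Bh, Ch\<^sub>\<Psi>, D\<^sub>\<Psi>) \<and>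
     (let L = four_block_mat (1\<^sub>m (n1 + n2)) (0\<^sub>m (n1 + n2) (nq + np)) (Ah @\<^sub>r Ch) (Bh @\<^sub>r Dh);
          W = four_block_mat (- Z) (0\<^sub>m (n1 + n2) (n1 + n2 + (nq + np)))
                (0\<^sub>m (n1 + n2 + (nq + np)) (n1 + n2)) (four_block_mat Z (0\<^sub>m (n1 + n2) (nq + np)) (0\<^sub>m (nq + np) (n1 + n2)) Mh);
          K = hcat Ch\<^sub>\<Psi> D\<^sub>\<Psi>
      in transpose_mat L * W * L = transpose_mat K * M * K)"
proof -
  define n where "n = dim_row A\<^sub>\<Psi>"
  have dims: "A\<^sub>\<Psi> \<in> carrier_mat n n" "B\<^sub>\<Psi> \<in> carrier_mat n (nq + np)" "C\<^sub>\<Psi> \<in> carrier_mat ns n" "D\<^sub>\<Psi> \<in> carrier_mat ns (nq + np)"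
    using minimal dimB dimC dimD by (auto simp: minimal_rlz_def wf_rlz_def n_def)
  have stA: "stab (rF A\<^sub>\<Psi>)" by (rule minimal_stable[OF minimal dims RH])
  have decA: "decay (rF A\<^sub>\<Psi>)" by (rule stab_decay[OF stA rF_rw[OF dims(1)] rF_cl[OF dims(1)]])
  have hmM: "hm (rF M)" using arg_cong[OF M_sym(2), of rF] by (simp add: hm_def rF_transpose)
  \<comment> \<open>The first \<open>nq\<close> columns of \<open>B\<^sub>\<Psi>\<close> and
    \<open>D\<^sub>\<Psi>\<close> belong to the first channel; \<open>sh nq\<close> moves the
    remaining ones to the front.\<close>
  have ring: "rw n (rF A\<^sub>\<Psi>)" "cl n (rF A\<^sub>\<Psi>)" "rw n (rF B\<^sub>\<Psi> * proj nq)" "cl nq (rF B\<^sub>\<Psi> * proj nq)"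
    "rw n (rF B\<^sub>\<Psi> * sh nq)" "cl np (rF B\<^sub>\<Psi> * sh nq)" "rw ns (rF C\<^sub>\<Psi>)" "cl n (rF C\<^sub>\<Psi>)"
    "rw ns (rF D\<^sub>\<Psi> * proj nq)" "cl nq (rF D\<^sub>\<Psi> * proj nq)" "rw ns (rF D\<^sub>\<Psi> * sh nq)" "cl np (rF D\<^sub>\<Psi> * sh nq)"
    "rw ns (rF M)"
    "rl (rF B\<^sub>\<Psi> * proj nq)" "rl (rF B\<^sub>\<Psi> * sh nq)" "rl (rF D\<^sub>\<Psi> * proj nq)" "rl (rF D\<^sub>\<Psi> * sh nq)"
    using dims M_sym(1) cl_mult_sh[OF rF_cl[OF dims(2)]] cl_mult_sh[OF rF_cl[OF dims(4)]] by simp_all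
  have fpos: "0 < re (adj (rF C\<^sub>\<Psi> * x + rF D\<^sub>\<Psi> * proj nq * u) * (rF M * (rF C\<^sub>\<Psi> * x + rF D\<^sub>\<Psi> * proj nq * u)))"
    if "cmod z = 1" "rw n x" "rw nq u" "sc z * x = rF A\<^sub>\<Psi> * x + rF B\<^sub>\<Psi> * proj nq * u" "0 < nsq u" for z x u
    by (rule frequency_positive[OF dims M_sym(1) decA that(1) _ that(3,4,5)])
      (use pos[OF that(1)] in \<open>simp add: \<Psi>1_def \<Psi>_def\<close>)
  have fneg: "\<exists>x1 u1. rw n x1 \<and> rw nq u1 \<and> sc z * x1 = rF A\<^sub>\<Psi> * x1 + rF B\<^sub>\<Psi> * proj nq * u1 \<and>
        re (adj ((rF C\<^sub>\<Psi> * x1 + rF D\<^sub>\<Psi> * proj nq * u1) + (rF C\<^sub>\<Psi> * x2 + rF D\<^sub>\<Psi> * sh nq * u2)) *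
         (rF M * ((rF C\<^sub>\<Psi> * x1 + rF D\<^sub>\<Psi> * proj nq * u1) + (rF C\<^sub>\<Psi> * x2 + rF D\<^sub>\<Psi> * sh nq * u2)))) < 0"
    if "cmod z = 1" "rw n x2" "rw np u2" "sc z * x2 = rF A\<^sub>\<Psi> * x2 + rF B\<^sub>\<Psi> * sh nq * u2" "0 < nsq u2" for z x2 u2
    by (rule frequency_negative[OF dims M_sym(1) decA that(1) _ _ that(3,4,5)])
      (use pos[OF that(1)] neg[OF that(1)] in \<open>simp_all add: \<Psi>1_def \<Psi>2_def \<Psi>_def\<close>)
  obtain n1 n2 V T A1 A2 E1 E2 C11 C12 C22 D11 D12 D22 D22' C1 C2 Z11 Z12 Z22 where
    VT: "rw n V" "cl n1 V" "rw n T" "cl n2 T" "rF A\<^sub>\<Psi> * V = V * A1" "rF B\<^sub>\<Psi> * proj nq = V * E1" "C1 = rF C\<^sub>\<Psi> * V"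
    "T * A2 = rF A\<^sub>\<Psi> * T" "T * E2 = rF B\<^sub>\<Psi> * sh nq" "C2 = rF C\<^sub>\<Psi> * T"
    and d: "rw n1 A1" "cl n1 A1" "rw n2 A2" "cl n2 A2" "rw n1 E1" "cl nq E1" "rw n2 E2" "cl np E2"
    "rw nq C11" "cl n1 C11" "rw nq C12" "cl n2 C12" "rw np C22" "cl n2 C22"
    "rw nq D11" "cl nq D11" "rw nq D12" "cl np D12" "rw np D22" "cl np D22" "rw np D22'" "cl np D22'"
    "hm Z11" "rw n1 Z11" "rw n1 Z12" "cl n2 Z12" "hm Z22" "rw n2 Z22"
    and rl: "rl A1" "rl A2" "rl E1" "rl E2" "rl C11" "rl C12" "rl C22" "rl D11" "rl D12" "rl D22" "rl D22'" "rl C1" "rl C2"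
    "rl Z11" "rl Z12" "rl Z22"
    and dec: "decay A1" "decay A2" and D22': "D22 * D22' = proj np" "D22' * D22 = proj np" "decay (A2 - E2 * (D22' * C22))"
    and K: "adj A1 * (Z11 * A1) - Z11 + adj C11 * C11 = adj C1 * (rF M * C1)"
    "adj A1 * (Z11 * E1) + adj C11 * D11 = adj C1 * (rF M * (rF D\<^sub>\<Psi> * proj nq))"
    "adj E1 * (Z11 * E1) + adj D11 * D11 = adj (rF D\<^sub>\<Psi> * proj nq) * (rF M * (rF D\<^sub>\<Psi> * proj nq))"
    "adj A1 * (Z12 * A2) - Z12 + adj C11 * C12 = adj C1 * (rF M * C2)"
    "adj A1 * (Z12 * E2) + adj C11 * D12 = adj C1 * (rF M * (rF D\<^sub>\<Psi> * sh nq))"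
    "adj E1 * (Z12 * A2) + adj D11 * C12 = adj (rF D\<^sub>\<Psi> * proj nq) * (rF M * C2)"
    "adj E1 * (Z12 * E2) + adj D11 * D12 = adj (rF D\<^sub>\<Psi> * proj nq) * (rF M * (rF D\<^sub>\<Psi> * sh nq))"
    "adj A2 * (Z22 * A2) - Z22 + adj C12 * C12 - adj C22 * C22 = adj C2 * (rF M * C2)"
    "adj A2 * (Z22 * E2) + adj C12 * D12 - adj C22 * D22 = adj C2 * (rF M * (rF D\<^sub>\<Psi> * sh nq))"
    "adj E2 * (Z22 * E2) + adj D12 * D12 - adj D22 * D22 = adj (rF D\<^sub>\<Psi> * sh nq) * (rF M * (rF D\<^sub>\<Psi> * sh nq))"
    by (rule triangular_factor[OF decA ring(1-12) hmM ring(13) rF_rl ring(14,15) rF_rl ring(16,17) rF_rl fpos fneg])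
      (assumption | rule that)+
  define N where "N = n1 + n2"
  define k where "k = nq + np"
  define A1m where "A1m = ofR n1 n1 A1"
  define A2m where "A2m = ofR n2 n2 A2"
  define B1m where "B1m = ofR n1 nq E1"
  define B2m where "B2m = ofR n2 np E2"
  define C11m where "C11m = ofR nq n1 C11"
  define C12m where "C12m = ofR nq n2 C12"
  define C22m where "C22m = ofR np n2 C22"
  define D11m where "D11m = ofR nq nq D11"
  define D12m where "D12m = ofR nq np D12"
  define D22m where "D22m = ofR np np D22"
  note mdefs = A1m_def A2m_def B1m_def B2m_def C11m_def C12m_def C22m_def D11m_def D12m_def D22m_def
  have cm': "A1m \<in> carrier_mat n1 n1" "A2m \<in> carrier_mat n2 n2" "B1m \<in> carrier_mat n1 nq" "B2m \<in> carrier_mat n2 np"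
    "C11m \<in> carrier_mat nq n1" "C12m \<in> carrier_mat nq n2" "C22m \<in> carrier_mat np n2"
    "D11m \<in> carrier_mat nq nq" "D12m \<in> carrier_mat nq np" "D22m \<in> carrier_mat np np"
    by (simp_all add: mdefs)
  have rFm: "rF A1m = A1" "rF A2m = A2" "rF B1m = E1" "rF B2m = E2" "rF C11m = C11" "rF C12m = C12" "rF C22m = C22"
    "rF D11m = D11" "rF D12m = D12" "rF D22m = D22"
    unfolding mdefs by (simp_all only: rF_ofR d rl)
  define Ah where "Ah = four_block_mat A1m (0\<^sub>m n1 n2) (0\<^sub>m n2 n1) A2m"
  define Bh where "Bh = four_block_mat B1m (0\<^sub>m n1 np) (0\<^sub>m n2 nq) B2m"
  define Ch where "Ch = four_block_mat C11m C12m (0\<^sub>m np n1) C22m"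
  define Dh where "Dh = four_block_mat D11m D12m (0\<^sub>m np nq) D22m"
  have ch: "Ah \<in> carrier_mat N N" "Bh \<in> carrier_mat N k" "Ch \<in> carrier_mat k N" "Dh \<in> carrier_mat k k"
    using cm' by (simp_all add: Ah_def Bh_def Ch_def Dh_def N_def k_def)
  have rh: "rF Ah = A1 + sh n1 * (A2 * adj (sh n1))" "rF Bh = E1 + sh n1 * (E2 * adj (sh nq))"
    "rF Ch = C11 + C12 * adj (sh n1) + sh nq * (C22 * adj (sh n1))"
    "rF Dh = D11 + D12 * adj (sh nq) + sh nq * (D22 * adj (sh nq))"
    unfolding Ah_def Bh_def Ch_def Dh_def
    using rF_four_block[OF cm'(1) zero_carrier_mat zero_carrier_mat cm'(2)]
      rF_four_block[OF cm'(3) zero_carrier_mat zero_carrier_mat cm'(4)]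
      rF_four_block[OF cm'(5,6) zero_carrier_mat cm'(7)] rF_four_block[OF cm'(8,9) zero_carrier_mat cm'(10)]
    by (simp_all add: rF_zero rFm)
  define Zr where "Zr = Z11 + Z12 * adj (sh n1) + sh n1 * adj Z12 + sh n1 * (Z22 * adj (sh n1))"
  have cN: "cl N X" if "cl n1 X" for X using cl_mono[OF that] by (simp add: N_def)
  have rN: "rw N X" if "rw n1 X" for X using rw_mono[OF that] by (simp add: N_def)
  have rsh: "rw N (sh n1 * X)" if "rw n2 X" for X using that by (simp add: N_def)
  have Zr: "hm Zr" "rw N Zr" "cl N Zr" "rl Zr"
  proof -
    show hZ: "hm Zr" using hm_adj[OF d(23)] hm_adj[OF d(27)] by (simp add: Zr_def hm_def mult.assoc add_ac)
    show "rw N Zr" unfolding Zr_def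
      by (intro rw_closure(1) rN[OF d(24)] rN[OF rw_mult[OF d(25)]] rsh rw_mult[OF d(28)]) (simp add: d)
    then show "cl N Zr" using hZ hm_cl by blast
    show "rl Zr" using rl by (simp add: Zr_def)
  qed
  define Z where "Z = ofR N N Zr"
  define Cm where "Cm = ofR ns N (C1 + C2 * adj (sh n1))"
  have Z: "Z \<in> carrier_mat N N" "rF Z = Zr" using Zr by (simp_all add: Z_def rF_ofR)
  have Cm: "Cm \<in> carrier_mat ns N" "rF Cm = C1 + C2 * adj (sh n1)"
  proof -
    have "cl N (C1 + C2 * adj (sh n1))" unfolding VT(7,10)
      using cl_closure(1)[OF cN[OF cl_mult[OF VT(2)]] cl_sh[OF cl_mult[OF VT(4)], of n1, folded N_def]] .
    moreover have "rw ns (C1 + C2 * adj (sh n1))" using ring by (simp add: VT)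
    ultimately show "rF Cm = C1 + C2 * adj (sh n1)" unfolding Cm_def using rl by (intro rF_ofR) simp_all
  qed (simp add: Cm_def)
  have Dsplit: "rF D\<^sub>\<Psi> = rF D\<^sub>\<Psi> * proj nq + rF D\<^sub>\<Psi> * sh nq * adj (sh nq)" by (rule split_cols[OF rF_cl[OF dims(4)]])
  have Bsplit: "rF B\<^sub>\<Psi> = rF B\<^sub>\<Psi> * proj nq + rF B\<^sub>\<Psi> * sh nq * adj (sh nq)" by (rule split_cols[OF rF_cl[OF dims(2)]])
  have Mh: "Mh \<in> carrier_mat k k" "rF Mh = proj nq - sh nq * (proj np * adj (sh nq))"
    unfolding Mh_def k_def by simp (rule rF_signature)
  note kyp = composite_kyp[OF d(1-20,23-28) hmM K, folded rh Mh(2) Zr_def Cm(2) Dsplit]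
  have stAh: "stab (rF Ah)" unfolding rh by (rule block_diag_stab[OF dec(1) d(1,2) dec(2) d(3,4)])
  have st: "same_tf (A\<^sub>\<Psi>, B\<^sub>\<Psi>, C\<^sub>\<Psi>, D\<^sub>\<Psi>) (Ah, Bh, Cm, D\<^sub>\<Psi>)" unfolding same_tf_def
  proof (intro allI impI, elim conjE)
    fix z assume def: "defined_at (A\<^sub>\<Psi>, B\<^sub>\<Psi>, C\<^sub>\<Psi>, D\<^sub>\<Psi>) z" "defined_at (Ah, Bh, Cm, D\<^sub>\<Psi>) z"
    obtain F where F: "tf (A\<^sub>\<Psi>, B\<^sub>\<Psi>, C\<^sub>\<Psi>, D\<^sub>\<Psi>) z \<in> carrier_mat ns k" "toF (tf (A\<^sub>\<Psi>, B\<^sub>\<Psi>, C\<^sub>\<Psi>, D\<^sub>\<Psi>) z) = rF C\<^sub>\<Psi> * F + rF D\<^sub>\<Psi>"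
      "\<And>F'. rw n F' \<Longrightarrow> sc z * F' = rF A\<^sub>\<Psi> * F' + rF B\<^sub>\<Psi> \<Longrightarrow> F' = F"
      using tf_resolvent[OF dims def(1)] unfolding k_def by metis
    obtain G where G: "sc z * G = rF Ah * G + rF Bh" "tf (Ah, Bh, Cm, D\<^sub>\<Psi>) z \<in> carrier_mat ns k"
      "toF (tf (Ah, Bh, Cm, D\<^sub>\<Psi>) z) = rF Cm * G + rF D\<^sub>\<Psi>"
      using tf_resolvent[OF ch(1,2) Cm(1) dims(4)[folded k_def] def(2)] by metis
    \<comment> \<open>\<open>J\<close> maps the duplicated state back to the state of
      \<open>\<Psi>\<close> and intertwines the two realizations.\<close>
    define J where "J = V + T * adj (sh n1)"
    have JA: "J * rF Ah = rF A\<^sub>\<Psi> * J"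
    proof -
      have "J * rF Ah = V * A1 + (T * A2) * adj (sh n1)"
        unfolding J_def rh using VT(2) d by (simp add: algebra_simps)
      then show ?thesis unfolding VT(8) VT(5)[symmetric] by (simp add: J_def algebra_simps)
    qed
    have JB: "J * rF Bh = rF B\<^sub>\<Psi>"
    proof -
      have "J * rF Bh = V * E1 + (T * E2) * adj (sh nq)"
        unfolding J_def rh using VT(2) d by (simp add: algebra_simps)
      then show ?thesis unfolding VT(9) VT(6)[symmetric] Bsplit[symmetric] .
    qed
    have JC: "rF C\<^sub>\<Psi> * J = rF Cm" unfolding J_def Cm VT(7,10) by (simp add: algebra_simps)
    have "sc z * (J * G) = J * (sc z * G)" by (simp add: mult_sc_left)
    also have "\<dots> = (J * rF Ah) * G + J * rF Bh" unfolding G(1) by (simp add: distrib_left mult.assoc)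
    also have "\<dots> = rF A\<^sub>\<Psi> * (J * G) + rF B\<^sub>\<Psi>" unfolding JA JB by (simp add: mult.assoc)
    finally have "J * G = F" by (intro F(3)) (simp_all add: J_def VT)
    then have "rF C\<^sub>\<Psi> * F = rF Cm * G" unfolding JC[symmetric] by (simp add: mult.assoc)
    then show "tf (A\<^sub>\<Psi>, B\<^sub>\<Psi>, C\<^sub>\<Psi>, D\<^sub>\<Psi>) z = tf (Ah, Bh, Cm, D\<^sub>\<Psi>) z"
      by (intro toF_inject[OF F(1) G(2)]) (simp add: F(2) G(3))
  qed
  have fac: "para (tf (Ah, Bh, Ch, Dh)) (cm Mh) (tf (Ah, Bh, Ch, Dh)) z = para \<Psi> (cm M) \<Psi> z" if z: "cmod z = 1" for z
  proof -
    obtain F where F: "sc z * F = rF Ah * F + rF Bh"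
      "tf (Ah, Bh, Ch, Dh) z \<in> carrier_mat k k" "toF (tf (Ah, Bh, Ch, Dh) z) = rF Ch * F + rF Dh"
      "tf (Ah, Bh, Ch, Dh) (inverse z) \<in> carrier_mat k k" "toF (tf (Ah, Bh, Ch, Dh) (inverse z)) = cj (rF Ch * F + rF Dh)"
      using tf_circle[OF ch stAh z] by metis
    obtain G where G: "sc z * G = rF Ah * G + rF Bh" "toF (tf (Ah, Bh, Cm, D\<^sub>\<Psi>) z) = rF Cm * G + rF D\<^sub>\<Psi>"
      using tf_circle[OF ch(1,2) Cm(1) dims(4)[folded k_def] stAh z] by metis
    have decAh: "decay (rF Ah)" by (rule stab_decay[OF stAh rF_rw[OF ch(1)] rF_cl[OF ch(1)]])
    have FG: "G = F" using resolvent_unique[OF decAh rF_rw[OF ch(1)] _ G(1) F(1)] z by simp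
    obtain H where H: "\<Psi> z \<in> carrier_mat ns k" "toF (\<Psi> z) = rF C\<^sub>\<Psi> * H + rF D\<^sub>\<Psi>"
      "\<Psi> (inverse z) \<in> carrier_mat ns k" "toF (\<Psi> (inverse z)) = cj (rF C\<^sub>\<Psi> * H + rF D\<^sub>\<Psi>)"
      using tf_circle[OF dims stA z] unfolding \<Psi>_def k_def by metis
    have defs: "defined_at (A\<^sub>\<Psi>, B\<^sub>\<Psi>, C\<^sub>\<Psi>, D\<^sub>\<Psi>) z" "defined_at (Ah, Bh, Cm, D\<^sub>\<Psi>) z"
      using stA stAh z unfolding stab_def by (force intro!: defined_atI[OF dims(1)] defined_atI[OF ch(1)])+
    \<comment> \<open>The storage identity is about the output \<open>Cm\<close>; \<open>st\<close>
      allows the value of \<open>\<Psi>\<close> to be read off that realization.\<close>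
    have CH: "rF C\<^sub>\<Psi> * H + rF D\<^sub>\<Psi> = rF Cm * F + rF D\<^sub>\<Psi>"
      using st defs G(2) H(2) unfolding same_tf_def FG \<Psi>_def by metis
    note P1 = para_toF[where ?G1.0 = "tf (Ah, Bh, Ch, Dh)" and ?G2.0 = "tf (Ah, Bh, Ch, Dh)" and z = z, OF F(4,2) Mh(1) F(5,3)]
    note P2 = para_toF[where ?G1.0 = \<Psi> and ?G2.0 = \<Psi> and z = z, OF H(3,1) M_sym(1) H(4,2), unfolded CH]
    \<comment> \<open>The input \<open>1\<close> treats all input columns at once, so
      \<open>kyp_frequency\<close> yields the identity of whole matrices.\<close>
    have u: "sc z * F = rF Ah * F + rF Bh * 1" using F(1) by simp
    have "adj (rF Ch * F + rF Dh * 1) * (rF Mh * (rF Ch * F + rF Dh * 1)) =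
      adj F * ((adj (rF Cm) * (rF M * rF Cm)) * F) + adj F * ((adj (rF Cm) * (rF M * rF D\<^sub>\<Psi>)) * 1)
      + adj 1 * ((adj (rF D\<^sub>\<Psi>) * (rF M * rF Cm)) * F) + adj 1 * ((adj (rF D\<^sub>\<Psi>) * (rF M * rF D\<^sub>\<Psi>)) * 1)"
      by (rule kyp_frequency[OF kyp z u u])
    also have "\<dots> = adj (rF Cm * F + rF D\<^sub>\<Psi>) * (rF M * (rF Cm * F + rF D\<^sub>\<Psi>))"
      by (simp add: algebra_simps)
    finally have "toF (para (tf (Ah, Bh, Ch, Dh)) (cm Mh) (tf (Ah, Bh, Ch, Dh)) z) = toF (para \<Psi> (cm M) \<Psi> z)"
      unfolding P1(2) P2(2) by simp
    then show ?thesis by (rule toF_inject[OF P1(1) P2(1)])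
  qed
  have inv: "stable_inverse np (A2m, B2m, C22m, D22m)"
    by (rule stable_inverse_realization[OF cm'(2,4,7,10) d(21,22) rl(11)]) (simp_all only: rFm D22')
  have final: "transpose_mat L * W * L = transpose_mat K * M * K"
    if L: "L = four_block_mat (1\<^sub>m N) (0\<^sub>m N k) (Ah @\<^sub>r Ch) (Bh @\<^sub>r Dh)"
      and W: "W = four_block_mat (- Z) (0\<^sub>m N (N + k)) (0\<^sub>m (N + k) N) (four_block_mat Z (0\<^sub>m N k) (0\<^sub>m k N) Mh)"
      and Kd: "K = hcat Cm D\<^sub>\<Psi>" for L W K
  proof -
    have ar: "Ah @\<^sub>r Ch \<in> carrier_mat (N + k) N" "Bh @\<^sub>r Dh \<in> carrier_mat (N + k) k"
      using ch by (auto intro: carrier_append_rows)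
    have in4: "four_block_mat Z (0\<^sub>m N k) (0\<^sub>m k N) Mh \<in> carrier_mat (N + k) (N + k)" using Z Mh by simp
    have cL: "L \<in> carrier_mat (N + (N + k)) (N + k)" unfolding L using ar by simp
    have cW: "W \<in> carrier_mat (N + (N + k)) (N + (N + k))" unfolding W using Z(1) in4 by simp
    have cK: "K \<in> carrier_mat ns (N + k)" unfolding Kd hcat_def using Cm(1) dims(4) by (auto simp: k_def)
    have rL: "rF L = proj N + sh N * (rF Ah + sh N * rF Ch) + sh N * ((rF Bh + sh N * rF Dh) * adj (sh N))"
      unfolding L using rF_four_block[OF one_carrier_mat zero_carrier_mat ar]
      by (simp add: rF_zero rF_one rF_append_rows[OF ch(1,3)] rF_append_rows[OF ch(2,4)])
    have rW: "rF W = - rF Z + sh N * ((rF Z + sh N * (rF Mh * adj (sh N))) * adj (sh N))"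
      unfolding W using rF_four_block[OF uminus_carrier_mat[OF Z(1)] zero_carrier_mat zero_carrier_mat in4]
        rF_four_block[OF Z(1) zero_carrier_mat zero_carrier_mat Mh(1)]
      by (simp add: rF_zero rF_uminus)
    have rK: "rF K = rF Cm + rF D\<^sub>\<Psi> * adj (sh N)" unfolding Kd by (rule rF_hcat[OF Cm(1) dims(4)])
    have "adj (rF L) * (rF W * rF L) = adj (rF K) * (rF M * rF K)"
      unfolding rL rW rK
      by (rule kyp_block[OF rF_rw[OF ch(1)] rF_cl[OF ch(1)] rF_rw[OF ch(2)] rF_cl[OF ch(2)]
          rF_rw[OF ch(3)] rF_cl[OF ch(3)] rF_rw[OF ch(4)] rF_cl[OF ch(4)] _ rF_rw[OF Z(1)]])
        (use Zr(1) kyp Z(2) in simp_all)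
    then have "rF (transpose_mat L * W * L) = rF (transpose_mat K * M * K)"
      using cL cW cK M_sym(1) by (simp add: rF_mult rF_transpose mult.assoc)
    then show ?thesis
      by (intro rF_inject[of _ "N + k" "N + k"]) (use cL cW cK M_sym(1) in auto)
  qed
  have Zt: "transpose_mat Z = Z"
    using Zr(1) Z by (intro rF_inject[of _ N N]) (simp_all add: rF_transpose hm_adj)
  show ?thesis
    apply (rule exI[of _ n1], rule exI[of _ n2], rule exI[of _ A1m], rule exI[of _ A2m], rule exI[of _ B1m], rule exI[of _ B2m])
    apply (rule exI[of _ C11m], rule exI[of _ C12m], rule exI[of _ C22m], rule exI[of _ D11m], rule exI[of _ D12m], rule exI[of _ D22m])
    apply (rule exI[of _ Ah], rule exI[of _ Bh], rule exI[of _ Ch], rule exI[of _ Dh], rule exI[of _ Cm], rule exI[of _ Z])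
    unfolding Let_def N_def[symmetric] k_def[symmetric]
    using cm' fac inv Z(1) Cm(1) Zt st final[OF refl refl refl]
      in_RH_stable[OF ch stAh] in_RH_stable[OF cm'(2,4,7,10)] decay_stab[OF dec(2) d(3)]
    by (simp add: rFm Ah_def Bh_def Ch_def Dh_def)
qed

end
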